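(* Let $M$ be a simple binary matroid that is not a binary comatroid but such that $M|F$ is a binary comatroid for every proper flat $F$ of $M$, and suppose $r(M)\ge 6$. Then $M$ or $M^c$ is a circuit.
   Context: All matroids are simple. Every simple binary matroid $M$ is uniquely $GF(2)$-representable, so for $k\ge r(M)$ one can write $M\cong PG(k-1,2)|T$, and the $(GF(2),k)$-complement of $M$ is $PG(k-1,2)\backslash T$ (well defined up to isomorphism); $M^c$ denotes the $(GF(2),r(M))$-complement of $M$. Binary comatroids are defined recursively: $U_{0,0}$ is one; the direct sum of two is one; and the $(GF(2),t)$-complement of one is one for every $t\ge r(M)$. *)

theory Defs
  imports Complex_Main "HOL-Library.Z2" "HOL-Library.Function_Algebras"
begin

section \<open>Finite matroids\<close>

record 'a matroid =
  ground :: "'a set"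
  indeps :: "'a set set"

definition matroid :: "'a matroid \<Rightarrow> bool" where
  "matroid M \<longleftrightarrow>
     finite (ground M) \<and>
     (\<forall>I\<in>indeps M. I \<subseteq> ground M) \<and>
     {} \<in> indeps M \<and>
     (\<forall>I\<in>indeps M. \<forall>J\<subseteq>I. J \<in> indeps M) \<and>
     (\<forall>I\<in>indeps M. \<forall>J\<in>indeps M. card I < card J \<longrightarrow> (\<exists>x\<in>J - I. insert x I \<in> indeps M))"

definition matroid_circuit :: "'a matroid \<Rightarrow> 'a set \<Rightarrow> bool" where
  "matroid_circuit M C \<longleftrightarrow> C \<subseteq> ground M \<and> C \<notin> indeps M \<and> (\<forall>D. D \<subset> C \<longrightarrow> D \<in> indeps M)"

definition is_circuit :: "'a matroid \<Rightarrow> bool" where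
  "is_circuit M \<longleftrightarrow> matroid_circuit M (ground M)"

text \<open>No loops (circuits of size 1) and no parallel pairs (circuits of size 2).\<close>

definition simple_matroid :: "'a matroid \<Rightarrow> bool" where
  "simple_matroid M \<longleftrightarrow> (\<forall>C. matroid_circuit M C \<longrightarrow> 3 \<le> card C)"

definition matroid_rank_of :: "'a matroid \<Rightarrow> 'a set \<Rightarrow> nat" where
  "matroid_rank_of M X = Max (card ` {I \<in> indeps M. I \<subseteq> X})"

definition matroid_rank :: "'a matroid \<Rightarrow> nat" where
  "matroid_rank M = matroid_rank_of M (ground M)"

definition matroid_closure :: "'a matroid \<Rightarrow> 'a set \<Rightarrow> 'a set" where
  "matroid_closure M X = {x \<in> ground M. matroid_rank_of M (insert x X) = matroid_rank_of M X}"

definition matroid_flat :: "'a matroid \<Rightarrow> 'a set \<Rightarrow> bool" where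
  "matroid_flat M F \<longleftrightarrow> F \<subseteq> ground M \<and> matroid_closure M F = F"

definition restriction :: "'a matroid \<Rightarrow> 'a set \<Rightarrow> 'a matroid" where
  "restriction M X = \<lparr>ground = ground M \<inter> X, indeps = {I \<in> indeps M. I \<subseteq> X}\<rparr>"

definition deletion :: "'a matroid \<Rightarrow> 'a set \<Rightarrow> 'a matroid" where
  "deletion M X = restriction M (ground M - X)"

text \<open>Only meaningful when the two ground sets are disjoint.\<close>

definition matroid_sum :: "'a matroid \<Rightarrow> 'a matroid \<Rightarrow> 'a matroid" where
  "matroid_sum M N =
     \<lparr>ground = ground M \<union> ground N, indeps = {I \<union> J | I J. I \<in> indeps M \<and> J \<in> indeps N}\<rparr>"

definition U00 :: "'a matroid" where
  "U00 = \<lparr>ground = {}, indeps = {{}}\<rparr>"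

definition matroid_iso :: "'a matroid \<Rightarrow> 'b matroid \<Rightarrow> bool" where
  "matroid_iso M N \<longleftrightarrow>
     (\<exists>f. bij_betw f (ground M) (ground N) \<and>
          (\<forall>X\<subseteq>ground M. X \<in> indeps M \<longleftrightarrow> f ` X \<in> indeps N))"

section \<open>Binary matroids\<close>

text \<open>The space \<open>GF(2)\<^sup>k\<close> is the set of functions \<open>nat \<Rightarrow> bit\<close> supported on \<open>{..<k}\<close>.\<close>

type_synonym gf2_vec = "nat \<Rightarrow> bit"

definition gf2_scale :: "bit \<Rightarrow> gf2_vec \<Rightarrow> gf2_vec" where
  "gf2_scale c v = (\<lambda>i. c * v i)"

interpretation gf2: vector_space gf2_scale
  by unfold_locales (auto simp: gf2_scale_def fun_eq_iff algebra_simps)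

definition gf2_space :: "nat \<Rightarrow> gf2_vec set" where
  "gf2_space k = {v. \<forall>i\<ge>k. v i = 0}"

text \<open>Representability over \<open>GF(2)\<close>: the element \<open>x\<close> labels the column \<open>\<phi> x\<close> of a
  matrix with \<open>k\<close> rows.\<close>

definition binary_matroid :: "'a matroid \<Rightarrow> bool" where
  "binary_matroid M \<longleftrightarrow>
     (\<exists>k \<phi>. \<phi> ` ground M \<subseteq> gf2_space k \<and>
        (\<forall>X\<subseteq>ground M. X \<in> indeps M \<longleftrightarrow> inj_on \<phi> X \<and> gf2.independent (\<phi> ` X)))"

text \<open>\<open>PG2 k\<close> is \<open>PG(k - 1, 2)\<close>; over \<open>GF(2)\<close> a point of the projective space is the same as a
  nonzero vector.  \<open>PG2 0\<close> is the empty matroid.\<close>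

definition PG2 :: "nat \<Rightarrow> gf2_vec matroid" where
  "PG2 k = \<lparr>ground = gf2_space k - {0},
            indeps = {I. I \<subseteq> gf2_space k - {0} \<and> gf2.independent I}\<rparr>"

interpretation gf2: vector_space_pair gf2_scale gf2_scale ..

lemma subspace_gf2_space: "gf2.subspace (gf2_space k)"
  by (auto simp: gf2.subspace_def gf2_space_def gf2_scale_def)

lemma finite_gf2_space: "finite (gf2_space k)"
proof -
  have u: "(UNIV :: bit set) = {0, 1}"
    using bit_not_zero_iff by blast
  have "gf2_space k \<subseteq> {f. \<forall>x. (x \<in> {..<k} \<longrightarrow> f x \<in> UNIV) \<and> (x \<notin> {..<k} \<longrightarrow> f x = 0)}"
    by (auto simp: gf2_space_def)
  moreover have "finite {f. \<forall>x. (x \<in> {..<k} \<longrightarrow> f x \<in> (UNIV :: bit set)) \<and> (x \<notin> {..<k} \<longrightarrow> f x = 0)}"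
    by (rule finite_set_of_finite_funs) (simp_all add: u)
  ultimately show ?thesis by (rule finite_subset)
qed

lemma gf2_span_sum:
  assumes "t \<in> gf2.span S"
  shows "\<exists>A\<subseteq>S. finite A \<and> t = \<Sum>A"
proof -
  obtain A r where A: "finite A" "A \<subseteq> S" "t = (\<Sum>a\<in>A. gf2_scale (r a) a)"
    using assms unfolding gf2.span_explicit by blast
  have "t = (\<Sum>a\<in>{a\<in>A. r a \<noteq> 0}. gf2_scale (r a) a)"
    unfolding A(3) using A(1) by (intro sum.mono_neutral_right) auto
  also have "\<dots> = \<Sum>{a\<in>A. r a \<noteq> 0}"
    by (intro sum.cong) auto
  finally show ?thesis using A by (intro exI[of _ "{a\<in>A. r a \<noteq> 0}"]) auto
qed

lemma gf2_sum_unique: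
  assumes B: "gf2.independent B" and A: "A \<subseteq> B" "finite A" and C: "C \<subseteq> B" "finite C"
    and eq: "\<Sum>A = \<Sum>C"
  shows "A = C"
proof -
  have sub: "X \<subseteq> Y" if "X \<subseteq> B" "finite X" "Y \<subseteq> B" "finite Y" "\<Sum>X = \<Sum>Y" for X Y
  proof
    fix x assume x: "x \<in> X"
    define u where "u a = (if a \<in> X then 1 else 0) - (if a \<in> Y then 1 else (0::bit))" for a
    have s: "(\<Sum>a\<in>X \<union> Y. gf2_scale (if a \<in> Z then 1 else 0) a) = \<Sum>Z"
      if "Z \<subseteq> X \<union> Y" for Z
    proof -
      have "(\<Sum>a\<in>X \<union> Y. gf2_scale (if a \<in> Z then 1 else 0) a)
          = (\<Sum>a\<in>Z. gf2_scale (if a \<in> Z then 1 else 0) a)"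
        using that \<open>finite X\<close> \<open>finite Y\<close> by (intro sum.mono_neutral_right) auto
      also have "\<dots> = \<Sum>Z" by (intro sum.cong) auto
      finally show ?thesis .
    qed
    have "(\<Sum>a\<in>X \<union> Y. gf2_scale (u a) a) = \<Sum>X - \<Sum>Y"
      unfolding u_def gf2.scale_left_diff_distrib sum_subtractf
      by (simp only: s[of X] s[of Y] Un_upper1 Un_upper2)
    then have "(\<Sum>a\<in>X \<union> Y. gf2_scale (u a) a) = 0" using that by simp
    then have "u x = 0"
      using gf2.independentD[OF B, of "X \<union> Y" u x] that x by auto
    then show "x \<in> Y" using x by (auto simp: u_def split: if_splits)
  qed
  show ?thesis using sub[OF A C eq] sub[OF C A eq[symmetric]] by blast
qed

lemma gf2_independent_image_iff:
  assumes g: "Vector_Spaces.linear gf2_scale gf2_scale g" and inj: "inj_on g V" and V: "gf2.subspace V"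
    and X: "X \<subseteq> V"
  shows "gf2.independent (g ` X) \<longleftrightarrow> gf2.independent X"
proof
  have "gf2.span X \<subseteq> V" using X V by (simp add: gf2.span_minimal)
  then have "inj_on g (gf2.span X)" using inj by (rule inj_on_subset[rotated])
  then show "gf2.independent X \<Longrightarrow> gf2.independent (g ` X)"
    using gf2.linear_independent_injective_image[OF g] by blast
next
  assume ind: "gf2.independent (g ` X)"
  show "gf2.independent X"
  proof
    assume "gf2.dependent X"
    then obtain a where a: "a \<in> X" "a \<in> gf2.span (X - {a})"
      unfolding gf2.dependent_def by blast
    have "g a \<in> gf2.span (g ` (X - {a}))"
      using gf2.linear_span_image[OF g] a by blast
    also have "g ` (X - {a}) = g ` X - {g a}"
      using inj X a(1) by (auto simp: inj_on_def subset_iff)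
    finally show False using ind a(1) unfolding gf2.dependent_def by blast
  qed
qed

lemma matroid_iso_sym: "matroid_iso M N \<Longrightarrow> matroid_iso N M"
proof -
  assume "matroid_iso M N"
  then obtain f where f: "bij_betw f (ground M) (ground N)"
    "\<And>X. X \<subseteq> ground M \<Longrightarrow> X \<in> indeps M \<longleftrightarrow> f ` X \<in> indeps N"
    unfolding matroid_iso_def by blast
  let ?g = "inv_into (ground M) f"
  have "Y \<in> indeps N \<longleftrightarrow> ?g ` Y \<in> indeps M" if "Y \<subseteq> ground N" for Y
  proof -
    have "?g ` Y \<subseteq> ground M"
      using that bij_betw_inv_into[OF f(1)] by (auto simp: bij_betw_def)
    moreover have "f ` ?g ` Y = Y"
      using f(1) that by (simp add: bij_betw_def image_inv_into_cancel)
    ultimately show ?thesis using f(2)[of "?g ` Y"] by simp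
  qed
  then show "matroid_iso N M"
    unfolding matroid_iso_def using bij_betw_inv_into[OF f(1)] by blast
qed

lemma matroid_iso_trans:
  assumes "matroid_iso M N" "matroid_iso N P"
  shows "matroid_iso M P"
proof -
  obtain f where f: "bij_betw f (ground M) (ground N)"
    "\<And>X. X \<subseteq> ground M \<Longrightarrow> X \<in> indeps M \<longleftrightarrow> f ` X \<in> indeps N"
    using assms(1) unfolding matroid_iso_def by blast
  obtain g where g: "bij_betw g (ground N) (ground P)"
    "\<And>X. X \<subseteq> ground N \<Longrightarrow> X \<in> indeps N \<longleftrightarrow> g ` X \<in> indeps P"
    using assms(2) unfolding matroid_iso_def by blast
  have "X \<in> indeps M \<longleftrightarrow> (g \<circ> f) ` X \<in> indeps P" if "X \<subseteq> ground M" for X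
  proof -
    have "f ` X \<subseteq> ground N" using that f(1) by (auto simp: bij_betw_def)
    then show ?thesis using f(2)[OF that] g(2) by (simp add: image_comp)
  qed
  then show ?thesis
    unfolding matroid_iso_def using bij_betw_trans[OF f(1) g(1)] by blast
qed

lemma simple_pair_indep:
  assumes M: "matroid M" "simple_matroid M" and X: "X \<subseteq> ground M" "card X \<le> 2"
  shows "X \<in> indeps M"
proof (rule ccontr)
  assume "X \<notin> indeps M"
  have fin: "finite X" using M X unfolding matroid_def by (meson finite_subset)
  let ?D = "{D. D \<subseteq> X \<and> D \<notin> indeps M}"
  have "finite ?D" using fin by simp
  moreover have "X \<in> ?D" using \<open>X \<notin> indeps M\<close> by simp
  ultimately obtain C where C: "C \<in> ?D" "\<forall>B\<in>?D. B \<subseteq> C \<longrightarrow> C = B"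
    using finite_has_minimal[of ?D] by blast
  then have "matroid_circuit M C" unfolding matroid_circuit_def using X by blast
  then have "3 \<le> card C" using M unfolding simple_matroid_def by blast
  moreover have "card C \<le> card X" using C fin by (simp add: card_mono)
  ultimately show False using X by simp
qed

lemma PG2_simps [simp]:
  "ground (PG2 k) = gf2_space k - {0}"
  "I \<in> indeps (PG2 k) \<longleftrightarrow> I \<subseteq> gf2_space k - {0} \<and> gf2.independent I"
  by (auto simp: PG2_def)

lemma restriction_simps [simp]:
  "ground (restriction M X) = ground M \<inter> X"
  "I \<in> indeps (restriction M X) \<longleftrightarrow> I \<in> indeps M \<and> I \<subseteq> X"
  by (auto simp: restriction_def)

definition gf2_unit :: "nat \<Rightarrow> gf2_vec" where
  "gf2_unit i = (\<lambda>j. if j = i then 1 else 0)"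

lemma independent_gf2_units: "gf2.independent (gf2_unit ` A)"
proof -
  have "u v = 0"
    if *: "finite t" "t \<subseteq> gf2_unit ` A" "(\<Sum>v\<in>t. gf2_scale (u v) v) = 0" "v \<in> t" for t u v
  proof -
    obtain i where i: "v = gf2_unit i" using * by blast
    have ap: "(\<Sum>v\<in>s. gf2_scale (u v) v) j = (\<Sum>v\<in>s. u v * v j)" if "finite s" for s j
      using that
      by (induction s) (simp_all only: sum.insert sum.empty plus_fun_apply zero_fun_apply gf2_scale_def
        not_False_eq_True if_False)
    have "w i = 0" if "w \<in> t" "w \<noteq> v" for w
      using that *(2) i by (auto simp: gf2_unit_def)
    then have "(\<Sum>w\<in>t. u w * w i) = (\<Sum>w\<in>t. if w = v then u v * v i else 0)"
      by (intro sum.cong) auto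
    also have "\<dots> = u v" using * i by (simp add: gf2_unit_def)
    finally show ?thesis using ap[OF *(1), of i] *(3) by simp
  qed
  then show ?thesis unfolding gf2.independent_explicit_module by blast
qed

lemma PG2_embedding_exists:
  assumes M: "matroid M" "simple_matroid M" "binary_matroid M" and k: "matroid_rank M \<le> k"
  shows "\<exists>T. T \<subseteq> ground (PG2 k) \<and> matroid_iso M (restriction (PG2 k) T)"
proof -
  obtain \<phi> where \<phi>: "\<And>X. X \<subseteq> ground M \<Longrightarrow>
      X \<in> indeps M \<longleftrightarrow> inj_on \<phi> X \<and> gf2.independent (\<phi> ` X)"
    using M(3) unfolding binary_matroid_def by blast
  have fin: "finite (ground M)" and ind_sub: "\<And>I. I \<in> indeps M \<Longrightarrow> I \<subseteq> ground M"
    using M(1) unfolding matroid_def by blast+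
  have inj: "inj_on \<phi> (ground M)"
  proof (rule inj_onI)
    fix x y assume xy: "x \<in> ground M" "y \<in> ground M" "\<phi> x = \<phi> y"
    have "{x, y} \<in> indeps M"
      using xy by (intro simple_pair_indep M) (auto simp: card_insert_if)
    then have "inj_on \<phi> {x, y}" using \<phi>[of "{x, y}"] xy(1,2) by blast
    then show "x = y" by (rule inj_onD) (use xy in simp_all)
  qed
  have nz: "0 \<notin> \<phi> ` ground M"
  proof
    assume "0 \<in> \<phi> ` ground M"
    then obtain x where x: "x \<in> ground M" "\<phi> x = 0" by auto
    have "{x} \<in> indeps M" using x by (intro simple_pair_indep M) auto
    then show False using \<phi>[of "{x}"] x by simp
  qed
  obtain B where B: "B \<subseteq> \<phi> ` ground M" "gf2.independent B" "\<phi> ` ground M \<subseteq> gf2.span B"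
    using gf2.maximal_independent_subset by blast
  obtain X where X: "X \<subseteq> ground M" "B = \<phi> ` X" using B(1) by (meson subset_imageE)
  have Xi: "X \<in> indeps M" using \<phi>[OF X(1)] B(2) X inj by (auto intro: inj_on_subset)
  have "card B = card X" using X inj by (metis card_image inj_on_subset)
  also have "\<dots> \<le> matroid_rank M"
    unfolding matroid_rank_def matroid_rank_of_def
  proof (rule Max_ge)
    have "indeps M \<subseteq> Pow (ground M)" using ind_sub by auto
    then show "finite (card ` {I \<in> indeps M. I \<subseteq> ground M})"
      using fin by (simp add: finite_subset)
  qed (use X Xi in auto)
  finally have "card B \<le> card {..<k}" using k by simp
  moreover have finB: "finite B" using fin X finite_subset by blast
  ultimately obtain h where h: "h ` B \<subseteq> {..<k}" "inj_on h B"
    using card_le_inj[of B "{..<k}"] by auto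
  obtain g where g: "Vector_Spaces.linear gf2_scale gf2_scale g" "\<And>x. x \<in> B \<Longrightarrow> g x = gf2_unit (h x)"
    using gf2.linear_independent_extend[OF B(2), of "\<lambda>x. gf2_unit (h x)"] by blast
  have gB: "g ` B = gf2_unit ` h ` B" using g(2) by force
  have "inj_on g B"
  proof (rule inj_onI)
    fix x y assume xy: "x \<in> B" "y \<in> B" "g x = g y"
    then have "gf2_unit (h x) (h x) = gf2_unit (h y) (h x)" using g(2) by simp
    then have "h x = h y" by (simp add: gf2_unit_def split: if_splits)
    then show "x = y" using inj_onD[OF h(2)] xy by blast
  qed
  then have ginj: "inj_on g (gf2.span B)"
    using gf2.linear_inj_on_span_independent_image[OF g(1), of B] independent_gf2_units gB by simp
  have "g ` B \<subseteq> gf2_space k"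
    unfolding gB using h(1) by (auto simp: gf2_unit_def gf2_space_def)
  then have gsp: "g ` gf2.span B \<subseteq> gf2_space k"
    using gf2.span_minimal[OF _ subspace_gf2_space]
    by (simp only: gf2.linear_span_image[OF g(1), symmetric])
  let ?f = "g \<circ> \<phi>"
  let ?T = "?f ` ground M"
  have T: "?T \<subseteq> gf2_space k - {0}"
  proof
    fix y assume "y \<in> ?T"
    then obtain x where x: "x \<in> ground M" "y = g (\<phi> x)" by auto
    have sp: "\<phi> x \<in> gf2.span B" using x B(3) by auto
    have "g (\<phi> x) \<noteq> g 0"
      using inj_onD[OF ginj _ sp gf2.span_zero] nz x by (metis imageI)
    then show "y \<in> gf2_space k - {0}"
      using gsp sp x gf2.linear_0[OF g(1)] by auto
  qed
  have injf: "inj_on ?f (ground M)"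
    by (rule comp_inj_on[OF inj inj_on_subset[OF ginj B(3)]])
  have "matroid_iso M (restriction (PG2 k) ?T)"
    unfolding matroid_iso_def
  proof (intro exI[of _ ?f] conjI allI impI)
    show "bij_betw ?f (ground M) (ground (restriction (PG2 k) ?T))"
      using T injf unfolding bij_betw_def by auto
    fix X assume X: "X \<subseteq> ground M"
    have "gf2.independent (g ` \<phi> ` X) \<longleftrightarrow> gf2.independent (\<phi> ` X)"
      using X B(3) by (intro gf2_independent_image_iff[OF g(1) ginj]) auto
    moreover have "inj_on \<phi> X" using inj X by (rule inj_on_subset)
    moreover have "?f ` X \<subseteq> ?T" using X by blast
    ultimately show "X \<in> indeps M \<longleftrightarrow> ?f ` X \<in> indeps (restriction (PG2 k) ?T)"
      using \<phi>[OF X] T by (auto simp: image_comp)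
  qed
  then show ?thesis using T by auto
qed

lemma PG2_iso_extends:
  assumes T: "T \<subseteq> gf2_space k - {0}" and T': "T' \<subseteq> gf2_space k - {0}"
    and f: "bij_betw f T T'"
    and fi: "\<And>X. X \<subseteq> T \<Longrightarrow> gf2.independent X \<longleftrightarrow> gf2.independent (f ` X)"
  shows "\<exists>g. Vector_Spaces.linear gf2_scale gf2_scale g \<and> bij_betw g (gf2_space k) (gf2_space k) \<and>
           (\<forall>t\<in>T. g t = f t)"
proof -
  let ?V = "gf2_space k"
  obtain B where B: "B \<subseteq> T" "gf2.independent B" "T \<subseteq> gf2.span B"
    using gf2.maximal_independent_subset by blast
  have finV: "finite X" if "X \<subseteq> ?V" for X using that finite_gf2_space finite_subset by blast
  have injT: "inj_on f T" and fT: "f ` T = T'" using f by (auto simp: bij_betw_def)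
  have ifB: "gf2.independent (f ` B)" using fi B by blast
  have BV: "B \<subseteq> ?V" and fBV: "f ` B \<subseteq> ?V" using B T T' fT by blast+
  obtain D where D: "B \<subseteq> D" "D \<subseteq> ?V" "gf2.independent D" "?V \<subseteq> gf2.span D"
    using gf2.maximal_independent_subset_extend[OF BV B(2)] by blast
  obtain D' where D': "f ` B \<subseteq> D'" "D' \<subseteq> ?V" "gf2.independent D'" "?V \<subseteq> gf2.span D'"
    using gf2.maximal_independent_subset_extend[OF fBV ifB] by blast
  have spD: "gf2.span D = ?V" and spD': "gf2.span D' = ?V"
    using D D' by (simp_all add: gf2.span_minimal subset_antisym subspace_gf2_space)
  have "card D = card D'"
    using D D' gf2.basis_card_eq_dim by metis
  moreover have "card (f ` B) = card B"
    using B(1) injT by (metis card_image inj_on_subset)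
  ultimately have "card (D - B) = card (D' - f ` B)"
    using D(1) D'(1) finV[OF BV] finV[OF fBV] by (simp add: card_Diff_subset)
  then obtain h where h: "bij_betw h (D - B) (D' - f ` B)"
    using finite_same_card_bij[of "D - B" "D' - f ` B"] finV D(2) D'(2) by blast
  let ?p = "\<lambda>x. if x \<in> B then f x else h x"
  have "bij_betw ?p (B \<union> (D - B)) (f ` B \<union> (D' - f ` B))"
  proof (rule bij_betw_combine)
    show "bij_betw ?p B (f ` B)"
      using injT B(1) by (auto simp: bij_betw_def inj_on_def subset_iff)
    show "bij_betw ?p (D - B) (D' - f ` B)"
      using h by (rule bij_betw_cong[THEN iffD1, rotated]) auto
  qed auto
  then have p: "bij_betw ?p D D'" using D(1) D'(1) by (simp add: Un_absorb1)
  obtain g where g: "Vector_Spaces.linear gf2_scale gf2_scale g" "\<And>x. x \<in> D \<Longrightarrow> g x = ?p x"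
    using gf2.linear_independent_extend[OF D(3), of ?p] by blast
  have gD: "bij_betw g D D'"
    using p bij_betw_cong[of D g ?p D'] g(2) by simp
  then have "inj_on g (gf2.span D)"
    using gf2.linear_inj_on_span_independent_image[OF g(1), of D] D'(3) by (simp add: bij_betw_def)
  moreover have "g ` gf2.span D = gf2.span D'"
    using gf2.linear_span_image[OF g(1), of D] gD by (simp add: bij_betw_def)
  ultimately have gV: "bij_betw g ?V ?V" by (simp add: bij_betw_def spD spD')
  have gB: "g b = f b" if "b \<in> B" for b using g(2)[of b] that D(1) by auto
  have "g t = f t" if t: "t \<in> T" for t
  proof (cases "t \<in> B")
    case True then show ?thesis by (rule gB)
  next
    case False
    obtain A where A: "A \<subseteq> B" "finite A" "t = \<Sum>A"
      using gf2_span_sum B(3) t by blast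
    have key: "t \<in> gf2.span C \<longleftrightarrow> f t \<in> gf2.span (f ` C)" if C: "C \<subseteq> B" for C
    proof -
      have "gf2.independent C" by (rule gf2.independent_mono[OF B(2) C])
      moreover have "gf2.independent (f ` C)" by (rule gf2.independent_mono[OF ifB image_mono[OF C]])
      moreover have "t \<notin> C" using C False by blast
      moreover have "f t \<notin> f ` C"
        using \<open>t \<notin> C\<close> injT t B(1) C by (meson inj_on_image_mem_iff order_trans)
      moreover have "gf2.independent (insert t C) \<longleftrightarrow> gf2.independent (insert (f t) (f ` C))"
        using fi[of "insert t C"] t B(1) C by auto
      ultimately show ?thesis by (simp add: gf2.independent_insert)
    qed
    have "t \<in> gf2.span A" unfolding A(3) by (intro gf2.span_sum gf2.span_base)
    then have "f t \<in> gf2.span (f ` A)" using key[OF A(1)] by blast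
    then obtain A' where A': "A' \<subseteq> f ` A" "f t = \<Sum>A'" using gf2_span_sum by blast
    obtain C where C: "C \<subseteq> A" "A' = f ` C" using A'(1) by (meson subset_imageE)
    have "f t \<in> gf2.span (f ` C)"
      unfolding A'(2) C(2) by (intro gf2.span_sum gf2.span_base)
    then have "t \<in> gf2.span C" using key[OF order_trans[OF C(1) A(1)]] by blast
    then obtain E where E: "E \<subseteq> C" "finite E" "t = \<Sum>E" using gf2_span_sum by blast
    have "E = A" using E A C by (intro gf2_sum_unique[OF B(2)]) auto
    then have CA: "C = A" using E C by blast
    have "g t = (\<Sum>a\<in>A. g a)" unfolding A(3) by (rule gf2.linear_sum[OF g(1)])
    also have "\<dots> = (\<Sum>a\<in>A. f a)" using gB A(1) by (intro sum.cong) auto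
    also have "\<dots> = \<Sum>(f ` A)"
      using injT A(1) B(1) by (subst sum.reindex) (auto intro: inj_on_subset)
    finally show ?thesis using A'(2) C(2) CA by simp
  qed
  then show ?thesis using g(1) gV by blast
qed

lemma PG2_delete_unique:
  assumes T: "T \<subseteq> ground (PG2 k)" and T': "T' \<subseteq> ground (PG2 k)"
    and iso: "matroid_iso (restriction (PG2 k) T) (restriction (PG2 k) T')"
  shows "matroid_iso (deletion (PG2 k) T) (deletion (PG2 k) T')"
proof -
  let ?V = "gf2_space k"
  have T: "T \<subseteq> ?V - {0}" and T': "T' \<subseteq> ?V - {0}" using T T' by simp_all
  then have [simp]: "(?V - {0}) \<inter> T = T" "(?V - {0}) \<inter> T' = T'" by blast+
  obtain f where f: "bij_betw f T T'"
    and fi: "\<And>X. X \<subseteq> T \<Longrightarrow> X \<in> indeps (restriction (PG2 k) T) \<longleftrightarrow> f ` X \<in> indeps (restriction (PG2 k) T')"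
    using iso unfolding matroid_iso_def by auto
  have "gf2.independent X \<longleftrightarrow> gf2.independent (f ` X)" if X: "X \<subseteq> T" for X
  proof -
    have "f ` X \<subseteq> T'" using X f by (auto simp: bij_betw_def)
    then show ?thesis using fi[OF X] X T T' by auto
  qed
  then obtain g where g: "Vector_Spaces.linear gf2_scale gf2_scale g" "bij_betw g ?V ?V"
      "\<And>t. t \<in> T \<Longrightarrow> g t = f t"
    using PG2_iso_extends[OF T T' f] by blast
  have gT: "g ` T = T'" using g(3) f by (force simp: bij_betw_def)
  have g0: "g 0 = 0" by (rule gf2.linear_0[OF g(1)])
  have inj: "inj_on g ?V" and im: "g ` ?V = ?V" using g(2) by (auto simp: bij_betw_def)
  have z: "0 \<in> ?V" using subspace_gf2_space gf2.subspace_0 by blast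
  have eq: "?V - {0} - T = ?V - insert 0 T" "?V - {0} - T' = ?V - insert 0 T'" by blast+
  have im': "g ` (?V - {0} - T) = ?V - {0} - T'"
    unfolding eq using inj_on_image_set_diff[OF inj, of ?V "insert 0 T"] T z im gT g0 by auto
  show ?thesis
    unfolding matroid_iso_def
  proof (intro exI[of _ g] conjI allI impI)
    show "bij_betw g (ground (deletion (PG2 k) T)) (ground (deletion (PG2 k) T'))"
      unfolding bij_betw_def using im' inj_on_subset[OF inj, of "?V - {0} - T"]
      by (auto simp: deletion_def Int_absorb1)
    fix X assume "X \<subseteq> ground (deletion (PG2 k) T)"
    then have X: "X \<subseteq> ?V - {0} - T" by (auto simp: deletion_def)
    have gX: "g ` X \<subseteq> ?V - {0} - T'" using X im' by blast
    have "gf2.independent (g ` X) \<longleftrightarrow> gf2.independent X"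
      using X by (intro gf2_independent_image_iff[OF g(1) inj subspace_gf2_space]) auto
    then show "X \<in> indeps (deletion (PG2 k) T) \<longleftrightarrow> g ` X \<in> indeps (deletion (PG2 k) T')"
      using X gX by (auto simp: deletion_def)
  qed
qed

text \<open>The \<open>(GF(2), k)\<close>-complement, for simple binary \<open>M\<close> with \<open>rank M \<le> k\<close>.  The chosen embedding
  exists by \<open>PG2_embedding_exists\<close> and the result does not depend on it, up to isomorphism, by
  \<open>gf2_complement_unique\<close>.\<close>

definition gf2_complement :: "nat \<Rightarrow> 'a matroid \<Rightarrow> gf2_vec matroid" where
  "gf2_complement k M =
     deletion (PG2 k) (SOME T. T \<subseteq> ground (PG2 k) \<and> matroid_iso M (restriction (PG2 k) T))"

lemma gf2_complement_unique:
  assumes T: "T \<subseteq> ground (PG2 k)" and iso: "matroid_iso M (restriction (PG2 k) T)"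
  shows "matroid_iso (gf2_complement k M) (deletion (PG2 k) T)"
proof -
  let ?P = "\<lambda>T. T \<subseteq> ground (PG2 k) \<and> matroid_iso M (restriction (PG2 k) T)"
  have P: "?P (Eps ?P)" by (rule someI[of ?P T]) (use assms in blast)
  then have "matroid_iso (restriction (PG2 k) (Eps ?P)) (restriction (PG2 k) T)"
    using iso matroid_iso_sym matroid_iso_trans by blast
  then show ?thesis
    unfolding gf2_complement_def using P T by (intro PG2_delete_unique) auto
qed

definition binary_complement :: "'a matroid \<Rightarrow> gf2_vec matroid" where
  "binary_complement M = gf2_complement (matroid_rank M) M"

text \<open>Matroids are taken up to isomorphism.  All members of the class have isomorphic copies on the
  infinite type \<^typ>\<open>gf2_vec\<close>, so the class is generated there and then transported to matroids over
  an arbitrary type, which may be too small to contain the intermediate matroids of a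
  construction.\<close>

inductive gen_comatroid :: "gf2_vec matroid \<Rightarrow> bool" where
  empty: "gen_comatroid U00"
| iso: "gen_comatroid M \<Longrightarrow> matroid_iso M N \<Longrightarrow> matroid N \<Longrightarrow> gen_comatroid N"
| sum: "gen_comatroid M \<Longrightarrow> gen_comatroid N \<Longrightarrow> ground M \<inter> ground N = {} \<Longrightarrow>
    gen_comatroid (matroid_sum M N)"
| compl: "gen_comatroid M \<Longrightarrow> matroid_rank M \<le> t \<Longrightarrow> gen_comatroid (gf2_complement t M)"

definition binary_comatroid :: "'a matroid \<Rightarrow> bool" where
  "binary_comatroid M \<longleftrightarrow> matroid M \<and> (\<exists>N. gen_comatroid N \<and> matroid_iso M N)"

end

theory Submission
  imports Defs
begin

text \<open>
  Embed \<open>M\<close> as a spanning set \<open>G\<close> of points of \<open>V = GF(2)\<^sup>n\<close> and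
  let \<open>R\<close> be the set of the other points. A set \<open>S\<close> of points is inseparable on a
  subspace \<open>W\<close> if \<open>W\<close> has no two proper subspaces that meet in \<open>0\<close> and
  cover \<open>S \<inter> W\<close>, that is, if the matroid \<open>S \<inter> W\<close> is connected and
  spans \<open>W\<close>. Comatroids are the colourings for which on no subspace of dimension at least
  \<open>2\<close> both colours are inseparable. So in a minimal non-comatroid both colours are inseparable on
  \<open>V\<close>, but not both on any smaller \<open>W\<close>.

  A space of dimension at least \<open>4\<close> is not the union of two pairs of proper subspaces with
  trivial intersections. As \<open>n \<ge> 6\<close>, this applies to the intersection of two hyperplanes, and
  forces one and the same colour, say \<open>G\<close>, to be separable on all hyperplanes.

  Now let \<open>F\<close> be a largest proper subspace on which \<open>G\<close> is inseparable, and \<open>D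
  \<subseteq> G - F\<close> a smallest set with nonzero sum \<open>s\<close> in \<open>F\<close>. Then
  \<open>F \<union> D\<close> spans \<open>V\<close>, \<open>G \<subseteq> F \<union> D\<close> and
  \<open>D\<close> has at least \<open>3\<close> elements. Completing \<open>D\<close> with a shortest
  expression of \<open>s\<close> by elements of \<open>G \<inter> F\<close> gives a circuit \<open>C\<close>
  with \<open>G \<inter> span C = C\<close>. If \<open>C\<close> spans \<open>V\<close> then \<open>G =
  C\<close>. Otherwise \<open>C\<close> has at most \<open>4\<close> elements, since both a circuit with
  \<open>5\<close> or more elements and its complement are inseparable; so \<open>C = D \<union> {s}\<close>
  and \<open>F\<close> has codimension \<open>2\<close>. Then some hyperplane \<open>K\<close> of
  \<open>F\<close> through \<open>s\<close> makes \<open>K + span D\<close> contradict the choice of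
  \<open>F\<close>.
\<close>

section \<open>Subspaces of binary vector spaces\<close>

lemma gf2_add_self [simp]: "(x :: gf2_vec) + x = 0"
proof
  fix i show "(x + x) i = 0 i" by (cases "x i") simp_all
qed

lemma gf2_minus_eq_plus: "(x :: gf2_vec) - y = x + y"
  by (metis add_diff_cancel_right' diff_add_eq diff_zero gf2_add_self diff_diff_eq)

lemma gf2_add_self_left [simp]: "(x :: gf2_vec) + (x + y) = y"
  by (simp add: add.assoc[symmetric])

lemma gf2_add_eq_0_iff: "(x :: gf2_vec) + y = 0 \<longleftrightarrow> x = y"
  by (metis add.right_neutral gf2_add_self gf2_add_self_left)

lemma gf2_scale_cases: "gf2_scale c x = (if c = 0 then 0 else x)"
  by (cases c) auto

lemma gf2_subspaceI:
  assumes "0 \<in> A" "\<And>x y. x \<in> A \<Longrightarrow> y \<in> A \<Longrightarrow> x + y \<in> A"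
  shows "gf2.subspace A"
  using assms by (auto simp: gf2.subspace_def gf2_scale_cases)

lemma gf2_subspace_sum: "gf2.subspace A \<Longrightarrow> X \<subseteq> A \<Longrightarrow> \<Sum>X \<in> A"
  by (meson gf2.subspace_sum subsetD)

lemma gf2_subspace_pair: "gf2.subspace {0, w}"
  by (rule gf2_subspaceI) auto

lemma gf2_subspace_add_iff:
  assumes "gf2.subspace A" "x \<in> A"
  shows "x + y \<in> A \<longleftrightarrow> y \<in> A" "y + x \<in> A \<longleftrightarrow> y \<in> A"
  using assms by (metis gf2.subspace_add gf2_add_self_left add.commute)+

lemma gf2_sum_Diff:
  fixes X Y :: "gf2_vec set"
  assumes "finite X" "Y \<subseteq> X"
  shows "\<Sum>(X - Y) = \<Sum>X + \<Sum>Y"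
  using sum_diff[OF assms, of "\<lambda>x. x"] by (simp add: gf2_minus_eq_plus)

lemma gf2_span_insert_subspace:
  assumes "gf2.subspace F"
  shows "gf2.span (insert x F) = F \<union> (+) x ` F"
proof
  have "gf2.subspace (F \<union> (+) x ` F)"
  proof (rule gf2_subspaceI)
    fix u v assume uv: "u \<in> F \<union> (+) x ` F" "v \<in> F \<union> (+) x ` F"
    obtain a where a: "a \<in> F" "u = a \<or> u = x + a" using uv(1) by blast
    obtain b where b: "b \<in> F" "v = b \<or> v = x + b" using uv(2) by blast
    have "u + v = a + b \<or> u + v = x + (a + b)"
      using a(2) b(2) by (metis add.assoc add.commute gf2_add_self_left)
    moreover have "a + b \<in> F" using gf2.subspace_add[OF assms a(1) b(1)] .
    ultimately show "u + v \<in> F \<union> (+) x ` F" by (metis UnCI image_eqI)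
  qed (use assms gf2.subspace_0 in blast)
  moreover have "insert x F \<subseteq> F \<union> (+) x ` F"
    using gf2.subspace_0[OF assms] by (auto intro: image_eqI[of _ _ 0])
  ultimately show "gf2.span (insert x F) \<subseteq> F \<union> (+) x ` F"
    by (rule gf2.span_minimal[rotated])
  show "F \<union> (+) x ` F \<subseteq> gf2.span (insert x F)"
    by (auto intro: gf2.span_base gf2.span_add)
qed

lemma card_span_insert:
  assumes "gf2.subspace F" "finite F" "x \<notin> F"
  shows "card (gf2.span (insert x F)) = 2 * card F"
proof -
  have "F \<inter> (+) x ` F = {}"
    using assms by (auto simp: gf2_subspace_add_iff)
  moreover have "card ((+) x ` F) = card F" by (rule card_image) simp
  ultimately show ?thesis
    using assms by (simp add: gf2_span_insert_subspace card_Un_disjoint)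
qed

lemma card_proper_subspace:
  assumes "gf2.subspace A" "gf2.subspace W" "finite W" "A \<subseteq> W" "\<not> W \<subseteq> A"
  shows "2 * card A \<le> card W"
proof -
  obtain x where x: "x \<in> W" "x \<notin> A" using assms by blast
  have "gf2.span (insert x A) \<subseteq> W" using assms x by (intro gf2.span_minimal) auto
  then show ?thesis
    using card_span_insert[of A x] x assms card_mono[of W] finite_subset by metis
qed

text \<open>Indices of subspaces are powers of 2: if adjoining one vector to \<open>A\<close> did
  not already give \<open>W\<close>, the index would be at least 4.\<close>

lemma card_index_2:
  assumes "gf2.subspace A" "gf2.subspace W" "finite W" "A \<subseteq> W" "\<not> W \<subseteq> A"
    and "card W < 4 * card A"
  shows "2 * card A = card W"
proof -
  obtain x where x: "x \<in> W" "x \<notin> A" using assms by blast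
  let ?A = "gf2.span (insert x A)"
  have c: "card ?A = 2 * card A" using card_span_insert x assms finite_subset by metis
  have s: "?A \<subseteq> W" using assms x by (intro gf2.span_minimal) auto
  have "W \<subseteq> ?A"
  proof (rule ccontr)
    assume "\<not> W \<subseteq> ?A"
    then have "2 * card ?A \<le> card W" using assms s by (intro card_proper_subspace) auto
    then show False using c assms by simp
  qed
  then show ?thesis using s c by (metis subset_antisym)
qed

section \<open>Counting vectors in pairs of subspaces with trivial intersection\<close>

lemma card_independent_subspaces:
  assumes "gf2.subspace A" "gf2.subspace B" "gf2.subspace W" "finite W" "A \<subseteq> W" "B \<subseteq> W"
    and "A \<inter> B = {0}"
  shows "card A * card B \<le> card W"
proof -
  have "inj_on (\<lambda>(a, b). a + b) (A \<times> B)"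
  proof (rule inj_onI, clarsimp)
    fix a b a' b' assume ab: "a \<in> A" "b \<in> B" "a' \<in> A" "b' \<in> B" "a + b = a' + b'"
    then have "a + a' = b + b'" by (metis add.commute add.left_commute gf2_add_self_left)
    moreover have "a + a' \<in> A" "b + b' \<in> B" using ab assms gf2.subspace_add by blast+
    ultimately have "a + a' = 0" "b + b' = 0" using assms(7) by auto
    then show "a = a' \<and> b = b'" by (simp add: gf2_add_eq_0_iff)
  qed
  moreover have "(\<lambda>(a, b). a + b) ` (A \<times> B) \<subseteq> W"
    using assms(5,6) by (auto intro!: gf2.subspace_add[OF assms(3)])
  ultimately have "card (A \<times> B) \<le> card W" using assms(4) by (metis card_inj_on_le)
  then show ?thesis by (simp add: card_cartesian_product)
qed

lemma card_Un_independent_subspaces: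
  assumes "gf2.subspace A" "gf2.subspace B" "finite A" "finite B" "A \<inter> B = {0}"
  shows "card (A \<union> B) + 1 = card A + card B"
  using card_Un_Int[of A B] assms by simp

text \<open>If one of the two is the zero subspace, the other has index at least 2. Otherwise both
  cardinalities a and b are at least 2, and (a - 2)(b - 2) \<ge> 0 gives 2a + 2b \<le> ab + 4, where
  ab \<le> \<open>card W\<close> by \<open>card_independent_subspaces\<close>.\<close>

lemma card_Un_proper_subspaces:
  assumes "gf2.subspace A" "gf2.subspace B" "gf2.subspace W" "finite W" "A \<subseteq> W" "B \<subseteq> W"
    and "A \<inter> B = {0}" "\<not> W \<subseteq> A" "\<not> W \<subseteq> B"
  shows "2 * card A + 2 * card B \<le> card W + 4"
proof -
  have pos: "card A \<ge> 1" "card B \<ge> 1"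
    using assms gf2.subspace_0 finite_subset by (metis One_nat_def Suc_leI card_gt_0_iff empty_iff)+
  have a: "2 * card A \<le> card W" "2 * card B \<le> card W"
    using assms by (auto intro: card_proper_subspace)
  have p: "card A * card B \<le> card W" using assms by (intro card_independent_subspaces)
  show ?thesis
  proof (cases "card A = 1 \<or> card B = 1")
    case True then show ?thesis using a by auto
  next
    case False
    then have "card A \<ge> 2" "card B \<ge> 2" using pos by auto
    then obtain i j where "card A = 2 + i" "card B = 2 + j" by (metis le_Suc_ex)
    then show ?thesis using p by (simp add: algebra_simps)
  qed
qed

text \<open>With \<open>x\<close> in \<open>A\<close> outside \<open>A'\<close>, the space
  \<open>W\<close> consists of \<open>A'\<close> and its translate by \<open>x\<close>, so
  \<open>A\<close> is covered by \<open>A \<inter> A'\<close> and the translate of that by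
  \<open>x\<close>.\<close>

lemma card_Int_index_2:
  assumes "gf2.subspace A" "gf2.subspace A'" "gf2.subspace W" "finite W" "A \<subseteq> W" "A' \<subseteq> W"
    and "2 * card A' = card W"
  shows "card A \<le> 2 * card (A \<inter> A')"
proof (cases "A \<subseteq> A'")
  case True then show ?thesis by (simp add: Int_absorb2)
next
  case False
  then obtain x where x: "x \<in> A" "x \<notin> A'" by blast
  have "gf2.span (insert x A') \<subseteq> W" using assms x by (intro gf2.span_minimal) auto
  moreover have "card (gf2.span (insert x A')) = card W"
    using card_span_insert[of A' x] assms x finite_subset by metis
  ultimately have W: "W = A' \<union> (+) x ` A'"
    using assms card_subset_eq gf2_span_insert_subspace by metis
  have "A \<subseteq> (A \<inter> A') \<union> (+) x ` (A \<inter> A')"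
  proof
    fix a assume a: "a \<in> A"
    then have "a \<in> A' \<or> (\<exists>b\<in>A'. a = x + b)" using W assms by blast
    then show "a \<in> (A \<inter> A') \<union> (+) x ` (A \<inter> A')"
      using a x gf2_subspace_add_iff[OF assms(1)] by auto
  qed
  moreover have fin: "finite (A \<inter> A')" using assms finite_subset by blast
  ultimately have "card A \<le> card ((A \<inter> A') \<union> (+) x ` (A \<inter> A'))"
    by (intro card_mono) auto
  also have "\<dots> \<le> card (A \<inter> A') + card (A \<inter> A')"
    using card_Un_le[of "A \<inter> A'" "(+) x ` (A \<inter> A')"] card_image_le[OF fin, of "(+) x"]
    by linarith
  finally show ?thesis by simp
qed

text \<open>Here the larger member of each pair comes first. Counting gives \<open>A\<close> and
  \<open>A'\<close> index 2, hence \<open>B\<close> and \<open>B'\<close> at most 2 elements. Then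
  \<open>A \<union> A'\<close> leaves at least a quarter of \<open>W\<close> for at most two further
  vectors, so \<open>card W\<close> is 8; in that case the product condition makes \<open>B\<close>
  zero, and one vector would have to cover two. The 8-element case may arise in
  \<open>larger_inseparable\<close>.\<close>

lemma subspaces_not_cover_aux:
  assumes W: "gf2.subspace W" "finite W"
    and A: "gf2.subspace A" "gf2.subspace B" "A \<subseteq> W" "B \<subseteq> W" "A \<inter> B = {0}" "\<not> W \<subseteq> A" "\<not> W \<subseteq> B"
    and A': "gf2.subspace A'" "gf2.subspace B'" "A' \<subseteq> W" "B' \<subseteq> W" "A' \<inter> B' = {0}" "\<not> W \<subseteq> A'" "\<not> W \<subseteq> B'"
    and cover: "W \<subseteq> A \<union> B \<union> (A' \<union> B')"
    and big: "8 \<le> card W" "16 \<le> card W \<or> 2 * (card A * card B) \<le> card W"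
    and le: "card B \<le> card A" "card B' \<le> card A'"
  shows False
proof -
  have fin: "finite A" "finite B" "finite A'" "finite B'" 
    using A(3,4) A'(3,4) W(2) by (simp_all add: finite_subset)
  have u1: "card (A \<union> B) + 1 = card A + card B" and u2: "card (A' \<union> B') + 1 = card A' + card B'"
    by (rule card_Un_independent_subspaces; fact)+
  have b1: "2 * card A + 2 * card B \<le> card W + 4" and b2: "2 * card A' + 2 * card B' \<le> card W + 4"
    by (rule card_Un_proper_subspaces[OF A(1,2) W A(3-7)], rule card_Un_proper_subspaces[OF A'(1,2) W A'(3-7)])
  have zero: "0 \<in> (A \<union> B) \<inter> (A' \<union> B')"
    using gf2.subspace_0[OF A(1)] gf2.subspace_0[OF A'(1)] by blast
  have "card W \<le> card (A \<union> B \<union> (A' \<union> B'))"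
    using cover fin by (intro card_mono) auto
  moreover have "card (A \<union> B \<union> (A' \<union> B')) + card ((A \<union> B) \<inter> (A' \<union> B')) = card (A \<union> B) + card (A' \<union> B')"
    by (rule card_Un_Int[symmetric]) (use fin in auto)
  moreover have "1 \<le> card ((A \<union> B) \<inter> (A' \<union> B'))"
    using card_mono[of "(A \<union> B) \<inter> (A' \<union> B')" "{0}"] zero fin by simp
  \<comment> \<open>The vector 0 is counted in each of the four summands, which accounts for the
    3.\<close>
  ultimately have tot: "card W + 3 \<le> card A + card B + (card A' + card B')" using u1 u2 by linarith
  \<comment> \<open>The other pair contributes at most \<open>card W / 2 + 2\<close>, so this pair
    contributes more than \<open>card W / 2\<close>, and its larger member more than a
    quarter.\<close>
  have "card W < 4 * card A" using tot le b2 by linarith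
  moreover have "card W < 4 * card A'" using tot le b1 by linarith
  ultimately have half: "2 * card A = card W" "2 * card A' = card W"
    using card_index_2[OF A(1) W A(3) A(6)] card_index_2[OF A'(1) W A'(3) A'(6)] by blast+
  have p: "card A * card B \<le> card W" "card A' * card B' \<le> card W"
    using card_independent_subspaces[OF A(1,2) W A(3-5)] card_independent_subspaces[OF A'(1,2) W A'(3-5)]
    by blast+
  have "0 < card A" "0 < card A'" using half big(1) by linarith+
  moreover have "card A * card B \<le> card A * 2" "card A' * card B' \<le> card A' * 2"
    using p half by linarith+
  ultimately have B2: "card B \<le> 2" "card B' \<le> 2" by (simp_all only: mult_le_cancel1)
  have "card (A \<union> A') + card (A \<inter> A') = card A + card A'"
    by (rule card_Un_Int[symmetric]) (use fin in auto)
  moreover have "card A \<le> 2 * card (A \<inter> A')"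
    by (rule card_Int_index_2[OF A(1) A'(1) W A(3) A'(3) half(2)])
  ultimately have AA: "4 * card (A \<union> A') \<le> 3 * card W" using half by linarith
  have "W \<subseteq> (A \<union> A') \<union> ((B - {0}) \<union> (B' - {0}))"
    using cover gf2.subspace_0[OF A(1)] by blast
  then have "card W \<le> card ((A \<union> A') \<union> ((B - {0}) \<union> (B' - {0})))"
    using fin by (intro card_mono) auto
  also have "\<dots> \<le> card (A \<union> A') + (card (B - {0}) + card (B' - {0}))"
    using card_Un_le[of "A \<union> A'" "(B - {0}) \<union> (B' - {0})"] card_Un_le[of "B - {0}" "B' - {0}"]
    by linarith
  also have "\<dots> = card (A \<union> A') + (card B - 1 + (card B' - 1))"
    using gf2.subspace_0[OF A(2)] gf2.subspace_0[OF A'(2)] by (simp add: card_Diff_singleton)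
  finally have fl: "card W \<le> card (A \<union> A') + (card B - 1 + (card B' - 1))" .
  then have "card W \<le> 8" using AA B2 by linarith
  then have "card W = 8" "card A = 4" using big(1) half by linarith+
  then have "card B \<le> 1" using big(2) by simp
  then show False using fl AA B2 \<open>card W = 8\<close> by linarith
qed

text \<open>Each pair covers at most about half of \<open>W\<close>, so each contains a subspace of index 2; but two of
  these overlap too much.\<close>

lemma subspaces_not_cover:
  assumes W: "gf2.subspace W" "finite W"
    and A: "gf2.subspace A" "gf2.subspace B" "A \<inter> B = {0}" "\<not> W \<subseteq> A" "\<not> W \<subseteq> B"
    and A': "gf2.subspace A'" "gf2.subspace B'" "A' \<inter> B' = {0}" "\<not> W \<subseteq> A'" "\<not> W \<subseteq> B'"
    and cover: "W \<subseteq> A \<union> B \<union> (A' \<union> B')"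
    and big: "8 \<le> card W" "16 \<le> card W \<or> 2 * (card (W \<inter> A) * card (W \<inter> B)) \<le> card W"
  shows False
proof -
  \<comment> \<open>All four subspaces are cut down to \<open>W\<close>; the four possible orders by
    size are covered at the end.\<close>
  have aux: False
    if le: "card D \<le> card C" "card D' \<le> card C'"
      and C: "{C, D} = {W \<inter> A, W \<inter> B}" "{C', D'} = {W \<inter> A', W \<inter> B'}" for C D C' D'
  proof (rule subspaces_not_cover_aux[OF W, of C D C' D'])
    have z: "0 \<in> W" using W gf2.subspace_0 by blast
    have s: "gf2.subspace (W \<inter> A)" "gf2.subspace (W \<inter> B)" "gf2.subspace (W \<inter> A')" "gf2.subspace (W \<inter> B')"
      using W A A' gf2.subspace_inter by blast+
    have CD: "(C = W \<inter> A \<and> D = W \<inter> B) \<or> (C = W \<inter> B \<and> D = W \<inter> A)"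
      "(C' = W \<inter> A' \<and> D' = W \<inter> B') \<or> (C' = W \<inter> B' \<and> D' = W \<inter> A')"
      using C by (auto simp: doubleton_eq_iff)
    show "gf2.subspace C" "gf2.subspace D" "gf2.subspace C'" "gf2.subspace D'" using CD s by auto
    show "C \<subseteq> W" "D \<subseteq> W" "C' \<subseteq> W" "D' \<subseteq> W" using CD by auto
    show "C \<inter> D = {0}" "C' \<inter> D' = {0}" using CD A A' z by auto
    show "\<not> W \<subseteq> C" "\<not> W \<subseteq> D" using CD(1) A by auto
    show "\<not> W \<subseteq> C'" "\<not> W \<subseteq> D'" using CD(2) A' by auto
    show "W \<subseteq> C \<union> D \<union> (C' \<union> D')" using CD cover by blast
    show "8 \<le> card W" by fact
    show "16 \<le> card W \<or> 2 * (card C * card D) \<le> card W"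
      using big CD by (auto simp: mult.commute)
    show "card D \<le> card C" "card D' \<le> card C'" by fact+
  qed
  show False
    using aux[of "W \<inter> B" "W \<inter> A" "W \<inter> B'" "W \<inter> A'"] aux[of "W \<inter> A" "W \<inter> B" "W \<inter> B'" "W \<inter> A'"]
      aux[of "W \<inter> B" "W \<inter> A" "W \<inter> A'" "W \<inter> B'"] aux[of "W \<inter> A" "W \<inter> B" "W \<inter> A'" "W \<inter> B'"]
    by (metis insert_commute linear)
qed

section \<open>Inseparability and hyperplanes\<close>

text \<open>\<open>A\<close> and \<open>B\<close> are not confined to \<open>W\<close>: if
  \<open>W\<close> is a subspace, intersecting them with \<open>W\<close> changes nothing. As the
  zero subspace is allowed, the condition includes that \<open>S \<inter> W\<close> spans
  \<open>W\<close>.\<close>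

definition inseparable :: "gf2_vec set \<Rightarrow> gf2_vec set \<Rightarrow> bool" where
  "inseparable S W \<longleftrightarrow> (\<forall>A B. gf2.subspace A \<longrightarrow> gf2.subspace B \<longrightarrow> A \<inter> B = {0} \<longrightarrow>
     S \<inter> W \<subseteq> A \<union> B \<longrightarrow> W \<subseteq> A \<or> W \<subseteq> B)"

lemma inseparableD:
  assumes "inseparable S W" "gf2.subspace A" "gf2.subspace B" "A \<inter> B = {0}" "S \<inter> W \<subseteq> A \<union> B"
  shows "W \<subseteq> A \<or> W \<subseteq> B"
  using assms unfolding inseparable_def by blast

lemma not_inseparableE:
  assumes "\<not> inseparable S W"
  obtains A B where "gf2.subspace A" "gf2.subspace B" "A \<inter> B = {0}" "S \<inter> W \<subseteq> A \<union> B"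
    "\<not> W \<subseteq> A" "\<not> W \<subseteq> B"
  using assms unfolding inseparable_def by blast

lemma inseparable_subset_span:
  assumes "inseparable S W"
  shows "W \<subseteq> gf2.span (S \<inter> W)"
proof -
  have "W \<subseteq> gf2.span (S \<inter> W) \<or> W \<subseteq> {0}"
    using gf2.span_superset[of "S \<inter> W"] gf2.span_zero[of "S \<inter> W"]
    by (intro inseparableD[OF assms]) auto
  then show ?thesis using gf2.span_zero by auto
qed

section \<open>The bilinear form and hyperplanes\<close>

definition gf2_dot :: "nat \<Rightarrow> gf2_vec \<Rightarrow> gf2_vec \<Rightarrow> bit" where
  "gf2_dot n x y = (\<Sum>i<n. x i * y i)"

lemma gf2_dot_commute: "gf2_dot n x y = gf2_dot n y x"
  unfolding gf2_dot_def by (intro sum.cong mult.commute refl)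

lemma gf2_dot_add: "gf2_dot n x (y + z) = gf2_dot n x y + gf2_dot n x z"
  unfolding gf2_dot_def plus_fun_apply distrib_left by (rule sum.distrib)

lemma gf2_dot_0 [simp]: "gf2_dot n x 0 = 0"
  unfolding gf2_dot_def zero_fun_apply mult_zero_right by (rule sum.neutral_const)

lemma bit_add_eq_0_iff: "(a :: bit) + b = 0 \<longleftrightarrow> a = b"
  by (cases a; cases b) simp_all

lemma gf2_dot_add_eq_0 [simp]:
  "gf2_dot n x (y + z) = 0 \<longleftrightarrow> (gf2_dot n x y = 0 \<longleftrightarrow> gf2_dot n x z = 0)"
  "gf2_dot n (y + z) x = 0 \<longleftrightarrow> (gf2_dot n y x = 0 \<longleftrightarrow> gf2_dot n z x = 0)"
  unfolding gf2_dot_commute[of n "y + z"] gf2_dot_add bit_add_eq_0_iff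
  by (cases "gf2_dot n x y"; cases "gf2_dot n x z"; simp add: gf2_dot_commute)+

lemma gf2_unit_in_space: "i < n \<Longrightarrow> gf2_unit i \<in> gf2_space n"
  by (auto simp: gf2_unit_def gf2_space_def)

lemma gf2_dot_unit: "i < n \<Longrightarrow> gf2_dot n x (gf2_unit i) = x i"
  unfolding gf2_dot_def gf2_unit_def
  by (simp add: sum.delta if_distrib[of "(*) _"] cong: if_cong del: mult_bit_eq_and)

lemma gf2_dot_nondegenerate:
  assumes "y \<in> gf2_space n" "\<And>x. x \<in> gf2_space n \<Longrightarrow> gf2_dot n y x = 0"
  shows "y = 0"
proof
  fix i
  show "y i = 0 i"
  proof (cases "i < n")
    case True
    then show ?thesis using assms(2)[OF gf2_unit_in_space[OF True]] gf2_dot_unit by simp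
  next
    case False then show ?thesis using assms(1) by (simp add: gf2_space_def)
  qed
qed

text \<open>Indexing by normal vectors makes the hyperplanes points of a dual copy of the space,
  which can be added. The index 0 gives the whole space, so indices of genuine hyperplanes have to
  be nonzero.\<close>

definition hyperplane :: "nat \<Rightarrow> gf2_vec \<Rightarrow> gf2_vec set" where
  "hyperplane n y = {x \<in> gf2_space n. gf2_dot n y x = 0}"

lemma subspace_dot_section: "gf2.subspace Y \<Longrightarrow> gf2.subspace {x \<in> Y. gf2_dot n y x = 0}"
  by (rule gf2_subspaceI) (auto simp: gf2.subspace_0 gf2.subspace_add)

lemma subspace_hyperplane: "gf2.subspace (hyperplane n y)"
  unfolding hyperplane_def by (rule subspace_dot_section[OF subspace_gf2_space])

lemma hyperplane_subset: "hyperplane n y \<subseteq> gf2_space n"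
  by (auto simp: hyperplane_def)

lemma finite_hyperplane: "finite (hyperplane n y)"
  using finite_subset[OF hyperplane_subset finite_gf2_space] .

text \<open>The vectors of \<open>Y\<close> with product 1 form a single translate of the section,
  by any one of them.\<close>

lemma card_dot_section:
  assumes "gf2.subspace Y" "finite Y"
  shows "card Y \<le> 2 * card {x \<in> Y. gf2_dot n y x = 0}" (is "_ \<le> 2 * card ?K")
proof (cases "\<exists>u\<in>Y. gf2_dot n y u \<noteq> 0")
  case True
  then obtain u where u: "u \<in> Y" "gf2_dot n y u \<noteq> 0" by blast
  have "Y \<subseteq> ?K \<union> (+) u ` ?K"
  proof
    fix p assume p: "p \<in> Y"
    show "p \<in> ?K \<union> (+) u ` ?K"
    proof (cases "gf2_dot n y p = 0")
      case False
      then have "u + p \<in> ?K" using u p assms by (simp add: gf2.subspace_add)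
      then show ?thesis using image_eqI[of p "(+) u" "u + p" ?K] by simp
    next
      case True
      then show ?thesis using p by simp
    qed
  qed
  then have "card Y \<le> card (?K \<union> (+) u ` ?K)" using assms by (intro card_mono) simp_all
  also have "\<dots> \<le> card ?K + card ?K"
    using card_Un_le[of ?K "(+) u ` ?K"] card_image_le[of ?K "(+) u"] finite_subset[of ?K Y] assms(2)
    by (simp add: order_trans)
  finally show ?thesis by simp
next
  case False
  then have "?K = Y" by auto
  then show ?thesis by simp
qed

lemma card_dot_section_eq:
  assumes "gf2.subspace Y" "finite Y" "u \<in> Y" "gf2_dot n y u \<noteq> 0"
  shows "card Y = 2 * card {x \<in> Y. gf2_dot n y x = 0}" (is "_ = 2 * card ?K")
proof -
  have "2 * card ?K \<le> card Y"
    using assms by (intro card_proper_subspace subspace_dot_section) auto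
  then show ?thesis using card_dot_section[OF assms(1,2), of n y] by simp
qed

lemma card_gf2_space: "card (gf2_space n) = 2 ^ n"
proof (induction n)
  case 0
  have "gf2_space 0 = {0}" by (auto simp: gf2_space_def fun_eq_iff)
  then show ?case by simp
next
  case (Suc n)
  have "gf2_unit n \<notin> gf2_space n" by (simp add: gf2_space_def gf2_unit_def)
  then have "card (gf2.span (insert (gf2_unit n) (gf2_space n))) = 2 * card (gf2_space n)"
    by (intro card_span_insert subspace_gf2_space finite_gf2_space)
  moreover have "gf2.span (insert (gf2_unit n) (gf2_space n)) = gf2_space (Suc n)"
    unfolding gf2_span_insert_subspace[OF subspace_gf2_space]
  proof
    show "gf2_space n \<union> (+) (gf2_unit n) ` gf2_space n \<subseteq> gf2_space (Suc n)"
      by (auto simp: gf2_space_def gf2_unit_def)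
    show "gf2_space (Suc n) \<subseteq> gf2_space n \<union> (+) (gf2_unit n) ` gf2_space n"
    proof
      fix v assume v: "v \<in> gf2_space (Suc n)"
      have ge: "v i = 0" if "i \<ge> n" "i \<noteq> n" for i using v that by (simp add: gf2_space_def)
      show "v \<in> gf2_space n \<union> (+) (gf2_unit n) ` gf2_space n"
      proof (cases "v n = 0")
        case True
        then have "v \<in> gf2_space n" using ge by (auto simp: gf2_space_def)
        then show ?thesis by blast
      next
        case False
        then have "gf2_unit n + v \<in> gf2_space n" using ge by (auto simp: gf2_space_def gf2_unit_def)
        then show ?thesis by (metis UnI2 gf2_add_self_left image_eqI)
      qed
    qed
  qed
  ultimately show ?case using Suc by simp
qed

text \<open>A vector \<open>u\<close> whose product with \<open>x\<close> is 1 lies off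
  \<open>hyperplane n h\<close>. All vectors off it differ from \<open>u\<close> by elements of it,
  so the forms of \<open>x\<close> and \<open>h\<close> agree everywhere and \<open>x + h\<close> is
  orthogonal to the whole space.\<close>

lemma hyperplane_mono_imp:
  assumes "x \<in> gf2_space n" "h \<in> gf2_space n" "hyperplane n h \<subseteq> hyperplane n x"
  shows "x = 0 \<or> x = h"
proof (rule ccontr)
  assume *: "\<not> (x = 0 \<or> x = h)"
  then obtain u where u: "u \<in> gf2_space n" "gf2_dot n x u \<noteq> 0"
    using gf2_dot_nondegenerate[OF assms(1)] by blast
  have hu: "gf2_dot n h u \<noteq> 0" using u assms(3) by (auto simp: hyperplane_def)
  have "gf2_dot n (x + h) p = 0" if p: "p \<in> gf2_space n" for p
  proof (cases "gf2_dot n h p = 0")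
    case True
    then show ?thesis using p assms(3) by (auto simp: hyperplane_def)
  next
    case False
    then have "u + p \<in> hyperplane n h"
      using p u hu gf2.subspace_add[OF subspace_gf2_space] by (simp add: hyperplane_def)
    then have "gf2_dot n x (u + p) = 0" using assms(3) by (auto simp: hyperplane_def)
    then show ?thesis using False u by simp
  qed
  then have "x + h = 0"
    using assms by (intro gf2_dot_nondegenerate) (auto intro: gf2.subspace_add[OF subspace_gf2_space])
  then show False using * by (simp add: gf2_add_eq_0_iff)
qed

text \<open>What is orthogonal to the intersection is a combination of the two normals. If
  \<open>k\<close> does not vanish on \<open>hyperplane n h\<close>, its form agrees there with that
  of \<open>x\<close>, and \<open>hyperplane_mono_imp\<close> applies to
  \<open>k + x\<close>.\<close>

lemma hyperplane_Int_subset_imp: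
  assumes "x \<in> gf2_space n" "h \<in> gf2_space n" "k \<in> gf2_space n" "hyperplane n x \<inter> hyperplane n h \<subseteq> hyperplane n k"
  shows "k \<in> {0, x, h, x + h}"
proof (cases "hyperplane n h \<subseteq> hyperplane n k")
  case True
  then show ?thesis using hyperplane_mono_imp assms by blast
next
  case False
  then obtain u where u: "u \<in> hyperplane n h" "u \<notin> hyperplane n k" by blast
  have ku: "gf2_dot n k u \<noteq> 0" and xu: "gf2_dot n x u \<noteq> 0"
    using u assms(4) by (auto simp: hyperplane_def)
  have "hyperplane n h \<subseteq> hyperplane n (k + x)"
  proof
    fix p assume p: "p \<in> hyperplane n h"
    show "p \<in> hyperplane n (k + x)"
    proof (cases "gf2_dot n x p = 0")
      case True
      then show ?thesis using p assms(4) by (auto simp: hyperplane_def)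
    next
      case False
      then have "u + p \<in> hyperplane n x \<inter> hyperplane n h"
        using p u xu gf2.subspace_add[OF subspace_gf2_space] by (simp add: hyperplane_def)
      then have "u + p \<in> hyperplane n k" using assms(4) by blast
      then show ?thesis using p False ku by (auto simp: hyperplane_def)
    qed
  qed
  then have "k + x = 0 \<or> k + x = h"
    using assms by (intro hyperplane_mono_imp) (auto intro: gf2.subspace_add[OF subspace_gf2_space])
  moreover have "k = x + (k + x)" using gf2_add_self_left[of x k] by (simp only: add.commute)
  ultimately have "k = x + 0 \<or> k = x + h" by metis
  then show ?thesis by auto
qed

text \<open>By \<open>hyperplane_mono_imp\<close> there are vectors orthogonal to \<open>s\<close>
  that handle \<open>a\<close> and \<open>b\<close> separately; if neither handles both, their sum
  does.\<close>

lemma exists_dual_vector: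
  assumes "s \<in> gf2_space n" "a \<in> gf2_space n" "b \<in> gf2_space n" "a \<noteq> 0" "a \<noteq> s" "b \<noteq> 0" "b \<noteq> s"
  obtains y where "y \<in> gf2_space n" "gf2_dot n y s = 0" "gf2_dot n y a \<noteq> 0" "gf2_dot n y b \<noteq> 0"
proof -
  have *: "\<exists>u\<in>hyperplane n s. gf2_dot n u c \<noteq> 0" if c: "c \<in> gf2_space n" "c \<noteq> 0" "c \<noteq> s" for c
  proof -
    obtain u where "u \<in> hyperplane n s" "u \<notin> hyperplane n c"
      using hyperplane_mono_imp[OF c(1) assms(1)] c by blast
    then have "gf2_dot n c u \<noteq> 0" by (simp add: hyperplane_def)
    then show ?thesis using \<open>u \<in> hyperplane n s\<close> by (auto simp only: gf2_dot_commute[of n c u])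
  qed
  obtain u where u: "u \<in> hyperplane n s" "gf2_dot n u a \<noteq> 0" using *[of a] assms by blast
  obtain v where v: "v \<in> hyperplane n s" "gf2_dot n v b \<noteq> 0" using *[of b] assms by blast
  have uv: "u + v \<in> hyperplane n s" using u v gf2.subspace_add[OF subspace_hyperplane] by blast
  have *: "y \<in> gf2_space n" "gf2_dot n y s = 0" if "y \<in> hyperplane n s" for y
    using that by (simp_all add: hyperplane_def gf2_dot_commute[of n y s])
  show thesis
  proof (cases "gf2_dot n u b = 0")
    case False
    then show thesis using that[of u] * u by blast
  next
    case ub: True
    show thesis
    proof (cases "gf2_dot n v a = 0")
      case False
      then show thesis using that[of v] * v by blast
    next
      case True
      then show thesis using that[of "u + v"] *[OF uv] u v ub by auto
    qed
  qed
qed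

section \<open>Colourings all of whose hyperplanes are separable\<close>

text \<open>The assumptions are symmetric in the two colours, so \<open>swap\<close> makes every
  result available for \<open>R\<close> too. The condition \<open>4 \<le> card W\<close> expresses
  dimension at least 2.\<close>

locale critical_colouring =
  fixes n :: nat and G R :: "gf2_vec set"
  assumes n6: "6 \<le> n"
    and colours: "G \<union> R = gf2_space n - {0}" "G \<inter> R = {}"
    and inseparable_G: "inseparable G (gf2_space n)"
    and inseparable_R: "inseparable R (gf2_space n)"
    and separable: "\<And>W. gf2.subspace W \<Longrightarrow> W \<subset> gf2_space n \<Longrightarrow> 4 \<le> card W \<Longrightarrow>
      \<not> inseparable G W \<or> \<not> inseparable R W"
begin

lemma swap: "critical_colouring n R G"
  using n6 colours inseparable_G inseparable_R separable
  by unfold_locales (auto simp: Un_commute Int_commute)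

section \<open>Comparing separations on different hyperplanes\<close>

lemma card_space: "64 \<le> card (gf2_space n)"
proof -
  have "(2::nat) ^ 6 \<le> 2 ^ n" using n6 by (intro power_increasing) auto
  then show ?thesis by (simp add: card_gf2_space)
qed

lemma card_hyperplane_ge: "32 \<le> card (hyperplane n h)"
  using card_dot_section[OF subspace_gf2_space finite_gf2_space, of n n h] card_space
  by (simp add: hyperplane_def)

lemma card_hyperplane_Int_ge: "16 \<le> card (hyperplane n h \<inter> hyperplane n k)"
proof -
  have "hyperplane n h \<inter> hyperplane n k = {x \<in> hyperplane n h. gf2_dot n k x = 0}"
    by (auto simp: hyperplane_def)
  then show ?thesis
    using card_dot_section[OF subspace_hyperplane finite_hyperplane, of n h n k] card_hyperplane_ge[of h]
    by simp
qed

lemma hyperplane_psubset: "h \<in> gf2_space n \<Longrightarrow> h \<noteq> 0 \<Longrightarrow> hyperplane n h \<subset> gf2_space n"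
  using gf2_dot_nondegenerate[of h n] by (auto simp: hyperplane_def)

lemma hyperplane_separable:
  "h \<in> gf2_space n \<Longrightarrow> h \<noteq> 0 \<Longrightarrow> \<not> inseparable G (hyperplane n h) \<or> \<not> inseparable R (hyperplane n h)"
  using separable[OF subspace_hyperplane hyperplane_psubset] card_hyperplane_ge[of h] by force

text \<open>This is the shape of a separation of \<open>S\<close> on \<open>hyperplane n h\<close>
  when one of its subspaces contains the intersection with \<open>hyperplane n k\<close>: the other
  subspace then accounts for at most one extra point.\<close>

definition near :: "gf2_vec set \<Rightarrow> gf2_vec \<Rightarrow> gf2_vec \<Rightarrow> bool" where
  "near S h k \<longleftrightarrow> (\<exists>w. S \<inter> hyperplane n h \<subseteq> hyperplane n k \<union> {w})"

lemma nearD: "near S h k \<Longrightarrow> a \<in> S \<Longrightarrow> b \<in> S \<Longrightarrow> a \<in> hyperplane n h \<Longrightarrow> b \<in> hyperplane n h \<Longrightarrow>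
  a \<notin> hyperplane n k \<Longrightarrow> b \<notin> hyperplane n k \<Longrightarrow> a = b"
  unfolding near_def by blast

text \<open>A point of \<open>hyperplane n h\<close> off \<open>hyperplane n k\<close> cannot lie in
  \<open>A\<close>, or \<open>A\<close> would contain all of \<open>hyperplane n h\<close>. So such
  points of \<open>S\<close> lie in \<open>B\<close>, and the sum of two of them lies in
  \<open>A \<inter> B\<close>, hence is 0.\<close>

lemma near_if_subset:
  assumes A: "gf2.subspace A" "gf2.subspace B" "A \<inter> B = {0}"
    and S: "\<not> hyperplane n h \<subseteq> A" "S \<inter> hyperplane n h \<subseteq> A \<union> B" and hk: "hyperplane n h \<inter> hyperplane n k \<subseteq> A"
  shows "near S h k"
proof -
  have add: "x + y \<in> hyperplane n h \<inter> hyperplane n k"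
    if "x \<in> hyperplane n h" "y \<in> hyperplane n h" "x \<notin> hyperplane n k" "y \<notin> hyperplane n k" for x y
    using that gf2.subspace_add[OF subspace_hyperplane] gf2.subspace_add[OF subspace_gf2_space]
    by (simp add: hyperplane_def)
  have notA: "x \<notin> A" if x: "x \<in> hyperplane n h" "x \<notin> hyperplane n k" for x
  proof
    assume xA: "x \<in> A"
    have "p \<in> A" if p: "p \<in> hyperplane n h" for p
    proof (cases "p \<in> hyperplane n k")
      case True then show ?thesis using p hk by blast
    next
      case False
      then have "x + p \<in> A" using add[OF x(1) p x(2)] hk by blast
      then show ?thesis using gf2_subspace_add_iff(1)[OF A(1) xA] by simp
    qed
    then show False using S(1) by blast
  qed
  have uniq: "x = y" if "x \<in> S \<inter> hyperplane n h - hyperplane n k" "y \<in> S \<inter> hyperplane n h - hyperplane n k" for x y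
  proof -
    have "x \<in> B" "y \<in> B" using that S(2) notA by blast+
    then have "x + y \<in> A \<inter> B" using add[of x y] that hk gf2.subspace_add[OF A(2)] by blast
    then show ?thesis using A(3) by (simp add: gf2_add_eq_0_iff)
  qed
  show ?thesis
  proof (cases "S \<inter> hyperplane n h - hyperplane n k = {}")
    case True
    then show ?thesis unfolding near_def by blast
  next
    case False
    then obtain w where "w \<in> S \<inter> hyperplane n h - hyperplane n k" by blast
    then have "S \<inter> hyperplane n h \<subseteq> hyperplane n k \<union> {w}" using uniq by blast
    then show ?thesis unfolding near_def by blast
  qed
qed

lemma colour_cases: "p \<in> gf2_space n \<Longrightarrow> p = 0 \<or> p \<in> G \<or> p \<in> R"
  using colours(1) by blast

text \<open>Two separations would cover at least 32 vectors by two pairs of proper subspaces. With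
  \<open>hyperplane_separable\<close>, exactly one colour is separable on each hyperplane with
  nonzero normal.\<close>

lemma hyperplane_not_both_separable:
  assumes "\<not> inseparable G (hyperplane n h)" "\<not> inseparable R (hyperplane n h)"
  shows False
proof -
  obtain A B where A: "gf2.subspace A" "gf2.subspace B" "A \<inter> B = {0}" "\<not> hyperplane n h \<subseteq> A" "\<not> hyperplane n h \<subseteq> B"
    and GA: "G \<inter> hyperplane n h \<subseteq> A \<union> B" using not_inseparableE[OF assms(1)] by metis
  obtain A' B' where A': "gf2.subspace A'" "gf2.subspace B'" "A' \<inter> B' = {0}" "\<not> hyperplane n h \<subseteq> A'" "\<not> hyperplane n h \<subseteq> B'"
    and RA: "R \<inter> hyperplane n h \<subseteq> A' \<union> B'" using not_inseparableE[OF assms(2)] by metis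
  have "hyperplane n h \<subseteq> A \<union> B \<union> (A' \<union> B')"
  proof
    fix p assume p: "p \<in> hyperplane n h"
    then have "p = 0 \<or> p \<in> G \<or> p \<in> R" using colour_cases hyperplane_subset by blast
    then show "p \<in> A \<union> B \<union> (A' \<union> B')"
      using p GA RA gf2.subspace_0[OF A(1)] by blast
  qed
  then show False
    by (rule subspaces_not_cover[OF subspace_hyperplane finite_hyperplane A A']) (use card_hyperplane_ge[of h] in auto)
qed

text \<open>The two separations together cover the intersection of the hyperplanes, which has at
  least 16 vectors. By \<open>subspaces_not_cover\<close> one of the four subspaces contains it, and
  the colour it belongs to decides the alternative.\<close>

lemma near_dichotomy:
  assumes "\<not> inseparable G (hyperplane n h)" "\<not> inseparable R (hyperplane n k)"
  shows "near G h k \<or> near R k h"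
proof -
  let ?Y = "hyperplane n h \<inter> hyperplane n k"
  obtain A B where A: "gf2.subspace A" "gf2.subspace B" "A \<inter> B = {0}" "\<not> hyperplane n h \<subseteq> A" "\<not> hyperplane n h \<subseteq> B"
    and GA: "G \<inter> hyperplane n h \<subseteq> A \<union> B" using not_inseparableE[OF assms(1)] by metis
  obtain A' B' where A': "gf2.subspace A'" "gf2.subspace B'" "A' \<inter> B' = {0}" "\<not> hyperplane n k \<subseteq> A'" "\<not> hyperplane n k \<subseteq> B'"
    and RA: "R \<inter> hyperplane n k \<subseteq> A' \<union> B'" using not_inseparableE[OF assms(2)] by metis
  have cover: "?Y \<subseteq> A \<union> B \<union> (A' \<union> B')"
  proof
    fix p assume p: "p \<in> ?Y"
    then have "p = 0 \<or> p \<in> G \<or> p \<in> R" using colour_cases hyperplane_subset by blast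
    then show "p \<in> A \<union> B \<union> (A' \<union> B')"
      using p GA RA gf2.subspace_0[OF A(1)] by blast
  qed
  have sY: "gf2.subspace ?Y" "finite ?Y"
    using gf2.subspace_inter[OF subspace_hyperplane subspace_hyperplane] finite_hyperplane by blast+
  have "?Y \<subseteq> A \<or> ?Y \<subseteq> B \<or> ?Y \<subseteq> A' \<or> ?Y \<subseteq> B'"
  proof (rule ccontr)
    assume *: "\<not> ?thesis"
    show False
      by (rule subspaces_not_cover[OF sY A(1-3) _ _ A'(1-3) _ _ cover])
        (use * card_hyperplane_Int_ge[of h k] in auto)
  qed
  moreover have "B \<inter> A = {0}" "B' \<inter> A' = {0}" using A(3) A'(3) by auto
  moreover have "G \<inter> hyperplane n h \<subseteq> B \<union> A" "R \<inter> hyperplane n k \<subseteq> B' \<union> A'"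
    using GA RA by auto
  moreover have "?Y = hyperplane n k \<inter> hyperplane n h" by auto
  ultimately show ?thesis
    using near_if_subset[OF A(1-4) GA] near_if_subset[OF A(2,1) _ A(5)]
      near_if_subset[OF A'(1-4) RA] near_if_subset[OF A'(2,1) _ A'(5)] by metis
qed

text \<open>Nearness supplies a pair, \<open>hyperplane n k\<close> and \<open>{0, w'}\<close>,
  covering the points of \<open>G\<close> in the intersection of the hyperplanes of \<open>x\<close>
  and \<open>h\<close>. The condition on \<open>k\<close> keeps this intersection from lying in
  \<open>hyperplane n k\<close>, so one of the subspaces separating \<open>R\<close> must contain
  it.\<close>

lemma near_transfer:
  assumes near: "near G h k" and x: "\<not> inseparable R (hyperplane n x)"
    and hkx: "h \<in> gf2_space n" "k \<in> gf2_space n" "x \<in> gf2_space n" "k \<notin> {0, x, h, x + h}"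
  shows "near R x h"
proof -
  let ?Y = "hyperplane n x \<inter> hyperplane n h"
  obtain A B where A: "gf2.subspace A" "gf2.subspace B" "A \<inter> B = {0}" "\<not> hyperplane n x \<subseteq> A" "\<not> hyperplane n x \<subseteq> B"
    and RA: "R \<inter> hyperplane n x \<subseteq> A \<union> B" using not_inseparableE[OF x] by metis
  obtain w where w: "G \<inter> hyperplane n h \<subseteq> hyperplane n k \<union> {w}"
    using near unfolding near_def by blast
  \<comment> \<open>An exceptional point that is already in \<open>hyperplane n k\<close> is
    replaced by 0, so that the pair meets only in 0.\<close>
  define w' where "w' = (if w \<in> hyperplane n k then 0 else w)"
  have sY: "gf2.subspace ?Y" "finite ?Y"
    using gf2.subspace_inter[OF subspace_hyperplane subspace_hyperplane] finite_hyperplane by blast+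
  have z: "0 \<in> hyperplane n k" by (rule gf2.subspace_0[OF subspace_hyperplane])
  have cover: "?Y \<subseteq> A \<union> B \<union> (hyperplane n k \<union> {0, w'})"
  proof
    fix p assume p: "p \<in> ?Y"
    then have "p = 0 \<or> p \<in> G \<or> p \<in> R" using colour_cases hyperplane_subset by blast
    then show "p \<in> A \<union> B \<union> (hyperplane n k \<union> {0, w'})"
      using p w RA unfolding w'_def by auto
  qed
  have k: "hyperplane n k \<inter> {0, w'} = {0}" using z by (auto simp: w'_def)
  have "\<not> ?Y \<subseteq> hyperplane n k" using hyperplane_Int_subset_imp[of x n h k] hkx by blast
  moreover have "\<not> ?Y \<subseteq> {0, w'}"
  proof
    assume "?Y \<subseteq> {0, w'}"
    then have "card ?Y \<le> card {0, w'}" by (intro card_mono) auto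
    also have "\<dots> \<le> 2" by (simp add: card_insert_if)
    finally show False using card_hyperplane_Int_ge[of x h] by simp
  qed
  ultimately have "?Y \<subseteq> A \<or> ?Y \<subseteq> B"
    using subspaces_not_cover[OF sY A(1-3) _ _ subspace_hyperplane gf2_subspace_pair k _ _ cover]
      card_hyperplane_Int_ge[of x h] by force
  moreover have "B \<inter> A = {0}" using A(3) by auto
  moreover have "R \<inter> hyperplane n x \<subseteq> B \<union> A" using RA by auto
  ultimately show ?thesis
    using near_if_subset[OF A(1-4) RA] near_if_subset[OF A(2,1) _ A(5)] by metis
qed

text \<open>Otherwise the hyperplane and some \<open>{0, w}\<close> would separate \<open>G\<close>
  on the whole space.\<close>

lemma two_outside:
  assumes "x \<in> gf2_space n" "x \<noteq> 0"
  obtains g g' where "g \<in> G - hyperplane n x" "g' \<in> G - hyperplane n x" "g \<noteq> g'"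
proof (rule ccontr)
  assume "\<not> thesis"
  then have uniq: "\<And>g g'. g \<in> G - hyperplane n x \<Longrightarrow> g' \<in> G - hyperplane n x \<Longrightarrow> g = g'"
    using that by blast
  \<comment> \<open>The default for \<open>w\<close> is 0, used when no point of \<open>G\<close> is
    outside; in both cases the pair meets only in 0.\<close>
  have "\<exists>w. w \<notin> hyperplane n x - {0} \<and> G \<subseteq> hyperplane n x \<union> {0, w}"
  proof (cases "G - hyperplane n x = {}")
    case True
    then show ?thesis by (intro exI[of _ 0]) auto
  next
    case False
    then obtain g where "g \<in> G - hyperplane n x" by blast
    then show ?thesis using uniq by (intro exI[of _ g]) auto
  qed
  then obtain w where w: "w \<notin> hyperplane n x - {0}" "G \<subseteq> hyperplane n x \<union> {0, w}"
    by blast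
  have "gf2_space n \<subseteq> hyperplane n x \<or> gf2_space n \<subseteq> {0, w}"
    using w gf2.subspace_0[OF subspace_hyperplane]
    by (intro inseparableD[OF inseparable_G subspace_hyperplane gf2_subspace_pair]) auto
  moreover have "\<not> gf2_space n \<subseteq> {0, w}"
  proof
    assume "gf2_space n \<subseteq> {0, w}"
    then have "card (gf2_space n) \<le> card {0, w}" by (intro card_mono) auto
    also have "\<dots> \<le> 2" by (simp add: card_insert_if)
    finally show False using card_space by simp
  qed
  ultimately show False using hyperplane_psubset[OF assms] by blast
qed

text \<open>A hyperplane through two points of \<open>G\<close> outside one hyperplane and two points of \<open>R\<close> outside another
  cannot be near either of them; \<open>near_transfer\<close> leaves too few exceptions to avoid all such hyperplanes.\<close>

lemma not_near:
  assumes near: "near G h k" and h: "\<not> inseparable G (hyperplane n h)" and k: "\<not> inseparable R (hyperplane n k)"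
    and hk: "h \<in> gf2_space n" "k \<in> gf2_space n" "h \<noteq> 0" "k \<noteq> 0"
  shows False
proof -
  interpret sw: critical_colouring n R G by (rule swap)
  have neq: "h \<noteq> k" using hyperplane_not_both_separable h k by blast
  \<comment> \<open>By symmetry of the form, hyperplanes through given points can be found by
    choosing a normal in the hyperplanes that these points define.\<close>
  have mem: "p \<in> hyperplane n z" if "p \<in> gf2_space n" "z \<in> hyperplane n p" for p z
    using that by (simp add: hyperplane_def gf2_dot_commute[of n z p])
  have GV: "G \<subseteq> gf2_space n" and RV: "R \<subseteq> gf2_space n" using colours by blast+
  show False
  \<comment> \<open>The split is whether \<open>R\<close> is separable on a hyperplane whose normal
    is not a combination of \<open>h\<close> and \<open>k\<close>.\<close>
  proof (cases "\<exists>x\<in>gf2_space n. x \<notin> {0, h, k, h + k} \<and> \<not> inseparable R (hyperplane n x)")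
    case True
    then obtain x where x: "x \<in> gf2_space n" "x \<notin> {0, h, k, h + k}" "\<not> inseparable R (hyperplane n x)"
      by blast
    have ne: "k \<noteq> x + h"
    proof
      assume "k = x + h"
      then have "h + k = x" by (simp add: add.commute)
      then show False using x(2) by blast
    qed
    have nx: "near R x h" by (rule near_transfer[OF near x(3) hk(1,2) x(1)]) (use ne x(2) hk neq in auto)
    obtain g g' where g: "g \<in> G - hyperplane n x" "g' \<in> G - hyperplane n x" "g \<noteq> g'"
      using two_outside x by blast
    obtain r r' where r: "r \<in> R - hyperplane n h" "r' \<in> R - hyperplane n h" "r \<noteq> r'"
      using sw.two_outside hk by blast
    \<comment> \<open>\<open>N\<close> will hold the normals of the hyperplanes through all four
      chosen points: four linear conditions on at least 64 vectors leave at least 4.\<close>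
    define N1 where "N1 = {z \<in> hyperplane n g \<inter> hyperplane n g'. gf2_dot n r z = 0}"
    define N where "N = {z \<in> N1. gf2_dot n r' z = 0}"
    have sN0: "gf2.subspace (hyperplane n g \<inter> hyperplane n g')" "finite (hyperplane n g \<inter> hyperplane n g')"
      using gf2.subspace_inter[OF subspace_hyperplane subspace_hyperplane] finite_hyperplane by blast+
    have sN1: "gf2.subspace N1" "finite N1"
      unfolding N1_def by (rule subspace_dot_section[OF sN0(1)], rule finite_subset[OF _ sN0(2)]) blast
    have sN: "gf2.subspace N" unfolding N_def by (intro subspace_dot_section sN1)
    have cN: "4 \<le> card N"
      using card_hyperplane_Int_ge[of g g'] card_dot_section[OF sN0, of n r, folded N1_def]
        card_dot_section[OF sN1, of n r', folded N_def] by linarith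
    \<comment> \<open>If \<open>N\<close> consisted of the excluded vectors only, then as a subspace
      it would also contain \<open>(h + x) + k\<close>, which differs from all of them.\<close>
    have "\<exists>z\<in>N. z \<notin> {0, h + x, k, h + k}"
    proof (rule ccontr)
      assume "\<not> ?thesis"
      then have sub: "N \<subseteq> {0, h + x, k, h + k}" by blast
      have "card {0, h + x, k, h + k} \<le> 4" by (simp add: card_insert_if)
      then have "N = {0, h + x, k, h + k}" using sub cN by (intro card_seteq) auto
      then have "(h + x) + k \<in> {0, h + x, k, h + k}"
        using gf2.subspace_add[OF sN, of "h + x" k] by auto
      moreover have "(h + x) + k \<noteq> 0"
        using ne by (metis add.commute gf2_add_eq_0_iff)
      moreover have "(h + x) + k \<noteq> h + x" using hk by simp
      moreover have "(h + x) + k \<noteq> k"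
        using x(2) by (auto simp: gf2_add_eq_0_iff)
      moreover have "(h + x) + k \<noteq> h + k" using x(2) by (simp add: add.assoc)
      ultimately show False by blast
    qed
    then obtain z where z: "z \<in> N" "z \<notin> {0, h + x, k, h + k}" by blast
    have zV: "z \<in> gf2_space n" using z(1) hyperplane_subset unfolding N_def N1_def by blast
    have inz: "g \<in> hyperplane n z" "g' \<in> hyperplane n z" "r \<in> hyperplane n z" "r' \<in> hyperplane n z"
    proof -
      have "z \<in> hyperplane n g" "z \<in> hyperplane n g'" "z \<in> hyperplane n r" "z \<in> hyperplane n r'"
        using z(1) zV unfolding N_def N1_def by (simp_all add: hyperplane_def)
      then show "g \<in> hyperplane n z" "g' \<in> hyperplane n z" "r \<in> hyperplane n z" "r' \<in> hyperplane n z"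
        using mem g r GV RV by blast+
    qed
    have zxh: "z \<noteq> x" "z \<noteq> h" using inz g r by blast+
    show False
    proof (cases "inseparable R (hyperplane n z)")
      case False
      have "near R z h"
      proof (rule near_transfer[OF near False hk(1,2) zV])
        have "k \<noteq> z + h"
        proof
          assume "k = z + h"
          then have "h + k = z" by (simp add: add.commute)
          then show False using z(2) by blast
        qed
        then show "k \<notin> {0, z, h, z + h}" using z(2) hk neq by auto
      qed
      then show False using nearD[of R z h r r'] inz r by blast
    next
      case True
      then have zG: "\<not> inseparable G (hyperplane n z)"
        using hyperplane_separable[OF zV] z(2) by blast
      have "near G z x"
      proof (rule sw.near_transfer[OF nx zG x(1) hk(1) zV])
        have "h \<noteq> z + x"
        proof
          assume "h = z + x"
          then have "h + x = z" by (simp add: add.assoc)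
          then show False using z(2) by blast
        qed
        then show "h \<notin> {0, z, x, z + x}" using zxh x(2) hk by auto
      qed
      then show False using nearD[of G z x g g'] inz g by blast
    qed
  next
    case False
    then have allG: "\<not> inseparable G (hyperplane n z)" if "z \<in> gf2_space n" "z \<notin> {0, h, k, h + k}" for z
      using that hyperplane_separable by blast
    obtain g g' where g: "g \<in> G - hyperplane n k" "g' \<in> G - hyperplane n k" "g \<noteq> g'"
      using two_outside hk by blast
    define N where "N = hyperplane n g \<inter> hyperplane n g'"
    have avoid: "\<exists>z\<in>N. z \<notin> set xs" if "length xs \<le> 8" for xs
    proof (rule ccontr)
      assume "\<not> ?thesis"
      then have "card N \<le> card (set xs)" by (intro card_mono) auto
      then show False using card_hyperplane_Int_ge[of g g'] card_length[of xs] that unfolding N_def by simp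
    qed
    have NV: "z \<in> gf2_space n" "g \<in> hyperplane n z" "g' \<in> hyperplane n z" if "z \<in> N" for z
      using that g GV mem hyperplane_subset unfolding N_def by blast+
    show False
    \<comment> \<open>If some other \<open>y\<close> has \<open>near R k y\<close>, transfer with
      the colours exchanged yields \<open>near G z k\<close>; if none has, the dichotomy leaves only
      this outcome. Both contradict the choice of \<open>g\<close> and \<open>g'\<close>.\<close>
    proof (cases "\<exists>y\<in>gf2_space n. y \<noteq> 0 \<and> y \<noteq> k \<and> near R k y")
      case True
      then obtain y where y: "y \<in> gf2_space n" "y \<noteq> 0" "y \<noteq> k" "near R k y" by blast
      obtain z where z: "z \<in> N" "z \<notin> set [0, h, k, h + k, y, y + k]"
        using avoid[of "[0, h, k, h + k, y, y + k]"] by auto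
      have zG: "\<not> inseparable G (hyperplane n z)" using allG NV(1)[OF z(1)] z(2) by simp
      have "near G z k"
      proof (rule sw.near_transfer[OF y(4) zG hk(2) y(1) NV(1)[OF z(1)]])
        have "y \<noteq> z + k"
        proof
          assume "y = z + k"
          then have "y + k = z" by (simp add: add.assoc)
          then show False using z(2) by simp
        qed
        then show "y \<notin> {0, z, k, z + k}" using z(2) y by auto
      qed
      then show False using nearD[of G z k g g'] NV[OF z(1)] g by blast
    next
      case False
      obtain z where z: "z \<in> N" "z \<notin> set [0, h, k, h + k]"
        using avoid[of "[0, h, k, h + k]"] by auto
      have zG: "\<not> inseparable G (hyperplane n z)" using allG NV(1)[OF z(1)] z(2) by simp
      have "near G z k" using near_dichotomy[OF zG k] False NV(1)[OF z(1)] z(2) by auto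
      then show False using nearD[of G z k g g'] NV[OF z(1)] g by blast
    qed
  qed
qed

end

text \<open>Mixed behaviour supplies the hypotheses of \<open>near_dichotomy\<close>, and
  \<open>not_near\<close> excludes both outcomes, the second one with the colours exchanged.\<close>

lemma (in critical_colouring) hyperplanes_separable:
  "(\<forall>h\<in>gf2_space n - {0}. \<not> inseparable G (hyperplane n h)) \<or> (\<forall>h\<in>gf2_space n - {0}. \<not> inseparable R (hyperplane n h))"
proof (rule ccontr)
  interpret sw: critical_colouring n R G by (rule swap)
  assume "\<not> ?thesis"
  then obtain h k where hk: "h \<in> gf2_space n - {0}" "k \<in> gf2_space n - {0}"
    "inseparable R (hyperplane n h)" "inseparable G (hyperplane n k)" by blast
  then have *: "\<not> inseparable G (hyperplane n h)" "\<not> inseparable R (hyperplane n k)"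
    using hyperplane_separable by blast+
  show False
    using near_dichotomy[OF *] not_near[OF _ *] sw.not_near[OF _ *(2,1)] hk by blast
qed

section \<open>Circuits and ears\<close>

text \<open>Coefficients over GF(2) are 0 or 1, so a linear dependency amounts to a nonempty finite
  set with sum 0; the minimal ones are the circuits of a binary matroid.\<close>

definition gf2_circuit :: "gf2_vec set \<Rightarrow> bool" where
  "gf2_circuit C \<longleftrightarrow> finite C \<and> C \<noteq> {} \<and> \<Sum>C = 0 \<and> (\<forall>E\<subseteq>C. \<Sum>E = 0 \<longrightarrow> E = {} \<or> E = C)"

lemma inseparable_pair: "p \<in> S \<Longrightarrow> inseparable S {0, p}"
  unfolding inseparable_def using gf2.subspace_0 by blast

lemma gf2_span_Un_subspaceE:
  assumes "v \<in> gf2.span (F \<union> D)" "gf2.subspace F"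
  obtains f E where "f \<in> F" "E \<subseteq> D" "v = f + \<Sum>E"
proof -
  obtain A where A: "A \<subseteq> F \<union> D" "finite A" "v = \<Sum>A"
    using gf2_span_sum[OF assms(1)] by blast
  have "v = \<Sum>(A \<inter> F) + \<Sum>(A - A \<inter> F)"
    using gf2_sum_Diff[OF A(2), of "A \<inter> F"] A(3)
    by (metis Int_lower1 add.commute gf2_add_self_left)
  moreover have "\<Sum>(A \<inter> F) \<in> F"
    using gf2_subspace_sum[OF assms(2), of "A \<inter> F"] by blast
  ultimately show thesis using that[of "\<Sum>(A \<inter> F)" "A - A \<inter> F"] A(1) by blast
qed

text \<open>This is a step of an ear decomposition. One of the two subspaces, say \<open>A\<close>,
  contains \<open>F\<close>. The part of \<open>D\<close> outside \<open>A\<close> lies in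
  \<open>B\<close>, while its sum is also in \<open>A\<close> and hence 0; by minimality of
  \<open>D\<close>, and as \<open>\<Sum>D\<close> is nonzero, this part is empty.\<close>

lemma inseparable_ear:
  assumes F: "gf2.subspace F" "inseparable S F" and D: "D \<subseteq> S" "finite D" "\<Sum>D \<in> F" "\<Sum>D \<noteq> 0"
    and sub: "\<And>E. E \<subseteq> D \<Longrightarrow> \<Sum>E \<in> F \<Longrightarrow> E = {} \<or> E = D"
  shows "inseparable S (gf2.span (F \<union> D))"
  unfolding inseparable_def
proof (intro allI impI)
  let ?W = "gf2.span (F \<union> D)"
  have key: "?W \<subseteq> A"
    if A: "gf2.subspace A" "gf2.subspace B" "A \<inter> B = {0}" "S \<inter> ?W \<subseteq> A \<union> B" "F \<subseteq> A" for A B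
  proof -
    let ?E = "D - D \<inter> A"
    have "D \<subseteq> ?W" using gf2.span_superset by blast
    then have "?E \<subseteq> B" using A(4) D(1) by blast
    then have "\<Sum>?E \<in> B" by (rule gf2_subspace_sum[OF A(2)])
    moreover have "\<Sum>?E = \<Sum>D + \<Sum>(D \<inter> A)" using D(2) by (intro gf2_sum_Diff) auto
    then have "\<Sum>?E \<in> A"
      using D(3) A(5) gf2_subspace_sum[OF A(1), of "D \<inter> A"] gf2.subspace_add[OF A(1)] by auto
    ultimately have E0: "\<Sum>?E = 0" using A(3) by blast
    then have "?E = {} \<or> ?E = D" using sub[of ?E] gf2.subspace_0[OF F(1)] by auto
    moreover have "?E \<noteq> D" using E0 D(4) by metis
    ultimately have "D \<subseteq> A" by blast
    then show ?thesis using A(1,5) by (intro gf2.span_minimal) auto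
  qed
  fix A B assume A: "gf2.subspace A" "gf2.subspace B" "A \<inter> B = {0}" "S \<inter> ?W \<subseteq> A \<union> B"
  have "F \<subseteq> ?W" using gf2.span_superset by blast
  then have "F \<subseteq> A \<or> F \<subseteq> B" using A by (intro inseparableD[OF F(2)]) auto
  moreover have "B \<inter> A = {0}" "S \<inter> ?W \<subseteq> B \<union> A" using A by auto
  ultimately show "?W \<subseteq> A \<or> ?W \<subseteq> B" using key[OF A] key[OF A(2,1)] by blast
qed

text \<open>The parts of \<open>C\<close> inside and outside \<open>A\<close> have the same sum,
  which lies in both subspaces and is therefore 0; so one part is empty.\<close>

lemma inseparable_circuit:
  assumes C: "gf2_circuit C" "C \<subseteq> S"
  shows "inseparable S (gf2.span C)"
  unfolding inseparable_def
proof (intro allI impI)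
  fix A B assume A: "gf2.subspace A" "gf2.subspace B" "A \<inter> B = {0}" "S \<inter> gf2.span C \<subseteq> A \<union> B"
  have CAB: "C \<subseteq> A \<union> B" using A(4) C(2) gf2.span_superset by blast
  have "\<Sum>(C - C \<inter> A) = \<Sum>C + \<Sum>(C \<inter> A)"
    using C(1) by (intro gf2_sum_Diff) (auto simp: gf2_circuit_def)
  then have "\<Sum>(C - C \<inter> A) = \<Sum>(C \<inter> A)" using C(1) by (simp add: gf2_circuit_def)
  moreover have "\<Sum>(C \<inter> A) \<in> A"
    using gf2_subspace_sum[OF A(1), of "C \<inter> A"] by blast
  moreover have "\<Sum>(C - C \<inter> A) \<in> B"
    using gf2_subspace_sum[OF A(2), of "C - C \<inter> A"] CAB by blast
  ultimately have "\<Sum>(C \<inter> A) = 0" using A(3) by auto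
  then have "C \<inter> A = {} \<or> C \<inter> A = C" using C(1) unfolding gf2_circuit_def by blast
  then have "C \<subseteq> A \<or> C \<subseteq> B" using CAB by blast
  then show "gf2.span C \<subseteq> A \<or> gf2.span C \<subseteq> B"
    using A(1,2) by (meson gf2.span_minimal)
qed

section \<open>Sizes of spans and the complement of a circuit\<close>

lemma card_span_sum_free:
  assumes "finite D" "\<And>E. E \<subseteq> D \<Longrightarrow> \<Sum>E = 0 \<Longrightarrow> E = {}"
  shows "finite (gf2.span D) \<and> card (gf2.span D) = 2 ^ card D"
  using assms
proof (induction D)
  case empty
  then show ?case by simp
next
  case (insert x D)
  have IH: "finite (gf2.span D)" "card (gf2.span D) = 2 ^ card D" using insert by blast+
  have x: "x \<notin> gf2.span D"
  proof
    assume "x \<in> gf2.span D"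
    then obtain A where A: "A \<subseteq> D" "finite A" "x = \<Sum>A" using gf2_span_sum by blast
    then have "\<Sum>(insert x A) = 0" using insert(2) by (subst sum.insert) auto
    then show False using insert(4)[of "insert x A"] A(1) by blast
  qed
  have eq: "gf2.span (insert x D) = gf2.span (insert x (gf2.span D))"
  proof
    show "gf2.span (insert x D) \<subseteq> gf2.span (insert x (gf2.span D))"
      using gf2.span_superset[of D] by (intro gf2.span_mono) auto
    have "gf2.span D \<subseteq> gf2.span (insert x D)" by (intro gf2.span_mono) auto
    then show "gf2.span (insert x (gf2.span D)) \<subseteq> gf2.span (insert x D)"
      using gf2.span_superset[of "insert x D"] by (intro gf2.span_minimal) auto
  qed
  have "card (gf2.span (insert x D)) = 2 * card (gf2.span D)"
    unfolding eq using x IH by (intro card_span_insert) auto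
  moreover have "finite (gf2.span (insert x D))"
    unfolding eq gf2_span_insert_subspace[OF gf2.subspace_span] using IH by simp
  ultimately show ?case using insert IH by simp
qed

lemma double_less_power: "4 \<le> m \<Longrightarrow> 2 * m + 4 < 2 ^ m"
  by (induction m rule: dec_induct) auto

text \<open>Two proper subspaces with trivial intersection cover at most
  \<open>card W / 2 + 1\<close> vectors of the span \<open>W\<close>, and the rest would belong to
  \<open>C\<close>. But \<open>card W\<close> is 2 to the power \<open>card C - 1\<close>, which is
  too large once \<open>C\<close> has 5 elements.\<close>

lemma inseparable_circuit_complement:
  assumes C: "gf2_circuit C" "5 \<le> card C" and R: "gf2.span C \<subseteq> insert 0 (C \<union> R)"
  shows "inseparable R (gf2.span C)"
proof (rule ccontr)
  let ?W = "gf2.span C"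
  have fC: "finite C" using C by (simp add: gf2_circuit_def)
  assume "\<not> ?thesis"
  then obtain A B where A: "gf2.subspace A" "gf2.subspace B" "A \<inter> B = {0}" "\<not> ?W \<subseteq> A" "\<not> ?W \<subseteq> B"
    and RA: "R \<inter> ?W \<subseteq> A \<union> B" using not_inseparableE by metis
  obtain c where c: "c \<in> C" using C by (auto simp: gf2_circuit_def)
  \<comment> \<open>Dropping one element of a circuit leaves a basis of its span.\<close>
  have sp: "gf2.span (C - {c}) = ?W"
  proof
    have "\<Sum>(C - {c}) = c" using gf2_sum_Diff[of C "{c}"] C c by (simp add: gf2_circuit_def)
    moreover have "\<Sum>(C - {c}) \<in> gf2.span (C - {c})" by (intro gf2.span_sum gf2.span_base)
    ultimately have "c \<in> gf2.span (C - {c})" by simp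
    then have "C \<subseteq> gf2.span (C - {c})" using gf2.span_superset[of "C - {c}"] by blast
    then show "?W \<subseteq> gf2.span (C - {c})" by (intro gf2.span_minimal) auto
  qed (intro gf2.span_mono, blast)
  have "finite (gf2.span (C - {c})) \<and> card (gf2.span (C - {c})) = 2 ^ card (C - {c})"
    using fC C(1) c by (intro card_span_sum_free) (auto simp: gf2_circuit_def)
  then have fW: "finite ?W" and cW: "card ?W = 2 ^ (card C - 1)"
    using sp c fC by (simp_all add: card_Diff_singleton)
  let ?A = "?W \<inter> A" and ?B = "?W \<inter> B"
  have sA: "gf2.subspace ?A" "gf2.subspace ?B" using A gf2.subspace_inter gf2.subspace_span by blast+
  have int: "?A \<inter> ?B = {0}" using A(3) gf2.span_zero[of C] by auto
  have "2 * card ?A + 2 * card ?B \<le> card ?W + 4"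
    by (rule card_Un_proper_subspaces[OF sA gf2.subspace_span fW _ _ int]) (use A(4,5) in auto)
  moreover have "card (?A \<union> ?B) + 1 = card ?A + card ?B"
    using fW by (intro card_Un_independent_subspaces sA int) auto
  moreover have "card ?W \<le> card ((?A \<union> ?B) \<union> C)"
  proof (rule card_mono)
    show "?W \<subseteq> (?A \<union> ?B) \<union> C" using R RA gf2.subspace_0[OF A(1)] by blast
  qed (use fW fC in auto)
  moreover have "card ((?A \<union> ?B) \<union> C) \<le> card (?A \<union> ?B) + card C"
    by (rule card_Un_le)
  ultimately have "card ?W \<le> 2 * card C + 2" by linarith
  moreover have "2 * (card C - 1) + 4 < 2 ^ (card C - 1)" using C(2) by (intro double_less_power) simp
  ultimately show False using cW C(2) by simp
qed

text \<open>Orthogonality to a basis of \<open>F\<close> is imposed one vector at a time, each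
  condition keeping at least half. As \<open>F\<close> is proper, more than one vector survives, and
  a nonzero one is the normal.\<close>

lemma psubspace_subset_hyperplane:
  assumes F: "gf2.subspace F" "F \<subset> gf2_space n"
  obtains y where "y \<in> gf2_space n" "y \<noteq> 0" "F \<subseteq> hyperplane n y"
proof -
  let ?V = "gf2_space n"
  obtain B where B: "B \<subseteq> F" "gf2.independent B" "F \<subseteq> gf2.span B"
    using gf2.maximal_independent_subset by blast
  have fB: "finite B" using B(1) F(2) finite_gf2_space finite_subset by (metis psubset_imp_subset)
  have "E = {}" if "E \<subseteq> B" "\<Sum>E = 0" for E
    using gf2_sum_unique[OF B(2) that(1) finite_subset[OF that(1) fB], of "{}"] that(2) by simp
  then have "card (gf2.span B) = 2 ^ card B" using card_span_sum_free[OF fB] by blast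
  moreover have "gf2.span B = F" using B F by (simp add: gf2.span_minimal subset_antisym)
  ultimately have cF: "card F = 2 ^ card B" by simp
  have ann: "gf2.subspace {y \<in> ?V. \<forall>b\<in>X. gf2_dot n b y = 0} \<and>
      card ?V \<le> 2 ^ card X * card {y \<in> ?V. \<forall>b\<in>X. gf2_dot n b y = 0}" if "finite X" for X
    using that
  proof (induction X)
    case empty
    then show ?case by (simp add: subspace_gf2_space)
  next
    case (insert x X)
    let ?Y = "{y \<in> ?V. \<forall>b\<in>X. gf2_dot n b y = 0}"
    have eq: "{y \<in> ?V. \<forall>b\<in>insert x X. gf2_dot n b y = 0} = {y \<in> ?Y. gf2_dot n x y = 0}"
      by auto
    have fY: "finite ?Y" using finite_gf2_space by simp
    have "card ?V \<le> 2 ^ card X * (2 * card {y \<in> ?Y. gf2_dot n x y = 0})"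
      using insert(3) card_dot_section[OF _ fY, of n x] by (meson le_trans mult_le_mono2)
    then show ?case
      unfolding eq using insert subspace_dot_section[of ?Y n x] by (simp add: mult.assoc mult.left_commute)
  qed
  let ?Y = "{y \<in> ?V. \<forall>b\<in>B. gf2_dot n b y = 0}"
  have "card F < card ?V" using F(2) finite_gf2_space by (rule psubset_card_mono[rotated])
  then have less: "card F < card F * card ?Y"
    using conjunct2[OF ann[OF fB]] unfolding cF by (rule less_le_trans)
  have "1 < card ?Y"
  proof (rule ccontr)
    assume "\<not> 1 < card ?Y"
    then have "card F * card ?Y \<le> card F * 1" by (intro mult_le_mono2) simp
    then show False using less by linarith
  qed
  then have "\<not> ?Y \<subseteq> {0}" using card_mono[of "{0}" ?Y] by force
  then obtain y where y: "y \<in> ?Y" "y \<noteq> 0" by blast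
  have "B \<subseteq> hyperplane n y"
    using y(1) B(1) F(2) by (auto simp: hyperplane_def gf2_dot_commute[of n y])
  then have "F \<subseteq> hyperplane n y" using B(3) gf2.span_minimal[OF _ subspace_hyperplane] by blast
  then show thesis using that y by blast
qed

text \<open>\<open>D\<close> and \<open>s\<close> form a circuit that meets \<open>F\<close> only in
  \<open>s\<close>. The new space is spanned by \<open>D\<close> and a hyperplane \<open>K\<close>
  of \<open>F\<close> through \<open>s\<close>: \<open>D\<close> brings two dimensions for the one
  lost. To keep \<open>G\<close> inseparable on \<open>K\<close>, this hyperplane is chosen to
  contain neither part of a separation of \<open>R\<close> on \<open>F\<close>.\<close>

lemma (in critical_colouring) larger_inseparable:
  assumes F: "gf2.subspace F" "F \<subset> gf2_space n" "inseparable G F" "16 \<le> card F"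
    and s: "s \<in> G" "s \<in> F"
    and D: "D \<subseteq> G" "card D = 3" "\<Sum>D = s"
    and sub: "\<And>E. E \<subseteq> D \<Longrightarrow> \<Sum>E \<in> F \<Longrightarrow> E = {} \<or> E = D"
  obtains F' where "gf2.subspace F'" "F' \<subset> gf2_space n" "inseparable G F'" "card F < card F'"
proof -
  have FV: "F \<subseteq> gf2_space n" using F(2) by blast
  have fF: "finite F" using FV finite_gf2_space finite_subset by blast
  have fD: "finite D" using D(2) by (intro card_ge_0_finite) simp
  have s0: "s \<noteq> 0" "s \<notin> R" using s colours by blast+
  have "\<not> inseparable R F" using separable[OF F(1,2)] F(3,4) by force
  then obtain A0 B0 where A0: "gf2.subspace A0" "gf2.subspace B0" "A0 \<inter> B0 = {0}"
    "R \<inter> F \<subseteq> A0 \<union> B0" "\<not> F \<subseteq> A0" "\<not> F \<subseteq> B0" by (rule not_inseparableE)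
  \<comment> \<open>A hyperplane through \<open>s\<close> can cut \<open>A\<close> properly only if
    \<open>A\<close> has a vector besides 0 and \<open>s\<close>. If it has none, \<open>A\<close>
    contains no point of \<open>R\<close>, since \<open>s\<close> is in \<open>G\<close>, and a
    suitable \<open>{0, t}\<close> can replace it.\<close>
  have enlarge: "\<exists>A'. gf2.subspace A' \<and> A' \<subseteq> F \<and> A' \<inter> B = {0} \<and> R \<inter> F \<subseteq> A' \<union> B \<and> \<not> F \<subseteq> A' \<and>
      (\<exists>a\<in>A'. a \<notin> {0, s})"
    if A: "gf2.subspace A" "gf2.subspace B" "A \<subseteq> F" "B \<subseteq> F" "A \<inter> B = {0}" "R \<inter> F \<subseteq> A \<union> B"
      "\<not> F \<subseteq> A" "\<not> F \<subseteq> B" for A B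
  proof (cases "A \<subseteq> {0, s}")
    case False
    then show ?thesis using A by (intro exI[of _ A]) blast
  next
    case True
    have z: "0 \<in> B" using gf2.subspace_0[OF A(2)] .
    have cB: "2 * card B \<le> card F" by (rule card_proper_subspace[OF A(2) F(1) fF A(4) A(8)])
    have "\<not> F \<subseteq> insert s B"
    proof
      assume "F \<subseteq> insert s B"
      then have "card F \<le> card (insert s B)"
        using finite_subset[OF A(4) fF] by (intro card_mono) auto
      also have "\<dots> \<le> Suc (card B)" by (rule card_insert_le_m1) auto
      finally show False using cB F(4) by linarith
    qed
    then obtain t where t: "t \<in> F" "t \<notin> B" "t \<noteq> s" by blast
    have "\<not> F \<subseteq> {0, t}"
    proof
      assume "F \<subseteq> {0, t}"
      then have "card F \<le> card {0, t}" by (intro card_mono) auto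
      also have "\<dots> \<le> 2" by (simp add: card_insert_if)
      finally show False using F(4) by simp
    qed
    moreover have "R \<inter> F \<subseteq> {0, t} \<union> B" using A(6) True s0(2) by blast
    moreover have "{0, t} \<inter> B = {0}" using z t by blast
    moreover have "t \<notin> {0, s}" using t z by blast
    ultimately show ?thesis
      using gf2_subspace_pair[of t] t(1) gf2.subspace_0[OF F(1)] by (intro exI[of _ "{0, t}"]) blast
  qed
  have z: "0 \<in> F" using gf2.subspace_0[OF F(1)] .
  have sub0: "gf2.subspace (A0 \<inter> F)" "gf2.subspace (B0 \<inter> F)"
    using gf2.subspace_inter A0(1,2) F(1) by blast+
  have i0: "(A0 \<inter> F) \<inter> (B0 \<inter> F) = {0}" "R \<inter> F \<subseteq> (A0 \<inter> F) \<union> (B0 \<inter> F)" "\<not> F \<subseteq> A0 \<inter> F" "\<not> F \<subseteq> B0 \<inter> F"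
    using A0(3-6) z by blast+
  obtain A where A: "gf2.subspace A" "A \<subseteq> F" "A \<inter> (B0 \<inter> F) = {0}" "R \<inter> F \<subseteq> A \<union> (B0 \<inter> F)"
    "\<not> F \<subseteq> A" "\<exists>a\<in>A. a \<notin> {0, s}"
    using enlarge[OF sub0 Int_lower2 Int_lower2 i0] by (elim exE conjE)
  have i1: "(B0 \<inter> F) \<inter> A = {0}" "R \<inter> F \<subseteq> (B0 \<inter> F) \<union> A" "\<not> F \<subseteq> B0 \<inter> F"
    using A(3,4) A0(6) by blast+
  obtain B where B: "gf2.subspace B" "B \<subseteq> F" "B \<inter> A = {0}" "R \<inter> F \<subseteq> B \<union> A"
    "\<exists>b\<in>B. b \<notin> {0, s}"
    using enlarge[OF sub0(2) A(1) Int_lower2 A(2) i1 A(5)] by (elim exE conjE)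
  obtain a where a: "a \<in> A" "a \<notin> {0, s}" using A(6) by blast
  obtain b where b: "b \<in> B" "b \<notin> {0, s}" using B(5) by blast
  \<comment> \<open>The vectors \<open>a\<close> and \<open>b\<close> will witness that
    \<open>K\<close> halves both \<open>A\<close> and \<open>B\<close>.\<close>
  obtain y where y: "y \<in> gf2_space n" "gf2_dot n y s = 0" "gf2_dot n y a \<noteq> 0" "gf2_dot n y b \<noteq> 0"
    by (rule exists_dual_vector[of s n a b]) (use s a b A(2) B(2) FV in auto)
  define K where "K = {x \<in> F. gf2_dot n y x = 0}"
  have sK: "gf2.subspace K" unfolding K_def by (rule subspace_dot_section[OF F(1)])
  have KF: "K \<subseteq> F" and fK: "finite K" using fF unfolding K_def by auto
  have aF: "a \<in> F" "a \<notin> K" using a A(2) y(3) unfolding K_def by auto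
  have sinK: "s \<in> K" using s y unfolding K_def by blast
  have cK: "card F = 2 * card K"
    unfolding K_def by (rule card_dot_section_eq[OF F(1) fF aF(1) y(3)])
  have eqs: "{x \<in> A. gf2_dot n y x = 0} = K \<inter> A" "{x \<in> B. gf2_dot n y x = 0} = K \<inter> B"
    using A(2) B(2) unfolding K_def by blast+
  have cA: "card A = 2 * card (K \<inter> A)"
    using card_dot_section_eq[OF A(1) finite_subset[OF A(2) fF] a(1) y(3)] eqs by simp
  have cB: "card B = 2 * card (K \<inter> B)"
    using card_dot_section_eq[OF B(1) finite_subset[OF B(2) fF] b(1) y(4)] eqs by simp
  have AB: "A \<inter> B = {0}" using B(3) by blast
  have "card A * card B \<le> card F"
    by (rule card_independent_subspaces[OF A(1) B(1) F(1) fF A(2) B(2) AB])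
  \<comment> \<open>Halving both parts but \<open>F\<close> only once gains a factor 2; this is the
    product condition of \<open>subspaces_not_cover\<close> in case \<open>K\<close> has just 8
    vectors.\<close>
  then have small: "2 * (card (K \<inter> A) * card (K \<inter> B)) \<le> card K" using cA cB cK by simp
  have zK: "0 \<in> K \<inter> A" "0 \<in> K \<inter> B"
    using gf2.subspace_0 sK A(1) B(1) by blast+
  then have pos: "1 \<le> card (K \<inter> A)" "1 \<le> card (K \<inter> B)"
    using fK card_mono[of "K \<inter> A" "{0}"] card_mono[of "K \<inter> B" "{0}"] by simp_all
  have K8: "8 \<le> card K" using cK F(4) by linarith
  have nK: "\<not> K \<subseteq> A" "\<not> K \<subseteq> B"
  proof -
    show "\<not> K \<subseteq> A"
    proof
      assume "K \<subseteq> A"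
      then have "K \<inter> A = K" by blast
      moreover have "card (K \<inter> A) * 1 \<le> card (K \<inter> A) * card (K \<inter> B)"
        using pos(2) by (rule mult_le_mono2)
      ultimately show False using small K8 by simp
    qed
    show "\<not> K \<subseteq> B"
    proof
      assume "K \<subseteq> B"
      then have "K \<inter> B = K" by blast
      moreover have "1 * card (K \<inter> B) \<le> card (K \<inter> A) * card (K \<inter> B)"
        using pos(1) by (rule mult_le_mono1)
      ultimately show False using small K8 by simp
    qed
  qed
  have GK: "inseparable G K"
  proof (rule ccontr)
    assume "\<not> inseparable G K"
    then obtain A' B' where A': "gf2.subspace A'" "gf2.subspace B'" "A' \<inter> B' = {0}" "G \<inter> K \<subseteq> A' \<union> B'"
      "\<not> K \<subseteq> A'" "\<not> K \<subseteq> B'" by (rule not_inseparableE)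
    have "K \<subseteq> A \<union> B \<union> (A' \<union> B')"
    proof
      fix p assume p: "p \<in> K"
      then have "p = 0 \<or> p \<in> G \<or> p \<in> R" using colour_cases KF FV by blast
      then show "p \<in> A \<union> B \<union> (A' \<union> B')" using p B(4) A'(4) zK KF by blast
    qed
    then show False
      using subspaces_not_cover[OF sK fK A(1) B(1) AB nK A'(1-3,5,6)] K8 small by blast
  qed
  have subK: "E = {} \<or> E = D" if "E \<subseteq> D" "\<Sum>E \<in> K" for E using sub[OF that(1)] that(2) KF by blast
  let ?W = "gf2.span (K \<union> D)"
  have "\<Sum>D \<in> K" "\<Sum>D \<noteq> 0" using D(3) sinK s0 by simp_all
  then have insep: "inseparable G ?W" using inseparable_ear[OF sK GK D(1) fD _ _ subK] by blast
  have WV: "?W \<subseteq> gf2_space n"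
    using KF FV D(1) colours(1) by (intro gf2.span_minimal subspace_gf2_space) blast
  \<comment> \<open>The new space meets \<open>F\<close> only in \<open>K\<close>, so it misses
    \<open>a\<close> and is proper.\<close>
  have "a \<notin> ?W"
  proof
    assume "a \<in> ?W"
    then obtain k E where k: "k \<in> K" "E \<subseteq> D" "a = k + \<Sum>E"
      using gf2_span_Un_subspaceE[OF _ sK] by metis
    then have "\<Sum>E = k + a" by simp
    then have "\<Sum>E \<in> F" using k(1) KF aF(1) gf2.subspace_add[OF F(1)] by auto
    then have "\<Sum>E = 0 \<or> \<Sum>E = s" using sub[OF k(2)] D(3) by auto
    then have "\<Sum>E \<in> K" using sinK gf2.subspace_0[OF sK] by auto
    then show False using k gf2.subspace_add[OF sK] aF(2) by blast
  qed
  then have psub: "?W \<subset> gf2_space n" using WV aF FV by blast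
  \<comment> \<open>Two elements of \<open>D\<close> are independent modulo \<open>K\<close>, so the
    new space has at least four times as many vectors as \<open>K\<close>, twice as many as
    \<open>F\<close>.\<close>
  obtain d e f where def: "D = {d, e, f}" "d \<noteq> e" "d \<noteq> f" "e \<noteq> f"
    using D(2) by (auto simp: card_3_iff)
  have dK: "d \<notin> K" using subK[of "{d}"] def by auto
  have dF: "d + e \<notin> F" using sub[of "{d, e}"] def by auto
  have eF: "e \<notin> F" using sub[of "{e}"] def by auto
  have eK: "e \<notin> gf2.span (insert d K)"
  proof
    assume "e \<in> gf2.span (insert d K)"
    then have "e \<in> K \<or> (\<exists>k\<in>K. e = d + k)"
      unfolding gf2_span_insert_subspace[OF sK] by blast
    then show False using dF eF KF by auto
  qed
  have c1: "card (gf2.span (insert d K)) = 2 * card K" by (rule card_span_insert[OF sK fK dK])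
  then have f1: "finite (gf2.span (insert d K))" using K8 by (intro card_ge_0_finite) simp
  have "card (gf2.span (insert e (gf2.span (insert d K)))) = 4 * card K"
    using card_span_insert[OF gf2.subspace_span f1 eK] c1 by simp
  moreover have "gf2.span (insert e (gf2.span (insert d K))) \<subseteq> ?W"
  proof (rule gf2.span_minimal)
    have "gf2.span (insert d K) \<subseteq> ?W" using def by (intro gf2.span_mono) auto
    then show "insert e (gf2.span (insert d K)) \<subseteq> ?W"
      using gf2.span_base[of e "K \<union> D"] def(1) by blast
  qed auto
  then have "card (gf2.span (insert e (gf2.span (insert d K)))) \<le> card ?W"
    using finite_subset[OF WV finite_gf2_space] by (rule card_mono[rotated])
  ultimately have "card F < card ?W" using cK K8 by linarith
  then show thesis using that[OF gf2.subspace_span psub insep] by blast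
qed

section \<open>From separable hyperplanes to a circuit\<close>

lemma ex_card_maximal:
  assumes "finite X" "X \<noteq> {}"
  obtains x where "x \<in> X" "\<And>y. y \<in> X \<Longrightarrow> card y \<le> card x"
proof -
  have "Max (card ` X) \<in> card ` X" using assms by (intro Max_in) auto
  then obtain x where x: "x \<in> X" "Max (card ` X) = card x" by blast
  then have "card y \<le> card x" if "y \<in> X" for y
    using Max_ge[of "card ` X" "card y"] assms(1) that by simp
  then show thesis using that x(1) by blast
qed

lemma (in critical_colouring) circuit_if_hyperplanes_separable:
  assumes hyps: "\<And>h. h \<in> gf2_space n \<Longrightarrow> h \<noteq> 0 \<Longrightarrow> \<not> inseparable G (hyperplane n h)"
  shows "gf2_circuit G"
proof -
  let ?V = "gf2_space n"
  have GV: "G \<subseteq> ?V" and G0: "0 \<notin> G" using colours(1) by blast+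
  have fG: "finite G" using GV finite_gf2_space finite_subset by blast
  define FF where "FF = {F. gf2.subspace F \<and> F \<subset> ?V \<and> inseparable G F}"
  have "\<not> ?V \<subseteq> {0}" using card_mono[of "{0}" ?V] card_space by force
  then obtain u where u: "u \<in> ?V" "u \<noteq> 0" by blast
  \<comment> \<open>The subspace \<open>{0, p}\<close> shows that the family \<open>FF\<close> is
    not empty.\<close>
  obtain p where p: "p \<in> G" using two_outside[OF u] by blast
  have "\<not> ?V \<subseteq> {0, p}"
  proof
    assume "?V \<subseteq> {0, p}"
    then have "card ?V \<le> card {0, p}" by (intro card_mono) auto
    also have "\<dots> \<le> 2" by (simp add: card_insert_if)
    finally show False using card_space by simp
  qed
  moreover have "{0, p} \<subseteq> ?V" using p GV gf2.subspace_0[OF subspace_gf2_space] by blast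
  ultimately have pF: "{0, p} \<in> FF"
    unfolding FF_def using gf2_subspace_pair inseparable_pair[OF p] by blast
  have "FF \<subseteq> Pow ?V" unfolding FF_def by blast
  then have "finite FF" using finite_gf2_space by (metis finite_Pow_iff finite_subset)
  then obtain F where F: "F \<in> FF" and Fmax: "\<And>F'. F' \<in> FF \<Longrightarrow> card F' \<le> card F"
    using ex_card_maximal pF by (metis empty_iff)
  have sF: "gf2.subspace F" and FV: "F \<subset> ?V" and iF: "inseparable G F"
    using F unfolding FF_def by blast+
  have fF: "finite F" using FV finite_gf2_space finite_subset by (metis psubset_imp_subset)
  have "p \<noteq> 0" using p G0 by blast
  then have "card {0, p} = 2" by (simp add: card_insert_if)
  then have F2: "2 \<le> card F" using Fmax[OF pF] by simp

  let ?P = "\<lambda>D. D \<subseteq> G - F \<and> \<Sum>D \<in> F - {0}"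
  \<comment> \<open>Otherwise \<open>F\<close> and the span of \<open>G - F\<close> would separate
    \<open>G\<close> on the whole space.\<close>
  have "\<exists>D. ?P D"
  proof (rule ccontr)
    assume no: "\<nexists>D. ?P D"
    let ?S = "gf2.span (G - F)"
    have "v = 0" if v: "v \<in> F" "v \<in> ?S" for v
    proof -
      obtain A where "A \<subseteq> G - F" "v = \<Sum>A" using gf2_span_sum[OF v(2)] by blast
      then show ?thesis using no v(1) by blast
    qed
    then have "F \<inter> ?S = {0}" using gf2.subspace_0[OF sF] gf2.span_zero by blast
    moreover have "G \<inter> ?V \<subseteq> F \<union> ?S" using gf2.span_superset by blast
    ultimately have "?V \<subseteq> F \<or> ?V \<subseteq> ?S"
      by (intro inseparableD[OF inseparable_G sF gf2.subspace_span])
    then have "F \<subseteq> ?S" using FV by blast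
    then have "F \<subseteq> {0}" using \<open>F \<inter> ?S = {0}\<close> by blast
    then have "card F \<le> card {0 :: gf2_vec}" by (intro card_mono) auto
    then show False using F2 by simp
  qed
  then obtain D where PD: "?P D" and Dmin: "\<And>E. ?P E \<Longrightarrow> card D \<le> card E"
    using ex_has_least_nat[of ?P _ card] by metis
  define s where "s = \<Sum>D"
  have sFs: "s \<in> F" "s \<noteq> 0" and DG: "D \<subseteq> G" and DF: "D \<inter> F = {}"
    using PD unfolding s_def by blast+
  have fD: "finite D" using DG fG finite_subset by blast
  have subD: "\<Sum>(D - E) = s + \<Sum>E" if "E \<subseteq> D" for E
    unfolding s_def by (rule gf2_sum_Diff[OF fD that])
  \<comment> \<open>Removing a subset with sum 0 keeps the sum \<open>s\<close>, and a subset with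
    nonzero sum in \<open>F\<close> is itself a candidate; minimality of \<open>D\<close> settles
    both cases.\<close>
  have Dsub: "E = {} \<or> E = D" if E: "E \<subseteq> D" "\<Sum>E \<in> F" for E
  proof (cases "\<Sum>E = 0")
    case True
    then have "?P (D - E)" using subD[OF E(1)] sFs PD by auto
    then have "card D \<le> card (D - E)" by (rule Dmin)
    moreover have "card (D - E) = card D - card E"
      by (rule card_Diff_subset[OF finite_subset[OF E(1) fD] E(1)])
    moreover have "card E \<le> card D" by (rule card_mono[OF fD E(1)])
    ultimately have "card E = 0" by linarith
    then show ?thesis using finite_subset[OF E(1) fD] by simp
  next
    case False
    then have "?P E" using E PD by blast
    then have "card D \<le> card E" by (rule Dmin)
    then show ?thesis using card_seteq[OF fD E(1)] by blast
  qed
  have D0: "D \<noteq> {}" using sFs(2) unfolding s_def by auto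

  \<comment> \<open>Attaching the ear \<open>D\<close> enlarges \<open>F\<close>, so by maximality
    the result is the whole space.\<close>
  have "inseparable G (gf2.span (F \<union> D))"
    by (rule inseparable_ear[OF sF iF DG fD]) (use sFs Dsub in \<open>auto simp: s_def\<close>)
  moreover have spV: "gf2.span (F \<union> D) \<subseteq> ?V"
    using FV DG GV by (intro gf2.span_minimal subspace_gf2_space) blast
  moreover have "\<not> gf2.span (F \<union> D) \<subset> ?V" if "inseparable G (gf2.span (F \<union> D))"
  proof
    assume "gf2.span (F \<union> D) \<subset> ?V"
    then have "card (gf2.span (F \<union> D)) \<le> card F"
      using that by (intro Fmax) (auto simp: FF_def)
    moreover have "F \<subset> gf2.span (F \<union> D)"
      using gf2.span_superset[of "F \<union> D"] D0 DF by blast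
    then have "card F < card (gf2.span (F \<union> D))"
      using spV finite_gf2_space finite_subset by (metis psubset_card_mono)
    ultimately show False by linarith
  qed
  ultimately have V: "?V = gf2.span (F \<union> D)" by blast

  have "card D \<noteq> 1"
  proof
    assume "card D = 1"
    then obtain d where "D = {d}" by (auto simp: card_1_singleton_iff)
    then show False using sFs DF unfolding s_def by auto
  qed
  \<comment> \<open>With two elements in \<open>D\<close>, the space \<open>F\<close> would have
    index 2 and be a hyperplane, contrary to \<open>hyps\<close>.\<close>
  moreover have "card D \<noteq> 2"
  proof
    assume "card D = 2"
    then obtain d e where de: "D = {d, e}" "d \<noteq> e" by (auto simp: card_2_iff)
    have "s = d + e" unfolding s_def using de by simp
    then have e: "e = d + s" by simp
    have "F \<union> D \<subseteq> gf2.span (insert d F)"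
      unfolding gf2_span_insert_subspace[OF sF] using de(1) e sFs(1) gf2.subspace_0[OF sF]
      by (auto intro: image_eqI[of d "(+) d" 0])
    then have "?V \<subseteq> gf2.span (insert d F)" unfolding V by (intro gf2.span_minimal) auto
    moreover have "finite (gf2.span (insert d F))"
      unfolding gf2_span_insert_subspace[OF sF] using fF by simp
    ultimately have "card ?V \<le> card (gf2.span (insert d F))" by (intro card_mono)
    also have "\<dots> = 2 * card F" using de DF by (intro card_span_insert[OF sF fF]) auto
    finally have cV: "card ?V \<le> 2 * card F" .
    obtain y where y: "y \<in> ?V" "y \<noteq> 0" "F \<subseteq> hyperplane n y"
      using psubspace_subset_hyperplane[OF sF FV] by blast
    have "2 * card (hyperplane n y) \<le> card ?V"
      using hyperplane_psubset[OF y(1,2)]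
      by (intro card_proper_subspace subspace_hyperplane subspace_gf2_space finite_gf2_space) auto
    then have "F = hyperplane n y" using cV by (intro card_seteq finite_hyperplane y(3)) simp
    then show False using hyps[OF y(1,2)] iF by simp
  qed
  moreover have "card D \<noteq> 0" using D0 fD by simp
  ultimately have D3: "3 \<le> card D" by linarith

  \<comment> \<open>For a further point \<open>g\<close> the set \<open>insert g E\<close> competes
    with \<open>D\<close>. Minimality then forces \<open>E\<close> to miss only one element
    \<open>d\<close> of \<open>D\<close>, and \<open>{g, d}\<close> is a competitor with two
    elements.\<close>
  have GFD: "g \<in> D" if g: "g \<in> G" "g \<notin> F" for g
  proof (rule ccontr)
    assume gD: "g \<notin> D"
    obtain f0 E0 where 0: "f0 \<in> F" "E0 \<subseteq> D" "g = f0 + \<Sum>E0"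
      using gf2_span_Un_subspaceE[OF _ sF] g(1) GV V by (metis subsetD)
    \<comment> \<open>If the component in \<open>F\<close> is 0, passing from \<open>E0\<close> to
      its complement in \<open>D\<close> changes it to \<open>s\<close>.\<close>
    have "\<exists>f E. f \<in> F \<and> f \<noteq> 0 \<and> E \<subseteq> D \<and> g = f + \<Sum>E"
    proof (cases "f0 = 0")
      case True
      then have "g = s + \<Sum>(D - E0)" using 0(3) subD[OF 0(2)] by simp
      then show ?thesis using sFs by blast
    qed (use 0 in blast)
    then obtain f E where E: "f \<in> F" "f \<noteq> 0" "E \<subseteq> D" "g = f + \<Sum>E" by blast
    have fE: "finite E" using E(3) fD finite_subset by blast
    have "\<Sum>(insert g E) = f"
      using E(3,4) gD fE by (subst sum.insert) (auto simp: add.assoc)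
    then have "?P (insert g E)" using E g DG DF by auto
    then have "card D \<le> card (insert g E)" by (rule Dmin)
    then have "card D \<le> Suc (card E)" using card_insert_le_m1[of "Suc (card E)" E g] by simp
    moreover have "E \<noteq> D"
    proof
      assume "E = D"
      then have "g = f + s" using E(4) unfolding s_def by simp
      then show False using g(2) gf2.subspace_add[OF sF E(1) sFs(1)] by simp
    qed
    then have "card E < card D" using E(3) fD by (intro psubset_card_mono) auto
    ultimately have "card (D - E) = 1" using card_Diff_subset[OF fE E(3)] by linarith
    then obtain d where d: "D - E = {d}" by (auto simp: card_1_singleton_iff)
    have "d = s + \<Sum>E" using subD[OF E(3)] d by simp
    then have gd: "g + d = f + s" using E(4) by (simp add: ac_simps)
    have dD: "d \<in> D" using d by blast
    have "g \<noteq> d" using dD gD by blast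
    then have "g + d \<noteq> 0" by (simp add: gf2_add_eq_0_iff)
    moreover have "g + d \<in> F" unfolding gd by (rule gf2.subspace_add[OF sF E(1) sFs(1)])
    moreover have "\<Sum>{g, d} = g + d" using \<open>g \<noteq> d\<close> by simp
    ultimately have "?P {g, d}" using g dD DG DF by auto
    then have "card D \<le> card {g, d}" by (rule Dmin)
    then show False using D3 \<open>g \<noteq> d\<close> by simp
  qed

  let ?Q = "\<lambda>P. P \<subseteq> G \<inter> F \<and> \<Sum>P = s"
  have "s \<in> gf2.span (G \<inter> F)" using inseparable_subset_span[OF iF] sFs(1) by blast
  then have "\<exists>P. ?Q P" using gf2_span_sum by metis
  then obtain P where QP: "?Q P" and Pmin: "\<And>E. ?Q E \<Longrightarrow> card P \<le> card E"
    using ex_has_least_nat[of ?Q _ card] by metis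
  have fP: "finite P" using QP fG finite_subset by blast
  have PF: "P \<subseteq> F" and PG: "P \<subseteq> G" and Ps: "\<Sum>P = s" using QP by blast+
  have subP: "\<Sum>(P - E) = s + \<Sum>E" if "E \<subseteq> P" for E
    using gf2_sum_Diff[OF fP that] Ps by simp
  define C where "C = P \<union> D"
  have PD0: "P \<inter> D = {}" using PF DF by blast
  have split: "\<Sum>E = \<Sum>(E \<inter> P) + \<Sum>(E \<inter> D)" if "E \<subseteq> C" for E
  proof -
    have "E = (E \<inter> P) \<union> (E \<inter> D)" using that unfolding C_def by blast
    then show ?thesis using sum.union_disjoint[of "E \<inter> P" "E \<inter> D" "\<lambda>x. x"] fP fD PD0 by auto
  qed
  have sumF: "\<Sum>(E \<inter> P) \<in> F" for E using gf2_subspace_sum[OF sF, of "E \<inter> P"] PF by blast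
  have circ: "gf2_circuit C"
    unfolding gf2_circuit_def
  proof (intro conjI allI impI)
    show "finite C" "C \<noteq> {}" unfolding C_def using fP fD D0 by auto
    have "C \<inter> P = P" "C \<inter> D = D" unfolding C_def by auto
    then show "\<Sum>C = 0" using split[of C] Ps s_def by simp
    fix E assume E: "E \<subseteq> C" "\<Sum>E = 0"
    have eq: "\<Sum>(E \<inter> P) = \<Sum>(E \<inter> D)"
      using split[OF E(1)] E(2) by (simp add: gf2_add_eq_0_iff)
    then have "E \<inter> D = {} \<or> E \<inter> D = D" using Dsub[of "E \<inter> D"] sumF[of E] by auto
    then show "E = {} \<or> E = C"
    proof
      assume ED: "E \<inter> D = {}"
      then have "\<Sum>(E \<inter> P) = 0" using eq by simp
      then have "\<Sum>(P - E \<inter> P) = s" using subP[of "E \<inter> P"] by simp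
      then have "card P \<le> card (P - E \<inter> P)" using QP by (intro Pmin) blast
      moreover have "card (P - E \<inter> P) = card P - card (E \<inter> P)"
        using fP by (intro card_Diff_subset) auto
      moreover have "card (E \<inter> P) \<le> card P" using fP by (intro card_mono) auto
      ultimately have "card (E \<inter> P) = 0" by linarith
      then have "E \<inter> P = {}" using fP by simp
      then show ?thesis using ED E(1) unfolding C_def by blast
    next
      assume ED: "E \<inter> D = D"
      then have "\<Sum>(E \<inter> P) = s" using eq s_def by simp
      then have "card P \<le> card (E \<inter> P)" using QP by (intro Pmin) blast
      then have "E \<inter> P = P" using fP by (intro card_seteq) auto
      then show ?thesis using ED E(1) unfolding C_def by blast
    qed
  qed
  have CG: "C \<subseteq> G" unfolding C_def using PG DG by blast
  \<comment> \<open>A further point of \<open>G\<close> in the span would lie in \<open>F\<close>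
    and be the sum of at least two elements of \<open>P\<close>; putting it in their place would
    shorten \<open>P\<close>.\<close>
  have GC: "g \<in> C" if g: "g \<in> G" "g \<in> gf2.span C" for g
  proof (cases "g \<in> F")
    case False
    then show ?thesis using GFD g(1) unfolding C_def by blast
  next
    case True
    obtain A where A: "A \<subseteq> C" "g = \<Sum>A" using gf2_span_sum[OF g(2)] by blast
    have gA: "g = \<Sum>(A \<inter> P) + \<Sum>(A \<inter> D)" using split[OF A(1)] A(2) by simp
    then have "\<Sum>(A \<inter> D) = \<Sum>(A \<inter> P) + g" by simp
    then have "\<Sum>(A \<inter> D) \<in> F" using gf2.subspace_add[OF sF sumF[of A] True] by simp
    then have "A \<inter> D = {} \<or> A \<inter> D = D" using Dsub[of "A \<inter> D"] by blast
    \<comment> \<open>If all of \<open>D\<close> occurs, its sum \<open>s\<close> is also that of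
      \<open>P\<close>, and complementing within \<open>P\<close> removes \<open>D\<close>.\<close>
    then have "\<exists>S\<subseteq>P. g = \<Sum>S"
    proof
      assume "A \<inter> D = {}"
      then have "g = \<Sum>(A \<inter> P)" using gA by simp
      then show ?thesis by blast
    next
      assume "A \<inter> D = D"
      then have "g = \<Sum>(P - A \<inter> P)"
        using gA subP[of "A \<inter> P"] s_def by (simp add: add.commute)
      then show ?thesis by blast
    qed
    then obtain S where S: "S \<subseteq> P" "g = \<Sum>S" by blast
    have fS: "finite S" using S(1) fP finite_subset by blast
    show ?thesis
    proof (rule ccontr)
      assume "g \<notin> C"
      then have gP: "g \<notin> P" unfolding C_def by blast
      have "card S \<noteq> 0" using S(2) g(1) G0 fS by auto
      moreover have "card S \<noteq> 1"
      proof
        assume "card S = 1"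
        then obtain t where "S = {t}" by (auto simp: card_1_singleton_iff)
        then show False using S gP by auto
      qed
      ultimately have S2: "2 \<le> card S" by linarith
      have "\<Sum>(insert g (P - S)) = g + \<Sum>(P - S)" using fP gP by (intro sum.insert) auto
      also have "\<dots> = s" using subP[OF S(1)] S(2) by (simp add: ac_simps)
      finally have "card P \<le> card (insert g (P - S))"
        using QP g(1) True by (intro Pmin) blast
      also have "\<dots> = Suc (card P - card S)"
        using fP gP card_Diff_subset[OF fS S(1)] by simp
      finally show False using S2 card_mono[OF fP S(1)] by linarith
    qed
  qed

  show ?thesis
  proof (cases "gf2.span C = ?V")
    case True
    then have "G = C" using CG GC GV by blast
    then show ?thesis using circ by simp
  next
    case False
    then have CV: "gf2.span C \<subset> ?V"
      using CG GV gf2.span_minimal[OF _ subspace_gf2_space] by blast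
    have c3: "{0} \<union> D \<subseteq> gf2.span C"
      using gf2.span_superset[of C] gf2.span_zero[of C] unfolding C_def by blast
    have "0 \<notin> D" using DG G0 by blast
    then have "card ({0} \<union> D) = Suc (card D)" using fD by simp
    moreover have "card ({0} \<union> D) \<le> card (gf2.span C)"
      using c3 CV finite_gf2_space finite_subset by (metis card_mono psubset_imp_subset)
    ultimately have "4 \<le> card (gf2.span C)" using D3 by linarith
    \<comment> \<open>\<open>G\<close> is inseparable on this proper subspace, so \<open>R\<close>
      is not. This bounds the circuit by 4 elements, leaving three for \<open>D\<close> and one for
      \<open>P\<close>, namely \<open>s\<close>.\<close>
    then have "\<not> inseparable R (gf2.span C)"
      using separable[OF gf2.subspace_span CV] inseparable_circuit[OF circ CG] by blast
    moreover have "gf2.span C \<subseteq> insert 0 (C \<union> R)" using CV GC colour_cases by blast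
    ultimately have "card C < 5" using inseparable_circuit_complement[OF circ] by (meson not_le)
    moreover have "card C = card P + card D" unfolding C_def using fP fD PD0 by (rule card_Un_disjoint)
    moreover have "card P \<noteq> 0" using Ps sFs(2) fP by auto
    ultimately have "card D = 3" "card P = 1" using D3 by linarith+
    then obtain t where "P = {t}" by (auto simp: card_1_singleton_iff)
    then have sG: "s \<in> G" using Ps PG by simp
    obtain d e f where def: "D = {d, e, f}" "d \<noteq> e" "d \<noteq> f" "e \<noteq> f"
      using \<open>card D = 3\<close> by (auto simp: card_3_iff)
    \<comment> \<open>As \<open>f\<close> is a combination of \<open>d\<close>, \<open>e\<close> and
      \<open>s\<close>, the vectors \<open>d\<close> and \<open>e\<close> alone extend
      \<open>F\<close> to the whole space; so \<open>F\<close> has at least 16 vectors.\<close>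
    let ?U = "gf2.span (insert d F)"
    have sf: "s = d + (e + f)" unfolding s_def using def by simp
    have f: "f = e + (d + s)" unfolding sf by simp
    have U: "d \<in> ?U" "F \<subseteq> ?U" using gf2.span_superset[of "insert d F"] by blast+
    then have "d + s \<in> ?U" using sFs(1) gf2.span_add by blast
    then have "f \<in> gf2.span (insert e ?U)"
      unfolding gf2_span_insert_subspace[OF gf2.subspace_span] using f by blast
    moreover have "insert e ?U \<subseteq> gf2.span (insert e ?U)" by (rule gf2.span_superset)
    ultimately have "F \<union> D \<subseteq> gf2.span (insert e ?U)" using U def(1) by blast
    then have "?V \<subseteq> gf2.span (insert e ?U)" unfolding V by (intro gf2.span_minimal) auto
    then have VU: "?V \<subseteq> ?U \<union> (+) e ` ?U"
      unfolding gf2_span_insert_subspace[OF gf2.subspace_span] .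
    have fU: "finite ?U" unfolding gf2_span_insert_subspace[OF sF] using fF by simp
    have cU: "card ?U = 2 * card F" using def DF by (intro card_span_insert[OF sF fF]) auto
    have "card ?V \<le> card (?U \<union> (+) e ` ?U)" using VU fU by (intro card_mono) auto
    also have "\<dots> \<le> card ?U + card ((+) e ` ?U)" by (rule card_Un_le)
    also have "\<dots> \<le> card ?U + card ?U" using card_image_le[OF fU] by simp
    finally have F16: "16 \<le> card F" using cU card_space by linarith
    obtain F' where "gf2.subspace F'" "F' \<subset> ?V" "inseparable G F'" "card F < card F'"
      using larger_inseparable[OF sF FV iF F16 sG sFs(1) DG \<open>card D = 3\<close> s_def[symmetric] Dsub]
      by blast
    then show ?thesis using Fmax[of F'] unfolding FF_def by auto
  qed
qed

theorem (in critical_colouring) circuit: "gf2_circuit G \<or> gf2_circuit R"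
proof -
  interpret sw: critical_colouring n R G by (rule swap)
  show ?thesis
    using hyperplanes_separable circuit_if_hyperplanes_separable sw.circuit_if_hyperplanes_separable
    by blast
qed

section \<open>Vector matroids\<close>

text \<open>No ambient dimension is recorded, so restrictions and deletions of different projective
  geometries become comparable.\<close>

definition vector_matroid :: "gf2_vec set \<Rightarrow> gf2_vec matroid" where
  "vector_matroid T = \<lparr>ground = T, indeps = {I. I \<subseteq> T \<and> gf2.independent I}\<rparr>"

lemma vector_matroid_simps [simp]:
  "ground (vector_matroid T) = T"
  "I \<in> indeps (vector_matroid T) \<longleftrightarrow> I \<subseteq> T \<and> gf2.independent I"
  by (auto simp: vector_matroid_def)

lemma restriction_PG2: "T \<subseteq> gf2_space k - {0} \<Longrightarrow> restriction (PG2 k) T = vector_matroid T"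
  by (auto simp: restriction_def vector_matroid_def PG2_def)

lemma deletion_PG2: "deletion (PG2 k) T = vector_matroid (gf2_space k - {0} - T)"
  by (auto simp: deletion_def restriction_def vector_matroid_def PG2_def)

section \<open>Independence, rank and direct sums for sets of vectors\<close>

lemma gf2_independent_iff_sum:
  "gf2.independent X \<longleftrightarrow> (\<forall>E\<subseteq>X. finite E \<longrightarrow> \<Sum>E = 0 \<longrightarrow> E = {})"
proof
  assume "gf2.independent X"
  then show "\<forall>E\<subseteq>X. finite E \<longrightarrow> \<Sum>E = 0 \<longrightarrow> E = {}"
    using gf2_sum_unique[of X _ "{}"] by simp
next
  assume *: "\<forall>E\<subseteq>X. finite E \<longrightarrow> \<Sum>E = 0 \<longrightarrow> E = {}"
  show "gf2.independent X"
  proof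
    assume "gf2.dependent X"
    then obtain a where a: "a \<in> X" "a \<in> gf2.span (X - {a})" unfolding gf2.dependent_def by blast
    obtain A where A: "A \<subseteq> X - {a}" "finite A" "a = \<Sum>A"
      using gf2_span_sum[OF a(2)] by blast
    have "\<Sum>(insert a A) = a + \<Sum>A" using A(1,2) by (intro sum.insert) auto
    then have "\<Sum>(insert a A) = 0" using A(3) by simp
    then show False using *[rule_format, of "insert a A"] A a(1) by blast
  qed
qed

lemma card_span_independent:
  "finite X \<Longrightarrow> gf2.independent X \<Longrightarrow> finite (gf2.span X) \<and> card (gf2.span X) = 2 ^ card X"
  by (rule card_span_sum_free) (auto simp: gf2_independent_iff_sum dest: finite_subset)

lemma card_independent_le:
  assumes "gf2.subspace A" "finite A" "card A = 2 ^ k" "I \<subseteq> A" "gf2.independent I"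
  shows "card I \<le> k"
proof -
  have "gf2.span I \<subseteq> A" using assms by (intro gf2.span_minimal)
  then have "card (gf2.span I) \<le> card A" using assms(2) by (rule card_mono[rotated])
  then have "(2::nat) ^ card I \<le> 2 ^ k"
    using card_span_independent[OF finite_subset[OF assms(4,2)] assms(5)] assms(3) by simp
  then show ?thesis by simp
qed

lemma matroid_vector_matroid: "finite T \<Longrightarrow> matroid (vector_matroid T)"
  unfolding matroid_def
proof (intro conjI ballI allI impI)
  assume fin: "finite T"
  fix I J assume IJ: "I \<in> indeps (vector_matroid T)" "J \<in> indeps (vector_matroid T)" "card I < card J"
  have fI: "finite I" using IJ(1) fin finite_subset by auto
  have "\<not> J \<subseteq> gf2.span I"
    using gf2.independent_span_bound[OF fI, of J] IJ by auto
  then obtain x where x: "x \<in> J" "x \<notin> gf2.span I" by blast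
  then have "x \<notin> I" using gf2.span_superset by blast
  then show "\<exists>x\<in>J - I. insert x I \<in> indeps (vector_matroid T)"
    using x IJ by (intro bexI[of _ x]) (auto simp: gf2.independent_insert)
qed (auto dest: gf2.independent_mono simp: gf2.independent_empty)

lemma simple_vector_matroid: "0 \<notin> T \<Longrightarrow> finite T \<Longrightarrow> simple_matroid (vector_matroid T)"
  unfolding simple_matroid_def
proof (intro allI impI, rule ccontr)
  fix C assume T: "0 \<notin> T" "finite T" and C: "matroid_circuit (vector_matroid T) C" "\<not> 3 \<le> card C"
  have CT: "C \<subseteq> T" "gf2.dependent C" using C(1) by (auto simp: matroid_circuit_def)
  have fC: "finite C" using CT(1) T(2) finite_subset by blast
  have "E = {}" if E: "E \<subseteq> C" "\<Sum>E = 0" for E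
  proof (rule ccontr)
    assume "E \<noteq> {}"
    have "card E \<le> card C" using card_mono[OF fC E(1)] .
    moreover have "card E \<noteq> 0"
      using \<open>E \<noteq> {}\<close> finite_subset[OF E(1) fC] by simp
    ultimately consider "card E = 1" | "card E = 2" using C(2) by linarith
    then show False
    proof cases
      case 1
      then obtain a where "E = {a}" by (auto simp: card_1_singleton_iff)
      then show False using E CT T by auto
    next
      case 2
      then obtain a b where "E = {a, b}" "a \<noteq> b" by (auto simp: card_2_iff)
      then show False using E(2) by (simp add: gf2_add_eq_0_iff)
    qed
  qed
  then have "gf2.independent C" unfolding gf2_independent_iff_sum by blast
  then show False using CT(2) by blast
qed

lemma binary_vector_matroid: "T \<subseteq> gf2_space k \<Longrightarrow> binary_matroid (vector_matroid T)"
  unfolding binary_matroid_def by (intro exI[of _ k] exI[of _ "\<lambda>x. x"]) auto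

lemma matroid_rank_le:
  assumes "finite (ground M)" "{} \<in> indeps M" "\<And>I. I \<in> indeps M \<Longrightarrow> I \<subseteq> ground M \<Longrightarrow> card I \<le> k"
  shows "matroid_rank M \<le> k"
proof -
  have "finite {I \<in> indeps M. I \<subseteq> ground M}"
    using assms(1) by (rule finite_subset[rotated, OF iffD2[OF finite_Pow_iff]]) auto
  then show ?thesis
    unfolding matroid_rank_def matroid_rank_of_def using assms(2,3) by (subst Max_le_iff) auto
qed

lemma matroid_rank_vector_matroid_le:
  assumes "gf2.subspace A" "finite A" "card A = 2 ^ k" "T \<subseteq> A"
  shows "matroid_rank (vector_matroid T) \<le> k"
proof (rule matroid_rank_le)
  fix I assume "I \<in> indeps (vector_matroid T)"
  then show "card I \<le> k" using assms by (intro card_independent_le[OF assms(1-3)]) auto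
qed (use assms finite_subset in \<open>auto simp: gf2.independent_empty\<close>)

lemma matroid_rank_iso:
  assumes "matroid_iso M N"
  shows "matroid_rank M = matroid_rank N"
proof -
  obtain f where f: "bij_betw f (ground M) (ground N)"
    "\<And>X. X \<subseteq> ground M \<Longrightarrow> X \<in> indeps M \<longleftrightarrow> f ` X \<in> indeps N"
    using assms unfolding matroid_iso_def by blast
  have inj: "inj_on f (ground M)" and im: "f ` ground M = ground N"
    using f(1) by (auto simp: bij_betw_def)
  have "card ` {I \<in> indeps M. I \<subseteq> ground M} = card ` {I \<in> indeps N. I \<subseteq> ground N}"
  proof (intro equalityI subsetI)
    fix c assume "c \<in> card ` {I \<in> indeps M. I \<subseteq> ground M}"
    then obtain I where I: "I \<in> indeps M" "I \<subseteq> ground M" "c = card I" by blast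
    have "c = card (f ` I)" using card_image[OF inj_on_subset[OF inj I(2)]] I(3) by simp
    moreover have "f ` I \<in> indeps N" "f ` I \<subseteq> ground N" using f(2)[OF I(2)] I im by blast+
    ultimately show "c \<in> card ` {I \<in> indeps N. I \<subseteq> ground N}" by blast
  next
    fix c assume "c \<in> card ` {I \<in> indeps N. I \<subseteq> ground N}"
    then obtain J where J: "J \<in> indeps N" "J \<subseteq> ground N" "c = card J" by blast
    obtain I where I: "I \<subseteq> ground M" "J = f ` I" using J(2) im by (metis subset_imageE)
    have "c = card I" using card_image[OF inj_on_subset[OF inj I(1)]] I(2) J(3) by simp
    moreover have "I \<in> indeps M" using f(2)[OF I(1)] J(1) I(2) by simp
    ultimately show "c \<in> card ` {I \<in> indeps M. I \<subseteq> ground M}" using I(1) by blast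
  qed
  then show ?thesis unfolding matroid_rank_def matroid_rank_of_def by simp
qed

text \<open>Instead of \<open>matroid\<close>, only the inclusion of independent sets in the ground
  set is assumed; this is what the induction in \<open>gen_comatroid_representation\<close> carries
  along.\<close>

lemma matroid_iso_sum:
  assumes iso: "matroid_iso M M'" "matroid_iso N N'"
    and wf: "\<And>I. I \<in> indeps M \<Longrightarrow> I \<subseteq> ground M" "\<And>I. I \<in> indeps N \<Longrightarrow> I \<subseteq> ground N"
      "\<And>I. I \<in> indeps M' \<Longrightarrow> I \<subseteq> ground M'" "\<And>I. I \<in> indeps N' \<Longrightarrow> I \<subseteq> ground N'"
    and disj: "ground M \<inter> ground N = {}" "ground M' \<inter> ground N' = {}"
  shows "matroid_iso (matroid_sum M N) (matroid_sum M' N')"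
proof -
  obtain f where f: "bij_betw f (ground M) (ground M')"
    "\<And>X. X \<subseteq> ground M \<Longrightarrow> X \<in> indeps M \<longleftrightarrow> f ` X \<in> indeps M'"
    using iso(1) unfolding matroid_iso_def by blast
  obtain g where g: "bij_betw g (ground N) (ground N')"
    "\<And>X. X \<subseteq> ground N \<Longrightarrow> X \<in> indeps N \<longleftrightarrow> g ` X \<in> indeps N'"
    using iso(2) unfolding matroid_iso_def by blast
  have sum_iff: "X \<in> indeps (matroid_sum A B) \<longleftrightarrow> X \<inter> ground A \<in> indeps A \<and> X \<inter> ground B \<in> indeps B"
    if "\<And>I. I \<in> indeps A \<Longrightarrow> I \<subseteq> ground A" "\<And>I. I \<in> indeps B \<Longrightarrow> I \<subseteq> ground B"
      "ground A \<inter> ground B = {}" "X \<subseteq> ground A \<union> ground B" for X and A B :: "'x matroid"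
  proof
    assume "X \<in> indeps (matroid_sum A B)"
    then obtain I J where "X = I \<union> J" "I \<in> indeps A" "J \<in> indeps B"
      by (auto simp: matroid_sum_def)
    moreover from this have "X \<inter> ground A = I" "X \<inter> ground B = J" using that(1-3) by blast+
    ultimately show "X \<inter> ground A \<in> indeps A \<and> X \<inter> ground B \<in> indeps B"
      by simp
  next
    assume "X \<inter> ground A \<in> indeps A \<and> X \<inter> ground B \<in> indeps B"
    moreover have "X = (X \<inter> ground A) \<union> (X \<inter> ground B)" using that(4) by blast
    ultimately show "X \<in> indeps (matroid_sum A B)" by (auto simp: matroid_sum_def)
  qed
  let ?h = "\<lambda>x. if x \<in> ground M then f x else g x"
  have "bij_betw ?h (ground M \<union> ground N) (ground M' \<union> ground N')"
  proof (rule bij_betw_combine)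
    show "bij_betw ?h (ground M) (ground M')"
      using f(1) by (rule bij_betw_cong[THEN iffD1, rotated]) auto
    show "bij_betw ?h (ground N) (ground N')"
      using g(1) by (rule bij_betw_cong[THEN iffD1, rotated]) (use disj(1) in auto)
  qed (rule disj(2))
  moreover have "X \<in> indeps (matroid_sum M N) \<longleftrightarrow> ?h ` X \<in> indeps (matroid_sum M' N')"
    if X: "X \<subseteq> ground M \<union> ground N" for X
  proof -
    have fM: "f ` ground M = ground M'" and gN: "g ` ground N = ground N'"
      using f(1) g(1) by (auto simp: bij_betw_def)
    have hX: "?h ` X = f ` (X \<inter> ground M) \<union> g ` (X \<inter> ground N)"
      using X disj(1) by auto
    have a: "?h ` X \<inter> ground M' = f ` (X \<inter> ground M)" and b: "?h ` X \<inter> ground N' = g ` (X \<inter> ground N)"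
      unfolding hX using fM gN disj(2) by blast+
    have "?h ` X \<subseteq> ground M' \<union> ground N'" unfolding hX using fM gN by blast
    then have "?h ` X \<in> indeps (matroid_sum M' N') \<longleftrightarrow>
        f ` (X \<inter> ground M) \<in> indeps M' \<and> g ` (X \<inter> ground N) \<in> indeps N'"
      using sum_iff[OF wf(3,4) disj(2)] a b by simp
    also have "\<dots> \<longleftrightarrow> X \<inter> ground M \<in> indeps M \<and> X \<inter> ground N \<in> indeps N"
      using f(2)[of "X \<inter> ground M"] g(2)[of "X \<inter> ground N"] by simp
    also have "\<dots> \<longleftrightarrow> X \<in> indeps (matroid_sum M N)"
      using sum_iff[OF wf(1,2) disj(1) X] by simp
    finally show ?thesis by simp
  qed
  ultimately show ?thesis unfolding matroid_iso_def by (intro exI[of _ ?h]) (simp add: matroid_sum_def)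
qed

text \<open>In a zero sum over \<open>I \<union> J\<close>, the part from \<open>I\<close> and the
  rest have equal sums, which lie in both spans and so vanish; independence of \<open>I\<close> and
  \<open>J\<close> then makes both parts empty.\<close>

lemma vector_matroid_sum:
  assumes "gf2.span S \<inter> gf2.span T = {0}" "0 \<notin> S" "0 \<notin> T"
  shows "matroid_sum (vector_matroid S) (vector_matroid T) = vector_matroid (S \<union> T)" "S \<inter> T = {}"
proof -
  have "x = 0" if "x \<in> S \<inter> T" for x
    using that gf2.span_base[of x S] gf2.span_base[of x T] assms(1) by blast
  then show "S \<inter> T = {}" using assms(2) by blast
  have ind: "gf2.independent (I \<union> J)" if I: "I \<subseteq> S" "gf2.independent I" and J: "J \<subseteq> T" "gf2.independent J" for I J
    unfolding gf2_independent_iff_sum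
  proof (intro allI impI)
    fix E assume E: "E \<subseteq> I \<union> J" "finite E" "\<Sum>E = 0"
    have "E - E \<inter> I \<subseteq> J" using E(1) by blast
    have "\<Sum>(E \<inter> I) = \<Sum>(E - E \<inter> I)"
      using gf2_sum_Diff[OF E(2), of "E \<inter> I"] E(3) by simp
    moreover have "\<Sum>(E \<inter> I) \<in> gf2.span S"
      using I(1) by (intro gf2.span_sum gf2.span_base) auto
    moreover have "\<Sum>(E - E \<inter> I) \<in> gf2.span T"
      using E(1) J(1) by (intro gf2.span_sum gf2.span_base) auto
    ultimately have "\<Sum>(E \<inter> I) \<in> gf2.span S \<inter> gf2.span T" by simp
    then have "\<Sum>(E \<inter> I) = 0" using assms(1) by blast
    moreover from this have "\<Sum>(E - E \<inter> I) = 0"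
      using \<open>\<Sum>(E \<inter> I) = \<Sum>(E - E \<inter> I)\<close> by simp
    ultimately have "E \<inter> I = {}" "E - E \<inter> I = {}"
      using I(2)[unfolded gf2_independent_iff_sum, rule_format, of "E \<inter> I"]
        J(2)[unfolded gf2_independent_iff_sum, rule_format, of "E - E \<inter> I"] \<open>E - E \<inter> I \<subseteq> J\<close> E(2) by simp_all
    then show "E = {}" by blast
  qed
  have "{I \<union> J |I J. I \<in> indeps (vector_matroid S) \<and> J \<in> indeps (vector_matroid T)} = {I. I \<subseteq> S \<union> T \<and> gf2.independent I}"
  proof (intro equalityI subsetI)
    fix X assume "X \<in> {I. I \<subseteq> S \<union> T \<and> gf2.independent I}"
    then have X: "X \<subseteq> S \<union> T" "gf2.independent X" by blast+
    have "X = (X \<inter> S) \<union> (X \<inter> T)" using X(1) by blast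
    moreover have "X \<inter> S \<in> indeps (vector_matroid S)" "X \<inter> T \<in> indeps (vector_matroid T)"
      using gf2.independent_mono[OF X(2), of "X \<inter> S"] gf2.independent_mono[OF X(2), of "X \<inter> T"]
      by simp_all
    ultimately show "X \<in> {I \<union> J |I J. I \<in> indeps (vector_matroid S) \<and> J \<in> indeps (vector_matroid T)}"
      by blast
  next
    fix X assume "X \<in> {I \<union> J |I J. I \<in> indeps (vector_matroid S) \<and> J \<in> indeps (vector_matroid T)}"
    then obtain I J where IJ: "X = I \<union> J" "I \<in> indeps (vector_matroid S)" "J \<in> indeps (vector_matroid T)"
      by blast
    then have "I \<subseteq> S" "gf2.independent I" "J \<subseteq> T" "gf2.independent J" by simp_all
    then show "X \<in> {I. I \<subseteq> S \<union> T \<and> gf2.independent I}"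
      using ind[of I J] IJ(1) by blast
  qed
  then show "matroid_sum (vector_matroid S) (vector_matroid T) = vector_matroid (S \<union> T)"
    unfolding matroid_sum_def by (simp add: vector_matroid_def)
qed

lemma vector_matroid_iso_image:
  assumes "inj_on f S" "\<And>X. X \<subseteq> S \<Longrightarrow> gf2.independent X \<longleftrightarrow> gf2.independent (f ` X)"
  shows "matroid_iso (vector_matroid S) (vector_matroid (f ` S))"
  unfolding matroid_iso_def using assms by (intro exI[of _ f]) (auto simp: bij_betw_def)

lemma vector_matroid_isoE:
  assumes "matroid_iso (vector_matroid S) (vector_matroid T)"
  obtains f where "bij_betw f S T" "\<And>X. X \<subseteq> S \<Longrightarrow> gf2.independent X \<longleftrightarrow> gf2.independent (f ` X)"
proof -
  obtain f where f: "bij_betw f S T"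
    "\<And>X. X \<subseteq> S \<Longrightarrow> X \<in> indeps (vector_matroid S) \<longleftrightarrow> f ` X \<in> indeps (vector_matroid T)"
    using assms unfolding matroid_iso_def by auto
  have "gf2.independent X \<longleftrightarrow> gf2.independent (f ` X)" if X: "X \<subseteq> S" for X
  proof -
    have "f ` X \<subseteq> T" using X f(1) by (auto simp: bij_betw_def)
    then show ?thesis using f(2)[OF X] X by simp
  qed
  then show thesis using that f(1) by blast
qed

section \<open>Comatroids are separable on every subspace\<close>

text \<open>Every subspace contains 0, so its colour is immaterial. This lets the plain complement
  \<open>- T\<close> stand for the other colour.\<close>

lemma inseparable_cong:
  assumes "S \<inter> W - {0} = S' \<inter> W - {0}"
  shows "inseparable S W \<longleftrightarrow> inseparable S' W"
proof -
  have "S \<inter> W \<subseteq> A \<union> B \<longleftrightarrow> S' \<inter> W \<subseteq> A \<union> B" if "gf2.subspace A" for A B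
    using assms gf2.subspace_0[OF that] by blast
  then show ?thesis unfolding inseparable_def by blast
qed

text \<open>A separating pair is cut down to \<open>V\<close>, where \<open>g\<close> is injective,
  and pushed forward to a pair for \<open>W\<close>.\<close>

lemma inseparable_transfer:
  assumes g: "Vector_Spaces.linear gf2_scale gf2_scale g" "bij_betw g V V" and V: "gf2.subspace V"
    and W: "W \<subseteq> V" "inseparable S' W" and S: "\<And>x. x \<in> V \<Longrightarrow> x \<in> S \<longleftrightarrow> g x \<in> S'"
  shows "inseparable S {x \<in> V. g x \<in> W}"
  unfolding inseparable_def
proof (intro allI impI)
  let ?W = "{x \<in> V. g x \<in> W}"
  fix A B assume A: "gf2.subspace A" "gf2.subspace B" "A \<inter> B = {0}" "S \<inter> ?W \<subseteq> A \<union> B"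
  have inj: "inj_on g V" and im: "g ` V = V" using g(2) by (auto simp: bij_betw_def)
  have sub: "gf2.subspace (g ` (X \<inter> V))" if "gf2.subspace X" for X
    using gf2.linear_subspace_image[OF g(1) gf2.subspace_inter[OF that V]] .
  have "g ` (A \<inter> V) \<inter> g ` (B \<inter> V) = g ` ((A \<inter> V) \<inter> (B \<inter> V))"
    by (rule inj_on_image_Int[OF inj, symmetric]) auto
  also have "(A \<inter> V) \<inter> (B \<inter> V) = {0}" using A(3) gf2.subspace_0[OF V] by blast
  also have "g ` {0} = {0}" using gf2.linear_0[OF g(1)] by simp
  finally have int: "g ` (A \<inter> V) \<inter> g ` (B \<inter> V) = {0}" .
  have "S' \<inter> W \<subseteq> g ` (A \<inter> V) \<union> g ` (B \<inter> V)"
  proof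
    fix y assume y: "y \<in> S' \<inter> W"
    then obtain x where x: "x \<in> V" "y = g x" using W(1) im by blast
    then have "x \<in> S \<inter> ?W" using S y by blast
    then have "x \<in> A \<union> B" using A(4) by blast
    then show "y \<in> g ` (A \<inter> V) \<union> g ` (B \<inter> V)" using x by blast
  qed
  then have or: "W \<subseteq> g ` (A \<inter> V) \<or> W \<subseteq> g ` (B \<inter> V)"
    by (rule inseparableD[OF W(2) sub[OF A(1)] sub[OF A(2)] int])
  have pull: "?W \<subseteq> X" if "W \<subseteq> g ` (X \<inter> V)" for X
  proof
    fix x assume x: "x \<in> ?W"
    then obtain a where "a \<in> X \<inter> V" "g x = g a"
      using \<open>W \<subseteq> g ` (X \<inter> V)\<close> by blast
    then show "x \<in> X" using inj_onD[OF inj, of x a] x by blast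
  qed
  show "?W \<subseteq> A \<or> ?W \<subseteq> B" using or pull by blast
qed

text \<open>Using \<open>- T\<close> makes the property independent of an ambient dimension: where
  \<open>T\<close> is inseparable, \<open>W\<close> lies in the span of \<open>T\<close> anyway.
  Infinite \<open>W\<close> are excluded, as their \<open>card\<close> is 0.\<close>

definition hereditarily_separable :: "gf2_vec set \<Rightarrow> bool" where
  "hereditarily_separable T \<longleftrightarrow>
     (\<forall>W. gf2.subspace W \<longrightarrow> 4 \<le> card W \<longrightarrow> \<not> inseparable T W \<or> \<not> inseparable (- T) W)"

lemma gf2_space_mono: "k \<le> l \<Longrightarrow> gf2_space k \<subseteq> gf2_space l"
  by (auto simp: gf2_space_def)

text \<open>By \<open>PG2_iso_extends\<close> the isomorphism extends to a linear bijection of a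
  common ambient space. A bad \<open>W\<close> for \<open>T'\<close> lies in that space, being
  spanned by points of \<open>T'\<close>, and its preimage is bad for \<open>T\<close>.\<close>

lemma hereditarily_separable_iso:
  assumes T: "T \<subseteq> gf2_space k - {0}" "T' \<subseteq> gf2_space k' - {0}"
    and iso: "matroid_iso (vector_matroid T) (vector_matroid T')" and hs: "hereditarily_separable T"
  shows "hereditarily_separable T'"
  unfolding hereditarily_separable_def
proof (intro allI impI, rule ccontr)
  let ?V = "gf2_space (max k k')"
  fix W assume W: "gf2.subspace W" "4 \<le> card W" "\<not> (\<not> inseparable T' W \<or> \<not> inseparable (- T') W)"
  have TV: "T \<subseteq> ?V - {0}" "T' \<subseteq> ?V - {0}"
    using T gf2_space_mono[of k "max k k'"] gf2_space_mono[of k' "max k k'"] by auto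
  obtain f where f: "bij_betw f T T'" "\<And>X. X \<subseteq> T \<Longrightarrow> gf2.independent X \<longleftrightarrow> gf2.independent (f ` X)"
    using vector_matroid_isoE[OF iso] by blast
  obtain g where g: "Vector_Spaces.linear gf2_scale gf2_scale g" "bij_betw g ?V ?V" "\<forall>t\<in>T. g t = f t"
    using PG2_iso_extends[OF TV f] by blast
  have inj: "inj_on g ?V" and im: "g ` ?V = ?V" using g(2) by (auto simp: bij_betw_def)
  have gT: "g ` T = T'" using g(3) f(1) by (force simp: bij_betw_def)
  have mem: "x \<in> T \<longleftrightarrow> g x \<in> T'" if "x \<in> ?V" for x
    using inj_on_image_mem_iff[OF inj that, of T] TV(1) gT by blast
  have "W \<subseteq> gf2.span (T' \<inter> W)" using W(3) inseparable_subset_span by blast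
  also have "\<dots> \<subseteq> ?V" using TV(2) by (intro gf2.span_minimal subspace_gf2_space) auto
  finally have WV: "W \<subseteq> ?V" .
  let ?W = "{x \<in> ?V. g x \<in> W}"
  have iW: "inseparable T' W" "inseparable (- T') W" using W(3) by blast+
  have "inseparable T ?W"
    by (rule inseparable_transfer[OF g(1,2) subspace_gf2_space WV iW(1) mem])
  moreover have "inseparable (- T) ?W"
    by (rule inseparable_transfer[OF g(1,2) subspace_gf2_space WV iW(2)]) (simp add: mem)
  moreover have "gf2.subspace ?W"
  proof (rule gf2_subspaceI)
    show "0 \<in> ?W"
      using gf2.linear_0[OF g(1)] gf2.subspace_0[OF W(1)] gf2.subspace_0[OF subspace_gf2_space] by simp
    fix x y assume "x \<in> ?W" "y \<in> ?W"
    then show "x + y \<in> ?W"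
      using gf2.linear_add[OF g(1)] gf2.subspace_add[OF W(1)] gf2.subspace_add[OF subspace_gf2_space]
      by simp
  qed
  moreover have "card ?W = card W"
  proof (rule bij_betw_same_card)
    show "bij_betw g ?W W"
      unfolding bij_betw_def
    proof
      show "inj_on g ?W" using inj by (rule inj_on_subset) auto
      show "g ` ?W = W"
      proof (intro equalityI subsetI)
        fix w assume w: "w \<in> W"
        then obtain v where "v \<in> ?V" "w = g v" using WV im by (metis imageE subsetD)
        then show "w \<in> g ` ?W" using w by blast
      qed auto
    qed
  qed
  ultimately show False using hs W(2) unfolding hereditarily_separable_def by metis
qed

text \<open>The two spans separate the union, so a bad \<open>W\<close> lies in one of them; there
  the other set has no points.\<close>

lemma hereditarily_separable_Un:
  assumes T: "gf2.span S \<inter> gf2.span T = {0}" "0 \<notin> S" "0 \<notin> T"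
    and hs: "hereditarily_separable S" "hereditarily_separable T"
  shows "hereditarily_separable (S \<union> T)"
  unfolding hereditarily_separable_def
proof (intro allI impI, rule ccontr)
  fix W assume W: "gf2.subspace W" "4 \<le> card W" "\<not> (\<not> inseparable (S \<union> T) W \<or> \<not> inseparable (- (S \<union> T)) W)"
  have sp: "S \<subseteq> gf2.span S" "T \<subseteq> gf2.span T" by (rule gf2.span_superset)+
  have no: "x = 0" if "x \<in> gf2.span S" "x \<in> gf2.span T" for x
    using IntI[OF that] unfolding T(1) by simp
  have "W \<subseteq> gf2.span S \<or> W \<subseteq> gf2.span T"
  proof (rule inseparableD[OF _ gf2.subspace_span gf2.subspace_span T(1)])
    show "inseparable (S \<union> T) W" using W(3) by blast
    show "(S \<union> T) \<inter> W \<subseteq> gf2.span S \<union> gf2.span T" using sp by blast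
  qed
  then show False
  proof
    assume "W \<subseteq> gf2.span S"
    then have "T \<inter> W = {}" using sp(2) T(3) no by blast
    then have "inseparable S W" "inseparable (- S) W"
      using W(3) inseparable_cong[of "S \<union> T" W S] inseparable_cong[of "- (S \<union> T)" W "- S"]
      by (auto simp: Int_Un_distrib2 Compl_Un)
    then show False using hs(1) W(1,2) unfolding hereditarily_separable_def by blast
  next
    assume "W \<subseteq> gf2.span T"
    then have "S \<inter> W = {}" using sp(1) T(2) no by blast
    then have "inseparable T W" "inseparable (- T) W"
      using W(3) inseparable_cong[of "S \<union> T" W T] inseparable_cong[of "- (S \<union> T)" W "- T"]
      by blast+
    then show False using hs(2) W(1,2) unfolding hereditarily_separable_def by blast
  qed
qed

text \<open>The property is symmetric in \<open>T\<close> and \<open>- T\<close>. A bad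
  \<open>W\<close> is spanned by points of the complement, so it lies in \<open>gf2_space t\<close>,
  where the complement and \<open>- T\<close> differ only in 0.\<close>

lemma hereditarily_separable_complement:
  assumes hs: "hereditarily_separable T"
  shows "hereditarily_separable (gf2_space t - {0} - T)" (is "hereditarily_separable ?R")
  unfolding hereditarily_separable_def
proof (intro allI impI, rule ccontr)
  fix W assume W: "gf2.subspace W" "4 \<le> card W" "\<not> (\<not> inseparable ?R W \<or> \<not> inseparable (- ?R) W)"
  have "W \<subseteq> gf2.span (?R \<inter> W)" using W(3) inseparable_subset_span by blast
  also have "\<dots> \<subseteq> gf2_space t" by (intro gf2.span_minimal subspace_gf2_space) auto
  finally have "W \<subseteq> gf2_space t" .
  then have "?R \<inter> W - {0} = - T \<inter> W - {0}" "- ?R \<inter> W - {0} = T \<inter> W - {0}"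
    by blast+
  then have "inseparable (- T) W" "inseparable T W"
    using W(3) inseparable_cong[of ?R W "- T"] inseparable_cong[of "- ?R" W T] by metis+
  then show False using hs W(1,2) unfolding hereditarily_separable_def by blast
qed

text \<open>This moves the second summand of a direct sum to coordinates that the first one, inside
  \<open>gf2_space k\<close>, does not use.\<close>

definition gf2_shift :: "nat \<Rightarrow> gf2_vec \<Rightarrow> gf2_vec" where
  "gf2_shift k v = (\<lambda>i. if i < k then 0 else v (i - k))"

lemma linear_gf2_shift: "Vector_Spaces.linear gf2_scale gf2_scale (gf2_shift k)"
  by unfold_locales (auto simp: gf2_shift_def gf2_scale_def fun_eq_iff)

lemma inj_gf2_shift: "inj (gf2_shift k)"
proof (rule injI)
  fix u v assume "gf2_shift k u = gf2_shift k v"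
  then have "gf2_shift k u (i + k) = gf2_shift k v (i + k)" for i by simp
  then show "u = v" by (simp add: gf2_shift_def fun_eq_iff)
qed

text \<open>Induction on the construction: isomorphism, direct sum and complement each preserve
  hereditary separability of a representing set. The first conjunct is needed for isomorphisms of
  direct sums.\<close>

lemma gen_comatroid_representation:
  assumes "gen_comatroid M"
  shows "(\<forall>I\<in>indeps M. I \<subseteq> ground M) \<and>
    (\<exists>k T. T \<subseteq> gf2_space k - {0} \<and> matroid_iso M (vector_matroid T) \<and> hereditarily_separable T)"
  using assms
proof induction
  case empty
  have "U00 = vector_matroid {}" by (auto simp: U00_def vector_matroid_def gf2.independent_empty)
  then have "matroid_iso (U00 :: gf2_vec matroid) (vector_matroid {})" 
    using vector_matroid_iso_image[of "\<lambda>x. x" "{}"] by simp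
  moreover have "hereditarily_separable {}"
    unfolding hereditarily_separable_def
  proof (intro allI impI, rule ccontr)
    fix W :: "gf2_vec set" assume W: "4 \<le> card W" "\<not> (\<not> inseparable {} W \<or> \<not> inseparable (- {}) W)"
    then have "W \<subseteq> {0}" using inseparable_subset_span[of "{}" W] by simp
    then have "card W \<le> card {0 :: gf2_vec}" by (intro card_mono) auto
    then show False using W(1) by simp
  qed
  ultimately show ?case by (auto simp: U00_def)
next
  case (iso M N)
  then have "\<forall>I\<in>indeps N. I \<subseteq> ground N" by (auto simp: matroid_def)
  moreover obtain k T where T: "T \<subseteq> gf2_space k - {0}" "matroid_iso M (vector_matroid T)" "hereditarily_separable T"
    using iso.IH by blast
  moreover have "matroid_iso N (vector_matroid T)"
    by (rule matroid_iso_trans[OF matroid_iso_sym[OF iso.hyps(2)] T(2)])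
  ultimately show ?case by blast
next
  case (sum M N)
  obtain k S where S: "S \<subseteq> gf2_space k - {0}" "matroid_iso M (vector_matroid S)" "hereditarily_separable S"
    using sum.IH(1) by blast
  obtain l T where T: "T \<subseteq> gf2_space l - {0}" "matroid_iso N (vector_matroid T)" "hereditarily_separable T"
    using sum.IH(2) by blast
  let ?T = "gf2_shift k ` T"
  have z: "gf2_shift k 0 = 0" by (rule gf2.linear_0[OF linear_gf2_shift])
  have T': "?T \<subseteq> gf2_space (k + l) - {0}"
  proof
    fix y assume "y \<in> ?T"
    then obtain x where x: "x \<in> T" "y = gf2_shift k x" by blast
    have "gf2_shift k x \<noteq> gf2_shift k 0" using injD[OF inj_gf2_shift, of k x 0] x(1) T(1) by auto
    moreover have "gf2_shift k x \<in> gf2_space (k + l)"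
      using x(1) T(1) by (auto simp: gf2_shift_def gf2_space_def)
    ultimately show "y \<in> gf2_space (k + l) - {0}" using x(2) z by simp
  qed
  have iso: "matroid_iso (vector_matroid T) (vector_matroid ?T)"
  proof (rule vector_matroid_iso_image)
    show "inj_on (gf2_shift k) T" using inj_gf2_shift by (rule inj_on_subset) auto
    show "gf2.independent X \<longleftrightarrow> gf2.independent (gf2_shift k ` X)" if "X \<subseteq> T" for X
      using gf2_independent_image_iff[OF linear_gf2_shift inj_gf2_shift gf2.subspace_UNIV] by simp
  qed
  have hT: "hereditarily_separable ?T" by (rule hereditarily_separable_iso[OF T(1) T' iso T(3)])
  have "gf2.span S \<subseteq> gf2_space k"
    using S(1) by (intro gf2.span_minimal subspace_gf2_space) auto
  moreover have "gf2.span ?T \<subseteq> {v. \<forall>i<k. v i = 0}"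
  proof (rule gf2.span_minimal)
    show "?T \<subseteq> {v. \<forall>i<k. v i = 0}" by (auto simp: gf2_shift_def)
    show "gf2.subspace {v. \<forall>i<k. v i = 0}" by (rule gf2_subspaceI) auto
  qed
  moreover have "v = 0" if "v \<in> gf2_space k" "v \<in> {v. \<forall>i<k. v i = 0}" for v
  proof
    fix i show "v i = 0 i" using that by (cases "i < k") (auto simp: gf2_space_def)
  qed
  ultimately have int: "gf2.span S \<inter> gf2.span ?T = {0}"
    using gf2.span_zero[of S] gf2.span_zero[of ?T] by blast
  have nz: "0 \<notin> S" "0 \<notin> ?T" using S(1) T' by blast+
  have "matroid_iso (matroid_sum M N) (matroid_sum (vector_matroid S) (vector_matroid ?T))"
    using sum.IH sum.hyps(3) vector_matroid_sum(2)[OF int nz]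
    by (intro matroid_iso_sum S(2) matroid_iso_trans[OF T(2) iso]) auto
  then have "matroid_iso (matroid_sum M N) (vector_matroid (S \<union> ?T))"
    using vector_matroid_sum(1)[OF int nz] by simp
  moreover have "S \<union> ?T \<subseteq> gf2_space (k + l) - {0}"
    using S(1) T' gf2_space_mono[of k "k + l"] by auto
  moreover have "hereditarily_separable (S \<union> ?T)"
    by (rule hereditarily_separable_Un[OF int nz S(3) hT])
  moreover have "\<forall>I\<in>indeps (matroid_sum M N). I \<subseteq> ground (matroid_sum M N)"
    using sum.IH by (auto simp: matroid_sum_def)
  ultimately show ?case by blast
next
  case (compl M t)
  obtain k T where T: "T \<subseteq> gf2_space k - {0}" "matroid_iso M (vector_matroid T)" "hereditarily_separable T"
    using compl.IH by blast
  have fT: "finite T" using T(1) finite_gf2_space finite_subset by (metis finite_Diff)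
  have "matroid_rank (vector_matroid T) \<le> t" using compl.hyps(2) matroid_rank_iso[OF T(2)] by simp
  \<comment> \<open>The representing set may lie in a space of dimension above \<open>t\<close>, so
    it is first embedded again in \<open>PG2 t\<close>.\<close>
  then obtain T0 where T0: "T0 \<subseteq> ground (PG2 t)" "matroid_iso (vector_matroid T) (restriction (PG2 t) T0)"
    using PG2_embedding_exists[of "vector_matroid T" t] matroid_vector_matroid[OF fT] simple_vector_matroid[of T] binary_vector_matroid[of T k] fT T(1)
    by blast
  have T0V: "T0 \<subseteq> gf2_space t - {0}" using T0(1) by simp
  have "matroid_iso (vector_matroid T) (vector_matroid T0)" using T0(2) restriction_PG2[OF T0V] by simp
  then have "hereditarily_separable T0" by (rule hereditarily_separable_iso[OF T(1) T0V _ T(3)])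
  then have "hereditarily_separable (gf2_space t - {0} - T0)" by (rule hereditarily_separable_complement)
  moreover have "matroid_iso (gf2_complement t M) (vector_matroid (gf2_space t - {0} - T0))"
    using gf2_complement_unique[OF T0(1) matroid_iso_trans[OF T(2) T0(2)]] unfolding deletion_PG2 .
  moreover have "\<forall>I\<in>indeps (gf2_complement t M). I \<subseteq> ground (gf2_complement t M)"
    unfolding gf2_complement_def deletion_PG2 by simp
  moreover have "gf2_space t - {0} - T0 \<subseteq> gf2_space t - {0}" by (rule Diff_subset)
  ultimately show ?case by (intro conjI exI)
qed

lemma gen_comatroid_hereditarily_separable:
  assumes "gen_comatroid (vector_matroid T)" "T \<subseteq> gf2_space k - {0}"
  shows "hereditarily_separable T"
proof -
  obtain l T' where T': "T' \<subseteq> gf2_space l - {0}" "matroid_iso (vector_matroid T) (vector_matroid T')" "hereditarily_separable T'"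
    using gen_comatroid_representation[OF assms(1)] by blast
  show ?thesis by (rule hereditarily_separable_iso[OF T'(1) assms(2) matroid_iso_sym[OF T'(2)] T'(3)])
qed

section \<open>Minimal non-comatroids\<close>

abbreviation comatroid_set :: "gf2_vec set \<Rightarrow> bool" where
  "comatroid_set T \<equiv> gen_comatroid (vector_matroid T)"

lemma comatroid_set_iso:
  "comatroid_set S \<Longrightarrow> matroid_iso (vector_matroid S) (vector_matroid T) \<Longrightarrow> finite T \<Longrightarrow> comatroid_set T"
  by (rule gen_comatroid.iso[OF _ _ matroid_vector_matroid])

lemma comatroid_set_Un:
  assumes A: "gf2.subspace A" "gf2.subspace B" "A \<inter> B = {0}" and S: "S \<subseteq> A - {0}" "T \<subseteq> B - {0}"
    and c: "comatroid_set S" "comatroid_set T"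
  shows "comatroid_set (S \<union> T)"
proof -
  have "gf2.span S \<subseteq> A" "gf2.span T \<subseteq> B"
    using A(1,2) S by (meson Diff_subset gf2.span_minimal order_trans)+
  then have int: "gf2.span S \<inter> gf2.span T = {0}"
    using A(3) gf2.span_zero[of S] gf2.span_zero[of T] by auto
  have nz: "0 \<notin> S" "0 \<notin> T" using S by auto
  have "gen_comatroid (matroid_sum (vector_matroid S) (vector_matroid T))"
    by (rule gen_comatroid.sum[OF c]) (simp add: vector_matroid_sum(2)[OF int nz])
  then show ?thesis using vector_matroid_sum(1)[OF int nz] by simp
qed

lemma comatroid_set_complement:
  assumes "comatroid_set T" "T \<subseteq> gf2_space t - {0}"
  shows "comatroid_set (gf2_space t - {0} - T)"
proof -
  have "matroid_rank (vector_matroid T) \<le> t"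
    using assms(2)
    by (intro matroid_rank_vector_matroid_le[OF subspace_gf2_space finite_gf2_space card_gf2_space]) auto
  then have "gen_comatroid (gf2_complement t (vector_matroid T))"
    by (rule gen_comatroid.compl[OF assms(1)])
  moreover have "matroid_iso (vector_matroid T) (restriction (PG2 t) T)"
    unfolding restriction_PG2[OF assms(2)] using vector_matroid_iso_image[of "\<lambda>x. x" T] by simp
  then have "matroid_iso (gf2_complement t (vector_matroid T)) (vector_matroid (gf2_space t - {0} - T))"
    using gf2_complement_unique[of T t "vector_matroid T"] assms(2) unfolding deletion_PG2 by simp
  ultimately show ?thesis
    by (rule gen_comatroid.iso) (simp add: matroid_vector_matroid finite_gf2_space)
qed

text \<open>A \<open>k\<close>-dimensional subspace is identified with \<open>GF(2)\<^sup>k\<close> by embedding all of its points.\<close>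

lemma comatroid_set_complement_subspace:
  assumes A: "gf2.subspace A" "finite A" "A \<subseteq> gf2_space n" and T: "comatroid_set T" "T \<subseteq> A - {0}"
  shows "comatroid_set (A - {0} - T)"
proof -
  obtain B where B: "B \<subseteq> A" "gf2.independent B" "A \<subseteq> gf2.span B"
    using gf2.maximal_independent_subset by blast
  have "gf2.span B = A" using B A(1) by (simp add: gf2.span_minimal subset_antisym)
  then have cA: "card A = 2 ^ card B"
    using card_span_independent[OF finite_subset[OF B(1) A(2)] B(2)] by simp
  let ?k = "card B" and ?P = "A - {0}"
  have "matroid_rank (vector_matroid ?P) \<le> ?k"
    by (rule matroid_rank_vector_matroid_le[OF A(1,2) cA]) auto
  moreover have "matroid (vector_matroid ?P)" "simple_matroid (vector_matroid ?P)" "binary_matroid (vector_matroid ?P)"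
    using A by (auto intro!: matroid_vector_matroid simple_vector_matroid binary_vector_matroid[of _ n])
  ultimately obtain T' where T': "T' \<subseteq> ground (PG2 ?k)" "matroid_iso (vector_matroid ?P) (restriction (PG2 ?k) T')"
    using PG2_embedding_exists by metis
  have T'V: "T' \<subseteq> gf2_space ?k - {0}" using T'(1) by simp
  have "matroid_iso (vector_matroid ?P) (vector_matroid T')" using T'(2) restriction_PG2[OF T'V] by simp
  then obtain f where f: "bij_betw f ?P T'"
    "\<And>X. X \<subseteq> ?P \<Longrightarrow> gf2.independent X \<longleftrightarrow> gf2.independent (f ` X)"
    using vector_matroid_isoE by blast
  have inj: "inj_on f ?P" and im: "f ` ?P = T'" using f(1) by (auto simp: bij_betw_def)
  \<comment> \<open>The image has as many points as the whole geometry and so equals it; hence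
    \<open>f\<close> carries complements in \<open>A\<close> to complements in
    \<open>gf2_space ?k\<close>.\<close>
  have "card T' = card ?P" using bij_betw_same_card[OF f(1)] by simp
  also have "\<dots> = card (gf2_space ?k - {0})"
    using cA card_gf2_space gf2.subspace_0[OF A(1)] gf2.subspace_0[OF subspace_gf2_space]
    by (simp add: card_Diff_singleton)
  finally have eq: "T' = gf2_space ?k - {0}"
    using T'V by (intro card_subset_eq) (auto simp: finite_gf2_space)
  have fT: "f ` T \<subseteq> gf2_space ?k - {0}" using T(2) im eq by blast
  have fin: "finite X" if "X \<subseteq> ?P" for X using that A(2) by (meson finite_Diff finite_subset)
  have iso: "matroid_iso (vector_matroid X) (vector_matroid (f ` X))" if "X \<subseteq> ?P" for X
    using f(2) that by (intro vector_matroid_iso_image inj_on_subset[OF inj]) auto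
  have "comatroid_set (f ` T)"
    by (rule comatroid_set_iso[OF T(1) iso[OF T(2)]]) (use fin[OF T(2)] in simp)
  then have "comatroid_set (gf2_space ?k - {0} - f ` T)" using fT by (rule comatroid_set_complement)
  also have "gf2_space ?k - {0} - f ` T = f ` (?P - T)"
    using inj_on_image_set_diff[OF inj, of ?P T] T(2) im eq by auto
  finally show ?thesis
    by (rule comatroid_set_iso[OF _ matroid_iso_sym[OF iso]]) (use fin in auto)
qed

lemma is_circuit_iso:
  assumes "matroid_iso M N" "is_circuit N"
  shows "is_circuit M"
proof -
  obtain f where f: "bij_betw f (ground M) (ground N)"
    "\<And>X. X \<subseteq> ground M \<Longrightarrow> X \<in> indeps M \<longleftrightarrow> f ` X \<in> indeps N"
    using assms(1) unfolding matroid_iso_def by blast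
  have inj: "inj_on f (ground M)" and im: "f ` ground M = ground N"
    using f(1) by (auto simp: bij_betw_def)
  have N: "ground N \<notin> indeps N" "\<And>D. D \<subset> ground N \<Longrightarrow> D \<in> indeps N"
    using assms(2) by (auto simp: is_circuit_def matroid_circuit_def)
  have "D \<in> indeps M" if D: "D \<subset> ground M" for D
  proof -
    have "f ` D \<subset> f ` ground M" 
      using D inj_on_image_eq_iff[OF inj, of D "ground M"] by blast
    then show ?thesis using f(2)[of D] N(2) im D by auto
  qed
  moreover have "ground M \<notin> indeps M" using f(2)[of "ground M"] N(1) im by simp
  ultimately show ?thesis by (simp add: is_circuit_def matroid_circuit_def)
qed

lemma is_circuit_vector_matroid:
  assumes "gf2_circuit C"
  shows "is_circuit (vector_matroid C)"
proof -
  have "gf2.dependent C"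
    using assms by (auto simp: gf2_circuit_def gf2_independent_iff_sum)
  moreover have "gf2.independent D" if "D \<subset> C" for D
    unfolding gf2_independent_iff_sum using assms that unfolding gf2_circuit_def by blast
  ultimately show ?thesis by (auto simp: is_circuit_def matroid_circuit_def)
qed

text \<open>A set separable on the whole space is the direct sum of its parts in two proper
  subspaces, which are comatroids by minimality. The complement of \<open>T\<close> inherits
  minimality by complementing within each subspace, so neither colour is separable. On proper
  subspaces hereditary separability applies.\<close>

lemma minimal_non_comatroid_critical:
  assumes n: "6 \<le> n" and T: "T \<subseteq> gf2_space n - {0}" and non: "\<not> comatroid_set T"
    and proper: "\<And>W. gf2.subspace W \<Longrightarrow> W \<subset> gf2_space n \<Longrightarrow> comatroid_set (T \<inter> W)"
  shows "critical_colouring n T (gf2_space n - {0} - T)"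
proof -
  let ?V = "gf2_space n"
  let ?R = "?V - {0} - T"
  have fV: "finite X" if "X \<subseteq> ?V" for X using that finite_gf2_space finite_subset by blast
  have z: "0 \<in> ?V" by (rule gf2.subspace_0[OF subspace_gf2_space])
  have sep: "comatroid_set S"
    if S: "S \<subseteq> ?V - {0}" "\<not> inseparable S ?V"
      and pr: "\<And>W. gf2.subspace W \<Longrightarrow> W \<subset> ?V \<Longrightarrow> comatroid_set (S \<inter> W)" for S
  proof -
    obtain A B where A: "gf2.subspace A" "gf2.subspace B" "A \<inter> B = {0}" "S \<inter> ?V \<subseteq> A \<union> B"
      "\<not> ?V \<subseteq> A" "\<not> ?V \<subseteq> B" using S(2) by (rule not_inseparableE)
    have sub: "gf2.subspace (A \<inter> ?V)" "gf2.subspace (B \<inter> ?V)"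
      using gf2.subspace_inter A(1,2) subspace_gf2_space by blast+
    have int: "(A \<inter> ?V) \<inter> (B \<inter> ?V) = {0}" using A(3) z by auto
    have "A \<inter> ?V \<subset> ?V" "B \<inter> ?V \<subset> ?V" using A(5,6) by blast+
    then have "comatroid_set (S \<inter> (A \<inter> ?V))" "comatroid_set (S \<inter> (B \<inter> ?V))"
      using pr sub by blast+
    then have "comatroid_set (S \<inter> (A \<inter> ?V) \<union> S \<inter> (B \<inter> ?V))"
      using S(1) by (intro comatroid_set_Un[OF sub int]) auto
    moreover have "S \<inter> (A \<inter> ?V) \<union> S \<inter> (B \<inter> ?V) = S"
      using A(4) S(1) by blast
    ultimately show ?thesis by simp
  qed
  show ?thesis
  proof
    show "6 \<le> n" by fact
    show "T \<union> ?R = ?V - {0}" "T \<inter> ?R = {}" using T by blast+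
    show "inseparable T ?V" using sep[OF T _ proper] non by blast
    show "inseparable ?R ?V"
    proof (rule ccontr)
      assume R: "\<not> inseparable ?R ?V"
      have "comatroid_set (?R \<inter> W)" if W: "gf2.subspace W" "W \<subset> ?V" for W
      proof -
        have "comatroid_set (W - {0} - T \<inter> W)"
          using W T by (intro comatroid_set_complement_subspace[OF _ fV _ proper]) auto
        moreover have "W - {0} - T \<inter> W = ?R \<inter> W" using W(2) by blast
        ultimately show ?thesis by simp
      qed
      then have "comatroid_set ?R" using sep[OF _ R] by blast
      then have "comatroid_set (?V - {0} - ?R)" by (rule comatroid_set_complement) blast
      moreover have "?V - {0} - ?R = T" using T by blast
      ultimately show False using non by simp
    qed
    fix W assume W: "gf2.subspace W" "W \<subset> ?V" "4 \<le> card W"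
    have "hereditarily_separable (T \<inter> W)"
      using T by (intro gen_comatroid_hereditarily_separable[OF proper[OF W(1,2)], of n]) blast
    then have "\<not> inseparable (T \<inter> W) W \<or> \<not> inseparable (- (T \<inter> W)) W"
      using W(1,3) unfolding hereditarily_separable_def by blast
    moreover have "inseparable (T \<inter> W) W \<longleftrightarrow> inseparable T W"
      by (rule inseparable_cong) blast
    moreover have "inseparable (- (T \<inter> W)) W \<longleftrightarrow> inseparable ?R W"
      by (rule inseparable_cong) (use W(2) in blast)
    ultimately show "\<not> inseparable T W \<or> \<not> inseparable ?R W" by blast
  qed
qed

section \<open>From flats of the matroid to subspaces\<close>

lemma matroid_rank_of_witness:
  assumes "matroid M"
  obtains I where "I \<in> indeps M" "I \<subseteq> X" "card I = matroid_rank_of M X"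
proof -
  let ?S = "{I \<in> indeps M. I \<subseteq> X}"
  have "?S \<subseteq> Pow (ground M)" "finite (ground M)" "{} \<in> ?S"
    using assms by (auto simp: matroid_def)
  then have "finite ?S" "?S \<noteq> {}" by (metis finite_Pow_iff finite_subset, blast)
  then have "Max (card ` ?S) \<in> card ` ?S" by (intro Max_in) auto
  then show thesis using that unfolding matroid_rank_of_def by auto
qed

lemma card_le_matroid_rank_of:
  assumes "matroid M" "I \<in> indeps M" "I \<subseteq> X"
  shows "card I \<le> matroid_rank_of M X"
proof -
  have "{I \<in> indeps M. I \<subseteq> X} \<subseteq> Pow (ground M)" "finite (ground M)"
    using assms by (auto simp: matroid_def)
  then have "finite {I \<in> indeps M. I \<subseteq> X}" by (metis finite_Pow_iff finite_subset)
  then show ?thesis unfolding matroid_rank_of_def using assms(2,3) by (intro Max_ge) auto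
qed

theorem theorem4p7:
  fixes M :: "'a matroid"
  assumes "matroid M" and "simple_matroid M" and "binary_matroid M"
    and "\<not> binary_comatroid M"
    and "\<And>F. matroid_flat M F \<Longrightarrow> F \<noteq> ground M \<Longrightarrow> binary_comatroid (restriction M F)"
    and "6 \<le> matroid_rank M"
  shows "is_circuit M \<or> is_circuit (binary_complement M)"
proof -
  define n where "n = matroid_rank M"
  let ?V = "gf2_space n"
  obtain T where T: "T \<subseteq> ground (PG2 n)" "matroid_iso M (restriction (PG2 n) T)"
    using PG2_embedding_exists[OF assms(1-3)] unfolding n_def by blast
  have TV: "T \<subseteq> ?V - {0}" using T(1) by simp
  have fT: "finite T" using TV finite_gf2_space finite_subset by (metis finite_Diff)
  have isoT: "matroid_iso M (vector_matroid T)" using T(2) restriction_PG2[OF TV] by simp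
  then obtain f where f: "bij_betw f (ground M) T"
    and ind0: "\<And>X. X \<subseteq> ground M \<Longrightarrow> X \<in> indeps M \<longleftrightarrow> f ` X \<in> indeps (vector_matroid T)"
    unfolding matroid_iso_def by auto
  have inj: "inj_on f (ground M)" and im: "f ` ground M = T" using f by (auto simp: bij_betw_def)
  have ind: "X \<in> indeps M \<longleftrightarrow> gf2.independent (f ` X)" if "X \<subseteq> ground M" for X
    using ind0[OF that] that im by auto
  have M_sub: "I \<subseteq> ground M" if "I \<in> indeps M" for I using assms(1) that by (auto simp: matroid_def)
  have fM: "finite (ground M)" using assms(1) by (simp add: matroid_def)

  \<comment> \<open>A basis of \<open>M\<close> gives \<open>n\<close> independent vectors in
    \<open>T\<close>. Hence points of \<open>M\<close> mapped into a proper subspace never exhaust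
    the ground set.\<close>
  have spanning: "\<not> T \<subseteq> W" if W: "gf2.subspace W" "W \<subset> ?V" for W
  proof
    assume TW: "T \<subseteq> W"
    obtain I where I: "I \<in> indeps M" "card I = n"
      using matroid_rank_of_witness[OF assms(1), of "ground M"] unfolding n_def matroid_rank_def by metis
    have IM: "I \<subseteq> ground M" by (rule M_sub[OF I(1)])
    have "card (f ` I) = n" using card_image[OF inj_on_subset[OF inj IM]] I(2) by simp
    moreover have "finite (f ` I)" "gf2.independent (f ` I)"
      using IM fM finite_subset ind[OF IM] I(1) by auto
    ultimately have c: "card (gf2.span (f ` I)) = card ?V"
      using card_span_independent card_gf2_space by metis
    have "gf2.span (f ` I) \<subseteq> W" using IM im TW by (intro gf2.span_minimal[OF _ W(1)]) blast
    then have "card ?V \<le> card W"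
      unfolding c[symmetric] using finite_subset[of W ?V] W(2) finite_gf2_space by (intro card_mono) auto
    moreover have "card W < card ?V" using W(2) finite_gf2_space by (intro psubset_card_mono) auto
    ultimately show False by simp
  qed

  have proper: "comatroid_set (T \<inter> W)" if W: "gf2.subspace W" "W \<subset> ?V" for W
  proof -
    \<comment> \<open>The preimage of a proper subspace is a proper flat, so minimality in terms of
      flats carries over to subspaces.\<close>
    define F where "F = {x \<in> ground M. f x \<in> W}"
    have FM: "F \<subseteq> ground M" and fF: "f ` F = T \<inter> W" unfolding F_def using im by auto
    have "F \<noteq> ground M" using spanning[OF W] im unfolding F_def by blast
    moreover have "matroid_flat M F"
    proof -
      \<comment> \<open>Otherwise \<open>x\<close> could be added to a largest independent subset of
        \<open>F\<close>, since its image lies outside \<open>W\<close>, and the rank would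
        grow.\<close>
      have "x \<in> F" if x: "x \<in> ground M" "matroid_rank_of M (insert x F) = matroid_rank_of M F" for x
      proof (rule ccontr)
        assume "x \<notin> F"
        then have xW: "f x \<notin> W" using x(1) unfolding F_def by blast
        obtain I where I: "I \<in> indeps M" "I \<subseteq> F" "card I = matroid_rank_of M F"
          using matroid_rank_of_witness[OF assms(1)] by metis
        have IM: "I \<subseteq> ground M" using I(2) FM by blast
        have "gf2.span (f ` I) \<subseteq> W"
          using I(2) unfolding F_def by (intro gf2.span_minimal[OF _ W(1)]) blast
        then have "f x \<notin> gf2.span (f ` I)" using xW by blast
        then have "gf2.independent (f ` insert x I)"
          using ind[OF IM] I(1) by (simp add: gf2.independent_insert)
        then have "insert x I \<in> indeps M" using ind[of "insert x I"] IM x(1) by blast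
        then have "card (insert x I) \<le> matroid_rank_of M (insert x F)"
          using I(2) by (intro card_le_matroid_rank_of[OF assms(1)]) auto
        moreover have "card (insert x I) = Suc (card I)"
          using \<open>x \<notin> F\<close> I(2) finite_subset[OF IM fM]
          by (intro card_insert_disjoint) auto
        ultimately show False using x(2) I(3) by simp
      qed
      moreover have "matroid_rank_of M (insert x F) = matroid_rank_of M F" if "x \<in> F" for x
        using that by (simp add: insert_absorb)
      ultimately have "matroid_closure M F = F" unfolding matroid_closure_def using FM by blast
      then show ?thesis unfolding matroid_flat_def using FM by simp
    qed
    ultimately have "binary_comatroid (restriction M F)" using assms(5) by blast
    then obtain N where N: "gen_comatroid N" "matroid_iso (restriction M F) N"
      unfolding binary_comatroid_def by blast
    have "matroid_iso (restriction M F) (vector_matroid (T \<inter> W))"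
      unfolding matroid_iso_def
    proof (intro exI[of _ f] conjI allI impI)
      show "bij_betw f (ground (restriction M F)) (ground (vector_matroid (T \<inter> W)))"
        using inj_on_subset[OF inj FM] fF FM by (simp add: bij_betw_def Int_absorb1)
      fix X assume "X \<subseteq> ground (restriction M F)"
      then have X: "X \<subseteq> F" "X \<subseteq> ground M" by auto
      then have "f ` X \<subseteq> T \<inter> W" using fF by blast
      then show "X \<in> indeps (restriction M F) \<longleftrightarrow> f ` X \<in> indeps (vector_matroid (T \<inter> W))"
        using X ind[OF X(2)] by simp
    qed
    then have "matroid_iso N (vector_matroid (T \<inter> W))"
      by (rule matroid_iso_trans[OF matroid_iso_sym[OF N(2)]])
    then show ?thesis using fT by (intro gen_comatroid.iso[OF N(1)] matroid_vector_matroid) auto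
  qed

  have non: "\<not> comatroid_set T" using assms(1,4) isoT unfolding binary_comatroid_def by blast
  interpret critical_colouring n T "?V - {0} - T"
    by (rule minimal_non_comatroid_critical[OF _ TV non proper]) (use assms(6) in \<open>simp_all add: n_def\<close>)
  have isoR: "matroid_iso (binary_complement M) (vector_matroid (?V - {0} - T))"
    using gf2_complement_unique[OF T] unfolding binary_complement_def n_def[symmetric] deletion_PG2 .
  show ?thesis
    using circuit is_circuit_iso[OF isoT is_circuit_vector_matroid] is_circuit_iso[OF isoR is_circuit_vector_matroid]
    by blast
qed

end
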